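(* Let $\{S_n\}_{n\ge0}$ be the SRRW-RVM with memory sequence $\{\mu_n\}$ (regularly varying of index $\gamma>-1$), recollection probability $p$, and zero mean innovation sequence $\{\xi_n\}_{n\ge1}$ satisfying $\mathbb{E}\xi_1^2=1$. If $\{v_n\}$ is bounded and $p\in[p_c,1]$ (with $p\ge0$), then $$\left(a_n\mu_nS_{\lfloor nt\rfloor}:t\ge0\right)\to\left(\frac{p(\gamma+1)}{p(\gamma+1)-\gamma}\,t^{\,p(\gamma+1)-\gamma}M_\infty:t\ge0\right)\quad\text{in }L^2\text{ and almost surely, in }D([0,\infty)),$$ where $M_\infty$ is the almost sure and $L^2$ limit of the martingale $M_n$.
   Context: Model (SRRW-RVM). Fix $p\in[0,1]$ (recollection probability) and $\gamma>-1$. Let $\{\mu_n\}_{n\ge1}$ (memory sequence) be a sequence of positive reals, regularly varying of index $\gamma$: $\mu_{\lfloor\lambda n\rfloor}/\mu_n\to\lambda^\gamma$ for every $\lambda>0$. Put $\nu_n=\sum_{k=1}^n\mu_k$. Let $\{\xi_n\}_{n\ge1}$ (innovation sequence) be i.i.d. real random variables with mean $0$; $\{\alpha_n\}_{n\ge2}$ i.i.d. Bernoulli($p$); $\{\beta_n\}_{n\ge2}$ independent with $\mathbb{P}(\beta_n=k)=\mu_k/\nu_{n-1}$ for $1\le k\le n-1$; the three sequences are independent of each other. Set $X_1=\xi_1$ and, for $n\ge1$, $X_{n+1}=\alpha_{n+1}X_{\beta_{n+1}}+(1-\alpha_{n+1})\xi_{n+1}$. The walk is $S_0=0$, $S_n=\sum_{k=1}^nX_k$.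 Notation. $a_n=\prod_{i=1}^{n-1}\left(1+p\frac{\mu_{i+1}}{\nu_i}\right)^{-1}$ for $n\ge1$ (so $a_1=1$); $v_n^2=\sum_{k=1}^na_k^2\mu_k^2$ ($v_n\ge0$); $p_c=(\gamma+\frac12)/(\gamma+1)$. $M_n=a_n\sum_{k=1}^n\mu_kX_k$ is a martingale with respect to the filtration $\mathcal{F}_n=\sigma(\xi_1,\ldots,\xi_n,\beta_2,\ldots,\beta_n,\alpha_2,\ldots,\alpha_n)$; when $\{v_n\}$ is bounded it is $L^2$-bounded and $M_\infty$ denotes its almost sure and $L^2$ limit. $D([0,\infty))$ is the space of r.c.l.l. functions on $[0,\infty)$ with the Skorohod topology. Convergence almost surely (resp. in $L^2$) in $D([0,\infty))$ of processes $Y_n$ to a process $Y$ with continuous paths means: for every $T>0$, $\sup_{0\le t\le T}|Y_n(t)-Y(t)|\to0$ almost surely (resp. in $L^2$). *)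

theory Defs
  imports "HOL-Probability.Probability"
begin

text \<open>Sequences are indexed from 1; the value of a memory sequence at 0 is never used.\<close>

definition regularly_varying :: "real \<Rightarrow> (nat \<Rightarrow> real) \<Rightarrow> bool" where
  "regularly_varying \<gamma> \<mu> \<longleftrightarrow>
     (\<forall>n\<ge>1. 0 < \<mu> n) \<and>
     (\<forall>c>0. (\<lambda>n. \<mu> (nat \<lfloor>c * real n\<rfloor>) / \<mu> n) \<longlonglongrightarrow> c powr \<gamma>)"

definition nu :: "(nat \<Rightarrow> real) \<Rightarrow> nat \<Rightarrow> real" where
  "nu \<mu> n = (\<Sum>k=1..n. \<mu> k)"

definition a_seq :: "real \<Rightarrow> (nat \<Rightarrow> real) \<Rightarrow> nat \<Rightarrow> real" where
  "a_seq p \<mu> n = (\<Prod>i=1..<n. inverse (1 + p * (\<mu> (i + 1) / nu \<mu> i)))"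

definition v_seq :: "real \<Rightarrow> (nat \<Rightarrow> real) \<Rightarrow> nat \<Rightarrow> real" where
  "v_seq p \<mu> n = sqrt (\<Sum>k=1..n. (a_seq p \<mu> k)\<^sup>2 * (\<mu> k)\<^sup>2)"

definition p_crit :: "real \<Rightarrow> real" where
  "p_crit \<gamma> = (\<gamma> + 1/2) / (\<gamma> + 1)"

definition generated_sets ::
    "'a measure \<Rightarrow> 'b measure \<Rightarrow> (nat \<Rightarrow> 'a \<Rightarrow> 'b) \<Rightarrow> nat set \<Rightarrow> 'a set set" where
  "generated_sets M N Y I =
     sigma_sets (space M) (\<Union>i\<in>I. {Y i -` A \<inter> space M | A. A \<in> sets N})"

datatype source = Innovation | Recollection | Recalled_Time

locale srrw_rvm = prob_space M for M :: "'a measure" +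
  fixes p \<gamma> :: real
    and \<mu> :: "nat \<Rightarrow> real"
    and \<xi> :: "nat \<Rightarrow> 'a \<Rightarrow> real"
    and \<alpha> :: "nat \<Rightarrow> 'a \<Rightarrow> bool"
    and \<beta> :: "nat \<Rightarrow> 'a \<Rightarrow> nat"
  assumes p_range: "p \<in> {0..1}"
    and gamma_gt: "\<gamma> > -1"
    and memory: "regularly_varying \<gamma> \<mu>"
    and xi_indep: "indep_vars (\<lambda>_. borel) \<xi> {1..}"
    and xi_ident: "\<And>n. n \<ge> 1 \<Longrightarrow> distr M borel (\<xi> n) = distr M borel (\<xi> 1)"
    and xi_integrable: "integrable M (\<xi> 1)"
    and xi_mean: "expectation (\<xi> 1) = 0"
    and alpha_indep: "indep_vars (\<lambda>_. count_space UNIV) \<alpha> {2..}"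
    and alpha_distr:
      "\<And>n. n \<ge> 2 \<Longrightarrow> distr M (count_space UNIV) (\<alpha> n) = measure_pmf (bernoulli_pmf p)"
    and beta_indep: "indep_vars (\<lambda>_. count_space UNIV) \<beta> {2..}"
    and beta_distr:
      "\<And>n k. n \<ge> 2 \<Longrightarrow> k \<in> {1..n - 1} \<Longrightarrow>
         prob {\<omega> \<in> space M. \<beta> n \<omega> = k} = \<mu> k / nu \<mu> (n - 1)"
    and sources_indep:
      "indep_sets (\<lambda>s. case s of
           Innovation \<Rightarrow> generated_sets M borel \<xi> {1..}
         | Recollection \<Rightarrow> generated_sets M (count_space UNIV) \<alpha> {2..}
         | Recalled_Time \<Rightarrow> generated_sets M (count_space UNIV) \<beta> {2..}) UNIV"

text \<open>The steps, indexed from 1. The law of \<open>\<beta> n\<close> only gives \<open>\<beta> n \<omega> \<in> {1..n - 1}\<close> almost surely;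
  on the exceptional null set the recalled step is taken to be 0.\<close>

fun srrw_step ::
    "(nat \<Rightarrow> 'a \<Rightarrow> real) \<Rightarrow> (nat \<Rightarrow> 'a \<Rightarrow> bool) \<Rightarrow> (nat \<Rightarrow> 'a \<Rightarrow> nat) \<Rightarrow> nat \<Rightarrow> 'a \<Rightarrow> real" where
  "srrw_step \<xi> \<alpha> \<beta> 0 \<omega> = 0"
| "srrw_step \<xi> \<alpha> \<beta> (Suc n) \<omega> =
     (if n = 0 then \<xi> 1 \<omega>
      else of_bool (\<alpha> (Suc n) \<omega>) *
             (if \<beta> (Suc n) \<omega> \<in> {1..n} then srrw_step \<xi> \<alpha> \<beta> (\<beta> (Suc n) \<omega>) \<omega> else 0)
           + (1 - of_bool (\<alpha> (Suc n) \<omega>)) * \<xi> (Suc n) \<omega>)"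

declare srrw_step.simps(2) [simp del]

definition srrw_walk ::
    "(nat \<Rightarrow> 'a \<Rightarrow> real) \<Rightarrow> (nat \<Rightarrow> 'a \<Rightarrow> bool) \<Rightarrow> (nat \<Rightarrow> 'a \<Rightarrow> nat) \<Rightarrow> nat \<Rightarrow> 'a \<Rightarrow> real" where
  "srrw_walk \<xi> \<alpha> \<beta> n \<omega> = (\<Sum>k=1..n. srrw_step \<xi> \<alpha> \<beta> k \<omega>)"

definition srrw_mart ::
    "real \<Rightarrow> (nat \<Rightarrow> real) \<Rightarrow> (nat \<Rightarrow> 'a \<Rightarrow> real) \<Rightarrow> (nat \<Rightarrow> 'a \<Rightarrow> bool) \<Rightarrow> (nat \<Rightarrow> 'a \<Rightarrow> nat)
      \<Rightarrow> nat \<Rightarrow> 'a \<Rightarrow> real" where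
  "srrw_mart p \<mu> \<xi> \<alpha> \<beta> n \<omega> = a_seq p \<mu> n * (\<Sum>k=1..n. \<mu> k * srrw_step \<xi> \<alpha> \<beta> k \<omega>)"

text \<open>The pointwise limit; where the martingale diverges, \<open>lim\<close> is an unspecified constant.\<close>

definition srrw_mart_lim ::
    "real \<Rightarrow> (nat \<Rightarrow> real) \<Rightarrow> (nat \<Rightarrow> 'a \<Rightarrow> real) \<Rightarrow> (nat \<Rightarrow> 'a \<Rightarrow> bool) \<Rightarrow> (nat \<Rightarrow> 'a \<Rightarrow> nat)
      \<Rightarrow> 'a \<Rightarrow> real" where
  "srrw_mart_lim p \<mu> \<xi> \<alpha> \<beta> \<omega> = lim (\<lambda>n. srrw_mart p \<mu> \<xi> \<alpha> \<beta> n \<omega>)"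

definition converges_AE ::
    "'a measure \<Rightarrow> (nat \<Rightarrow> 'a \<Rightarrow> real) \<Rightarrow> ('a \<Rightarrow> real) \<Rightarrow> bool" where
  "converges_AE M Y Z \<longleftrightarrow> (AE \<omega> in M. (\<lambda>n. Y n \<omega>) \<longlonglongrightarrow> Z \<omega>)"

definition converges_L2 ::
    "'a measure \<Rightarrow> (nat \<Rightarrow> 'a \<Rightarrow> real) \<Rightarrow> ('a \<Rightarrow> real) \<Rightarrow> bool" where
  "converges_L2 M Y Z \<longleftrightarrow>
     Z \<in> borel_measurable M \<and> integrable M (\<lambda>\<omega>. (Z \<omega>)\<^sup>2) \<and>
     (\<lambda>n. \<integral>\<^sup>+\<omega>. ennreal ((Y n \<omega> - Z \<omega>)\<^sup>2) \<partial>M) \<longlonglongrightarrow> 0"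

text \<open>Processes on \<open>[0,\<infty>)\<close> are written with the time argument first. The uniform distance is
  \<open>ennreal\<close>-valued, so that the supremum and its second moment are meaningful without any
  boundedness or integrability proviso. The two notions below are convergence in
  \<open>D([0,\<infty>))\<close> when the limit process has continuous paths.\<close>

definition unif_dist :: "real \<Rightarrow> (real \<Rightarrow> real) \<Rightarrow> (real \<Rightarrow> real) \<Rightarrow> ennreal" where
  "unif_dist T y z = (SUP t\<in>{0..T}. ennreal \<bar>y t - z t\<bar>)"

definition converges_AE_D ::
    "'a measure \<Rightarrow> (nat \<Rightarrow> real \<Rightarrow> 'a \<Rightarrow> real) \<Rightarrow> (real \<Rightarrow> 'a \<Rightarrow> real) \<Rightarrow> bool" where
  "converges_AE_D M Y Z \<longleftrightarrow>
     (\<forall>T>0. AE \<omega> in M. (\<lambda>n. unif_dist T (\<lambda>t. Y n t \<omega>) (\<lambda>t. Z t \<omega>)) \<longlonglongrightarrow> 0)"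

definition converges_L2_D ::
    "'a measure \<Rightarrow> (nat \<Rightarrow> real \<Rightarrow> 'a \<Rightarrow> real) \<Rightarrow> (real \<Rightarrow> 'a \<Rightarrow> real) \<Rightarrow> bool" where
  "converges_L2_D M Y Z \<longleftrightarrow>
     (\<forall>T>0. (\<lambda>n. \<integral>\<^sup>+\<omega>. (unif_dist T (\<lambda>t. Y n t \<omega>) (\<lambda>t. Z t \<omega>))\<^sup>2 \<partial>M) \<longlonglongrightarrow> 0)"

end

theory Submission
  imports Defs "HOL-Real_Asymp.Real_Asymp"
begin

text \<open>
  Write \<open>Y\<^sub>n = \<Sum>k\<le>n. \<mu>\<^sub>k X\<^sub>k\<close> and \<open>D\<^sub>n\<^sub>+\<^sub>1 = X\<^sub>n\<^sub>+\<^sub>1 - p Y\<^sub>n / \<nu>\<^sub>n\<close>. The \<open>D\<^sub>k\<close> are martingale differences of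
  variance at most 1, \<open>M\<^sub>n = \<Sum>k\<le>n. a\<^sub>k \<mu>\<^sub>k D\<^sub>k\<close>, and \<open>S\<^sub>n = \<Sum>k\<le>n. D\<^sub>k + p (\<Sum>k<n. w\<^sub>k M\<^sub>k)\<close> with
  \<open>w\<^sub>k = 1 / (a\<^sub>k \<nu>\<^sub>k)\<close>. Karamata's theorem \<open>n \<mu>\<^sub>n / \<nu>\<^sub>n \<longlonglongrightarrow> \<gamma> + 1\<close> makes \<open>W\<^sub>n = \<Sum>k<n. w\<^sub>k\<close>
  regularly varying of index \<open>\<kappa> = p (\<gamma> + 1) - \<gamma> > 0\<close> with \<open>a\<^sub>n \<mu>\<^sub>n W\<^sub>n \<longlonglongrightarrow> (\<gamma> + 1) / \<kappa>\<close>. As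
  \<open>v\<^sub>n\<close> is bounded, \<open>\<Sum>n. 1 / W\<^sub>n\<^sup>2\<close> converges, so Kronecker's lemma and Doob's inequality show that
  the sum of the \<open>D\<^sub>k\<close> is negligible against \<open>W\<^sub>n\<close>, while \<open>\<Sum>k<n. w\<^sub>k M\<^sub>k\<close> is a weighted average
  with limit \<open>M\<^sub>\<infinity> W\<^sub>n\<close>. Monotonicity of \<open>W\<close> yields uniformity in time.
\<close>

section \<open>Regularly varying sequences\<close>

text \<open>Two obstacles shape the argument. Regular variation is given only along
  \<open>\<lfloor>c * n\<rfloor>\<close> for each fixed \<open>c\<close>, while Karamata's theorem
  compares all indices of a window at once; a uniform version has to come first. And
  \<open>a\<^sub>n \<mu>\<^sub>n\<close> need not be monotone, whereas Kronecker's lemma and suprema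
  over time call for a monotone normalization; \<open>1 + W\<^sub>n\<close> is increasing and of the
  order of \<open>1 / (a\<^sub>n \<mu>\<^sub>n)\<close>, so it takes over that role. The constants
  come from two limits, \<open>a\<^sub>n \<mu>\<^sub>n (n w\<^sub>n) = n \<mu>\<^sub>n /
  \<nu>\<^sub>n \<longlonglongrightarrow> \<gamma> + 1\<close> and
  \<open>n w\<^sub>n / W\<^sub>n \<longlonglongrightarrow> \<kappa>\<close>; their quotient is the
  limit of \<open>a\<^sub>n \<mu>\<^sub>n W\<^sub>n\<close>, and the factor \<open>p\<close> of the
  decomposition completes the constant of the limit process. Since
  \<open>a\<^sub>n \<mu>\<^sub>n \<longlonglongrightarrow> 0\<close>, the first limit also forces
  \<open>W\<^sub>n\<close> to diverge. The condition on \<open>p\<close> says that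
  \<open>\<kappa> \<ge> 1/2\<close>. The martingale property enters as orthogonality of
  \<open>D\<^sub>n\<^sub>+\<^sub>1\<close> to square-integrable functions of the past, which a
  pathwise form of Doob's inequality turns into the maximal bound.\<close>

text \<open>Uniform convergence theorem, by measure: the multipliers that are good from
  \<open>N\<close> on fill almost all of \<open>{1..4}\<close>, so the good sets scaled by
  \<open>n\<close> and by \<open>m\<close> must meet. The window factor 3, rather than 2, covers the
  pair \<open>n div 2\<close>, \<open>n\<close> for odd \<open>n\<close>.\<close>

lemma regularly_varying_uniform:
  assumes rv: "regularly_varying \<gamma> \<mu>" and e: "e > 0"
  shows "\<exists>N\<ge>1. \<forall>n m. N \<le> n \<longrightarrow> n \<le> m \<longrightarrow> m \<le> 3 * n \<longrightarrow>
    \<bar>ln (\<mu> m / \<mu> n) - \<gamma> * ln (real m / real n)\<bar> \<le> e"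
proof -
  have pos: "\<mu> n > 0" if "n \<ge> 1" for n
    using rv that by (auto simp: regularly_varying_def)
  define h where "h = (\<lambda>u n. ln (\<mu> (nat \<lfloor>u * real n\<rfloor>) / \<mu> n) - \<gamma> * ln u)"
  define E where "E = (\<lambda>N. {u \<in> {1..4}. \<forall>n\<ge>N. \<bar>h u n\<bar> \<le> e / 2})"
  have meas: "E N \<in> sets lborel" for N
    unfolding E_def h_def by measurable
  have fin: "E N \<in> fmeasurable lborel" for N
  proof (rule fmeasurableI2[of "{1..4::real}"])
    show "E N \<subseteq> {1..4}" by (auto simp: E_def)
    show "{1..4::real} \<in> fmeasurable lborel" by (intro fmeasurableI) auto
  qed (use meas in auto)
  have lim: "(\<lambda>n. h u n) \<longlonglongrightarrow> 0" if "u \<in> {1..4}" for u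
  proof -
    have "(\<lambda>n. \<mu> (nat \<lfloor>u * real n\<rfloor>) / \<mu> n) \<longlonglongrightarrow> u powr \<gamma>"
      using rv that by (auto simp: regularly_varying_def)
    then have "(\<lambda>n. ln (\<mu> (nat \<lfloor>u * real n\<rfloor>) / \<mu> n)) \<longlonglongrightarrow> ln (u powr \<gamma>)"
      using that by (intro tendsto_ln) auto
    then show ?thesis using that unfolding h_def
      by (subst LIM_zero_iff) (auto simp: ln_powr)
  qed
  have UN: "(\<Union>N. E N) = {1..4}"
  proof
    show "{1..4} \<subseteq> (\<Union>N. E N)"
    proof
      fix u :: real assume u: "u \<in> {1..4}"
      have "eventually (\<lambda>n. \<bar>h u n\<bar> < e / 2) sequentially"
        using tendstoD[OF lim[OF u], of "e/2"] e by (simp add: dist_real_def)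
      then obtain N where "\<forall>n\<ge>N. \<bar>h u n\<bar> < e / 2" by (auto simp: eventually_sequentially)
      then show "u \<in> (\<Union>N. E N)" using u by (auto simp: E_def intro!: exI[of _ N] less_imp_le)
    qed
  qed (auto simp: E_def)
  have "(\<lambda>N. measure lborel (E N)) \<longlonglongrightarrow> measure lborel (\<Union>N. E N)"
  proof (rule Lim_measure_incseq)
    show "range E \<subseteq> sets lborel" using meas by auto
    show "incseq E" by (auto simp: E_def incseq_def)
    show "emeasure lborel (\<Union>N. E N) \<noteq> \<infinity>" unfolding UN by simp
  qed
  then have "(\<lambda>N. measure lborel (E N)) \<longlonglongrightarrow> 3" unfolding UN by simp
  \<comment> \<open>This leaves bad multipliers of measure below 1/10. Scaled by \<open>n\<close>
    and by \<open>m\<close> they have total measure at most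
    \<open>(n + m) / 10 \<le> 2 * n / 5\<close>, less than the length
    \<open>4 * n - m \<ge> n\<close> of the interval from \<open>m\<close> to
    \<open>4 * n\<close>.\<close>
  then have "eventually (\<lambda>N. measure lborel (E N) > 29 / 10) sequentially"
    by (rule order_tendstoD) simp
  then have "eventually (\<lambda>N. measure lborel (E N) > 29 / 10 \<and> N \<ge> 1) sequentially"
    using eventually_ge_at_top[of 1] by eventually_elim auto
  then obtain N where N: "measure lborel (E N) > 29 / 10" "N \<ge> 1"
    using eventually_happens'[OF sequentially_bot] by blast
  show ?thesis
  proof (intro exI[of _ N] conjI allI impI)
    show "N \<ge> 1" by fact
    fix n m assume nm: "N \<le> n" "n \<le> m" "m \<le> 3 * n"
    have n0: "real n > 0" and m0: "real m > 0" using nm N by auto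
    define U where "U = (\<lambda>k. (\<lambda>x. real k * x) ` ({1..4} - E N))"
    have compl: "({1..4} - E N) \<in> lmeasurable" "measure lebesgue ({1..4} - E N) < 1 / 10"
    proof -
      have fin': "E N \<in> lmeasurable" using fin[of N] meas[of N]
        by (auto simp: fmeasurable_def)
      show "({1..4} - E N) \<in> lmeasurable" 
        by (rule fmeasurable.Diff[OF lmeasurable_interval(1) fin'])
      have "measure lebesgue ({1..4} - E N) = measure lebesgue {1..4::real} - measure lebesgue (E N)"
        by (rule measurable_measure_Diff[OF lmeasurable_interval(1) fmeasurableD[OF fin']]) (auto simp: E_def)
      also have "\<dots> < 1 / 10" using N meas[of N] by simp
      finally show "measure lebesgue ({1..4} - E N) < 1 / 10" .
    qed
    have Um: "U k \<in> lmeasurable" "measure lebesgue (U k) \<le> real k / 10" if k: "k \<in> {n, m}" for k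
    proof -
      have aff: "U k = (\<lambda>x. real k *\<^sub>R x + 0) ` ({1..4} - E N)" by (simp add: U_def)
      have "{1..4} - E N \<in> sets borel" using meas[of N] by simp
      then have "(\<lambda>x. x / real k) -` ({1..4} - E N) \<inter> space borel \<in> sets borel"
        by (intro measurable_sets[of _ borel borel]) auto
      moreover have "U k = (\<lambda>x. x / real k) -` ({1..4} - E N) \<inter> space borel"
        using k n0 m0 by (force simp: U_def image_iff)
      ultimately have "U k \<in> sets lebesgue" by simp
      moreover have "emeasure lebesgue (U k) < \<infinity>"
        unfolding aff emeasure_lebesgue_affine using compl(1)
        by (auto simp: ennreal_mult_less_top fmeasurable_def)
      ultimately show "U k \<in> lmeasurable" by (intro fmeasurableI)
      have "measure lebesgue (U k) = \<bar>real k\<bar> ^ DIM(real) * measure lebesgue ({1..4} - E N)"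
        unfolding aff by (rule measure_lebesgue_affine)
      also have "\<dots> \<le> real k * (1 / 10)"
        using compl(2) mult_left_mono[of "measure lebesgue ({1..4} - E N)" "1 / 10" "real k"] by simp
      finally show "measure lebesgue (U k) \<le> real k / 10" by simp
    qed
    have "measure lebesgue (U n \<union> U m) \<le> measure lebesgue (U n) + measure lebesgue (U m)"
      by (rule measure_Un_le) (use Um[of n] Um[of m] in auto)
    also have "\<dots> \<le> real n / 10 + real m / 10" using Um(2)[of n] Um(2)[of m] by simp
    also have "\<dots> < real (4 * n) - real m" using nm n0 by auto
    also have "\<dots> = measure lebesgue {real m..real (4 * n)}" using nm by simp
    finally have "\<not> {real m..real (4 * n)} \<subseteq> U n \<union> U m"
      using Um(1)[of n] Um(1)[of m] measure_mono_fmeasurable[of "{real m..real (4 * n)}" "U n \<union> U m" lebesgue]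
      by (auto simp: fmeasurable.Un)
    \<comment> \<open>\<open>\<mu>\<close> at \<open>\<lfloor>x\<rfloor>\<close> is compared with both \<open>\<mu> n\<close> and \<open>\<mu> m\<close>, along good multipliers \<open>x / n\<close> and \<open>x / m\<close>.\<close>
    then obtain x where "x \<in> {real m..real (4 * n)}" "x \<notin> U n \<union> U m" by blast
    then have x: "real m \<le> x" "x \<le> 4 * real n" "x \<notin> U n" "x \<notin> U m" by auto
    have inE: "x / real k \<in> E N" if "k \<in> {n, m}" for k
    proof (rule ccontr)
      assume "x / real k \<notin> E N"
      moreover have "x / real k \<in> {1..4}" using x nm n0 m0 that by (auto simp: field_simps)
      ultimately have "real k * (x / real k) \<in> U k" unfolding U_def by blast
      then show False using x that n0 m0 by auto
    qed
    define k where "k = nat \<lfloor>x\<rfloor>"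
    have kpos: "k \<ge> 1" using x nm N by (auto simp: k_def le_nat_floor)
    have x0: "x > 0" using x m0 by linarith
    have "\<bar>h (x / real n) n\<bar> \<le> e / 2" "\<bar>h (x / real m) m\<bar> \<le> e / 2"
      using inE nm by (auto simp: E_def)
    moreover have "h (x / real n) n = ln (\<mu> k) - ln (\<mu> n) - \<gamma> * (ln x - ln (real n))"
      "h (x / real m) m = ln (\<mu> k) - ln (\<mu> m) - \<gamma> * (ln x - ln (real m))"
      using n0 m0 x0 kpos nm N pos[of k] pos[of n] pos[of m]
      by (auto simp: h_def k_def[symmetric] ln_div)
    moreover have "ln (\<mu> m / \<mu> n) - \<gamma> * ln (real m / real n)
       = ln (\<mu> m) - ln (\<mu> n) - \<gamma> * (ln (real m) - ln (real n))"
      using n0 m0 nm N pos[of n] pos[of m] by (auto simp: ln_div)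
    ultimately show "\<bar>ln (\<mu> m / \<mu> n) - \<gamma> * ln (real m / real n)\<bar> \<le> e"
      by (auto simp: right_diff_distrib abs_if split: if_splits)
  qed
qed

section \<open>Karamata's theorem for partial sums\<close>

text \<open>Strong induction first bounds \<open>e\<close> globally; beyond
  \<open>2 ^ j * (N + 1)\<close> the recursion can then be applied \<open>j\<close> times, which
  shrinks that bound by \<open>l ^ j\<close>.\<close>

lemma halving_contraction:
  fixes e :: "nat \<Rightarrow> real"
  assumes nonneg: "\<And>n. e n \<ge> 0" and l: "0 \<le> l" "l < 1"
    and contr: "\<And>\<eta>. \<eta> > 0 \<Longrightarrow> eventually (\<lambda>n. e n \<le> l * e (n div 2) + \<eta>) sequentially"
  shows "e \<longlonglongrightarrow> 0"
proof (rule LIMSEQ_I)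
  fix r :: real assume r: "r > 0"
  \<comment> \<open>Chosen so that \<open>r / 2\<close> is the fixed point of the map from
    \<open>x\<close> to \<open>l * x + \<eta>\<close>.\<close>
  define \<eta> where "\<eta> = r * (1 - l) / 2"
  have \<eta>: "\<eta> > 0" using r l by (simp add: \<eta>_def)
  obtain N where N: "\<And>n. n \<ge> N \<Longrightarrow> e n \<le> l * e (n div 2) + \<eta>"
    using contr[OF \<eta>] by (auto simp: eventually_sequentially)
  define B where "B = (\<Sum>k\<le>N. e k)"
  have B0: "B \<ge> 0" using nonneg by (auto simp: B_def intro: sum_nonneg)
  have fix_pt: "\<eta> = (1 - l) * (r / 2)" by (simp add: \<eta>_def)
  have bd: "e n \<le> B + r / 2" for n
  proof (induction n rule: less_induct)
    case (less n)
    show ?case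
    proof (cases "n \<le> N")
      case True
      then have "e n \<le> B" unfolding B_def using nonneg by (intro member_le_sum) auto
      then show ?thesis using r by simp
    next
      case False
      then have "e (n div 2) \<le> B + r / 2" using less[of "n div 2"] by auto
      then have "e n \<le> l * (B + r / 2) + \<eta>"
        using N[of n] False l mult_left_mono[of "e (n div 2)" "B + r / 2" l] by auto
      also have "\<dots> = l * B + r / 2" by (simp add: fix_pt field_simps)
      also have "\<dots> \<le> B + r / 2" using l B0 mult_right_mono[of l 1 B] by simp
      finally show ?thesis .
    qed
  qed
  have it: "e n \<le> l ^ j * B + r / 2" if "n \<ge> 2 ^ j * (N + 1)" for n j
    using that
  proof (induction j arbitrary: n)
    case (Suc j)
    have "e (n div 2) \<le> l ^ j * B + r / 2" using Suc.prems by (intro Suc.IH) (auto simp: algebra_simps)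
    moreover have "n \<ge> N"
    proof -
      have "N + 1 \<le> 2 ^ Suc j * (N + 1)" using mult_le_mono1[of 1 "2 ^ Suc j" "N + 1"] by simp
      then show ?thesis using Suc.prems by linarith
    qed
    ultimately have "e n \<le> l * (l ^ j * B + r / 2) + \<eta>"
      using N[of n] l mult_left_mono[of "e (n div 2)" "l ^ j * B + r / 2" l] by auto
    also have "\<dots> = l ^ Suc j * B + r / 2" by (simp add: fix_pt field_simps)
    finally show ?case .
  qed (use bd in auto)
  have "(\<lambda>j. l ^ j * B) \<longlonglongrightarrow> 0 * B" using l by (intro tendsto_mult LIMSEQ_power_zero) auto
  then have "eventually (\<lambda>j. l ^ j * B < r / 2) sequentially"
    using r by (intro order_tendstoD) auto
  then obtain j where "l ^ j * B < r / 2" by (auto simp: eventually_sequentially)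
  then have "norm (e n - 0) < r" if "n \<ge> 2 ^ j * (N + 1)" for n
    using it[OF that] nonneg[of n] by simp
  then show "\<exists>no. \<forall>n\<ge>no. norm (e n - 0) < r" by blast
qed

text \<open>Derivative of \<open>(1 + h) powr (\<gamma> + 1)\<close> at 0, along
  \<open>h = - 1 / k\<close>. It allows \<open>k powr \<gamma>\<close> to be replaced by an
  increment, so that the comparison sums in Karamata's theorem telescope exactly.\<close>

lemma powr_over_increment_tendsto_1:
  fixes \<gamma> :: real
  assumes "\<gamma> > -1"
  shows "(\<lambda>k. real k powr \<gamma> / ((real k powr (\<gamma> + 1) - real (k - 1) powr (\<gamma> + 1)) / (\<gamma> + 1))) \<longlonglongrightarrow> 1"
proof -
  have "((\<lambda>h. (1 + h) powr (\<gamma> + 1)) has_real_derivative (\<gamma> + 1)) (at 0)"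
    using assms by (auto intro!: derivative_eq_intros)
  then have "((\<lambda>h. ((1 + h) powr (\<gamma> + 1) - 1) / h) \<longlongrightarrow> \<gamma> + 1) (at 0)"
    by (simp add: DERIV_def)
  moreover have "filterlim (\<lambda>k. - 1 / real k) (at 0) sequentially" by real_asymp
  ultimately have "(\<lambda>k. ((1 + - 1 / real k) powr (\<gamma> + 1) - 1) / (- 1 / real k)) \<longlonglongrightarrow> \<gamma> + 1"
    by (rule filterlim_compose)
  then have "(\<lambda>k. (\<gamma> + 1) / (((1 + - 1 / real k) powr (\<gamma> + 1) - 1) / (- 1 / real k)))
     \<longlonglongrightarrow> (\<gamma> + 1) / (\<gamma> + 1)"
    by (intro tendsto_intros) (use assms in auto)
  then have "(\<lambda>k. (\<gamma> + 1) / (((1 + - 1 / real k) powr (\<gamma> + 1) - 1) / (- 1 / real k))) \<longlonglongrightarrow> 1"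
    using assms by simp
  moreover have "eventually (\<lambda>k. (\<gamma> + 1) / (((1 + - 1 / real k) powr (\<gamma> + 1) - 1) / (- 1 / real k)) =
      real k powr \<gamma> / ((real k powr (\<gamma> + 1) - real (k - 1) powr (\<gamma> + 1)) / (\<gamma> + 1))) sequentially"
    using eventually_ge_at_top[of 1]
  proof eventually_elim
    case (elim k)
    have "1 + - 1 / real k = real (k - 1) / real k" using elim by (simp add: field_simps of_nat_diff)
    then have 1: "(1 + - 1 / real k) powr (\<gamma> + 1) = real (k - 1) powr (\<gamma> + 1) / (real k powr \<gamma> * real k)"
      using elim by (simp add: powr_divide powr_add)
    have "(real (k - 1) powr (\<gamma> + 1) / (real k powr \<gamma> * real k) - 1) / (- 1 / real k)
        = (real k powr (\<gamma> + 1) - real (k - 1) powr (\<gamma> + 1)) / real k powr \<gamma>"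
      using elim by (simp add: powr_add divide_simps)
    then show ?case unfolding 1 by (simp add: mult.commute)
  qed
  ultimately show ?thesis by (rule Lim_transform_eventually)
qed

text \<open>Write \<open>\<mu> k = q k * d k\<close> with \<open>d\<close> the increments of
  \<open>P\<close> and \<open>q\<close> slowly varying. Over the upper half of \<open>{1..n}\<close>
  the factor \<open>q\<close> is almost constant, so that half contributes about
  \<open>q n * (P n - P m)\<close> with \<open>m = n div 2\<close>; the lower half is
  \<open>nu \<mu> m\<close> again. The relative error of \<open>nu \<mu> n\<close> against
  \<open>q n * P n\<close> therefore contracts from \<open>m\<close> to \<open>n\<close>.\<close>

lemma karamata_sum:
  assumes rv: "regularly_varying \<gamma> \<mu>" and g: "\<gamma> > -1"
  shows "(\<lambda>n. real n * \<mu> n / nu \<mu> n) \<longlonglongrightarrow> \<gamma> + 1"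
proof -
  have pos: "\<mu> n > 0" if "n \<ge> 1" for n
    using rv that by (auto simp: regularly_varying_def)
  define P where "P = (\<lambda>n. real n powr (\<gamma> + 1) / (\<gamma> + 1))"
  define d where "d = (\<lambda>k. P k - P (k - 1))"
  define q where "q = (\<lambda>k. \<mu> k / d k)"
  define s where "s = (\<lambda>k. real k powr \<gamma> / d k)"
  have P0: "P n > 0" if "n \<ge> 1" for n using that g by (simp add: P_def)
  have d0: "d k > 0" if "k \<ge> 1" for k
    using that g unfolding d_def P_def diff_divide_distrib[symmetric]
    by (auto intro!: divide_pos_pos powr_less_mono2)
  have q0: "q k > 0" if "k \<ge> 1" for k using that d0 pos by (simp add: q_def)
  have s0: "s k > 0" if "k \<ge> 1" for k using that d0 by (simp add: s_def)
  have s1: "s \<longlonglongrightarrow> 1"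
    using powr_over_increment_tendsto_1[OF g] by (simp add: s_def d_def P_def diff_divide_distrib)
  have lns: "(\<lambda>k. ln (s k)) \<longlonglongrightarrow> 0" using tendsto_ln[OF s1] by simp
  have q_uniform: "eventually (\<lambda>N. \<forall>m k. N \<le> m \<longrightarrow> m \<le> k \<longrightarrow> k \<le> 3 * m \<longrightarrow> \<bar>ln (q k) - ln (q m)\<bar> \<le> e) sequentially"
    if e: "e > 0" for e
  proof -
    obtain N1 where N1: "N1 \<ge> 1" "\<And>n m. N1 \<le> n \<Longrightarrow> n \<le> m \<Longrightarrow> m \<le> 3 * n \<Longrightarrow>
        \<bar>ln (\<mu> m / \<mu> n) - \<gamma> * ln (real m / real n)\<bar> \<le> e / 3"
      using regularly_varying_uniform[OF rv, of "e/3"] e by auto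
    have "eventually (\<lambda>k. \<bar>ln (s k)\<bar> < e / 3) sequentially"
      using tendstoD[OF lns, of "e/3"] e by (simp add: dist_real_def)
    then obtain N2 where N2: "\<And>k. k \<ge> N2 \<Longrightarrow> \<bar>ln (s k)\<bar> < e / 3"
      by (auto simp: eventually_sequentially)
    show ?thesis
    proof (rule eventually_sequentiallyI[of "max N1 N2"], intro allI impI)
      fix N m k assume N: "max N1 N2 \<le> N" "N \<le> m" "m \<le> k" "k \<le> 3 * m"
      have 1: "m \<ge> 1" "k \<ge> 1" using N N1 by auto
      have "ln (q j) = ln (\<mu> j) - \<gamma> * ln (real j) + ln (s j)" if "j \<ge> 1" for j
        using that d0[of j] pos[of j] s0[of j] by (simp add: q_def s_def ln_div ln_powr)
      moreover have "ln (\<mu> k / \<mu> m) - \<gamma> * ln (real k / real m) =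
          (ln (\<mu> k) - \<gamma> * ln (real k)) - (ln (\<mu> m) - \<gamma> * ln (real m))"
        using 1 pos[of k] pos[of m] by (simp add: ln_div algebra_simps)
      ultimately show "\<bar>ln (q k) - ln (q m)\<bar> \<le> e"
        using N1(2)[of m k] N2[of m] N2[of k] N 1 by (simp add: abs_if split: if_splits)
    qed
  qed
  \<comment> \<open>Upper bound for \<open>P (n div 2) / P n\<close>. It is below 1 because
    \<open>\<gamma> > -1\<close>, and it is what makes the halving step a contraction.\<close>
  define \<theta> where "\<theta> = (1 / 2 :: real) powr (\<gamma> + 1)"
  have \<theta>: "0 < \<theta>" "\<theta> < 1" using g powr_less_mono2[of "\<gamma> + 1" "1 / 2" 1] by (auto simp: \<theta>_def)
  define R where "R = (\<lambda>n. nu \<mu> n / (q n * P n))"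
  have "(\<lambda>n. \<bar>R n - 1\<bar>) \<longlonglongrightarrow> 0"
  proof (rule halving_contraction[where l = "(1 + \<theta>) / 2"])
    fix \<eta> :: real assume \<eta>: "\<eta> > 0"
    \<comment> \<open>The first bound keeps the additive error \<open>2 * \<delta>\<close> below
      \<open>\<eta>\<close>; the second keeps the factor \<open>\<theta> * (1 + \<delta>)\<close>
      below \<open>(1 + \<theta>) / 2 < 1\<close>.\<close>
    define \<delta> where "\<delta> = min (\<eta> / 2) ((1 - \<theta>) / 2)"
    have \<delta>: "\<delta> > 0" "2 * \<delta> \<le> \<eta>" "\<delta> \<le> (1 - \<theta>) / 2" using \<eta> \<theta> by (auto simp: \<delta>_def min_def)
    obtain N where N: "N \<ge> 1"
      "\<And>m k. N \<le> m \<Longrightarrow> m \<le> k \<Longrightarrow> k \<le> 3 * m \<Longrightarrow> \<bar>ln (q k) - ln (q m)\<bar> \<le> ln (1 + \<delta>)"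
      using eventually_happens'[OF sequentially_bot
          eventually_conj[OF q_uniform[of "ln (1 + \<delta>)"] eventually_ge_at_top[of 1]]] \<delta> by auto
    have ratio: "q k \<le> q n * (1 + \<delta>)" "q n * (1 - \<delta>) \<le> q k"
      if "N \<le> k" "k \<le> n" "n \<le> 3 * k" for k n
    proof -
      have l: "\<bar>ln (q n) - ln (q k)\<bar> \<le> ln (1 + \<delta>)" using N(2) that by blast
      have qq: "q n > 0" "q k > 0" using that N q0 by auto
      have "ln (q k) \<le> ln (q n * (1 + \<delta>))" using l qq \<delta> by (simp add: ln_mult)
      then show "q k \<le> q n * (1 + \<delta>)" using qq \<delta> by (subst (asm) ln_le_cancel_iff) auto
      have "ln (q n) \<le> ln (q k * (1 + \<delta>))" using l qq \<delta> by (simp add: ln_mult)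
      then have "q n \<le> q k * (1 + \<delta>)" using qq \<delta> by (subst (asm) ln_le_cancel_iff) auto
      then have "q n * (1 - \<delta>) \<le> q k * (1 + \<delta>) * (1 - \<delta>)"
        using \<delta> \<theta> by (intro mult_right_mono) auto
      also have "\<dots> = q k - q k * \<delta>\<^sup>2" by (simp add: algebra_simps power2_eq_square)
      also have "\<dots> \<le> q k" using qq by simp
      finally show "q n * (1 - \<delta>) \<le> q k" .
    qed
    show "eventually (\<lambda>n. \<bar>R n - 1\<bar> \<le> (1 + \<theta>) / 2 * \<bar>R (n div 2) - 1\<bar> + \<eta>) sequentially"
    proof (rule eventually_sequentiallyI[of "2 * N"])
      fix n assume n: "2 * N \<le> n"
      define m where "m = n div 2"
      have m: "N \<le> m" "m \<le> n" "n \<le> 3 * m" "1 \<le> m" "2 * m \<le> n" using n N by (auto simp: m_def)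
      have n1: "n \<ge> 1" using m by linarith
      note pp = q0[OF n1] q0[OF m(4)] P0[OF n1] P0[OF m(4)]
      define S where "S = (\<Sum>k\<in>{m<..n}. \<mu> k)"
      have nuS: "nu \<mu> n = nu \<mu> m + S"
      proof -
        have "{1..n} = {1..m} \<union> {m<..n}" using m by auto
        then show ?thesis unfolding nu_def S_def by (simp add: sum.union_disjoint[symmetric] ivl_disj_int)
      qed
      have tele: "(\<Sum>k\<in>{m<..n}. d k) = P n - P m"
      proof -
        have "(\<Sum>k\<in>{m<..m + j}. d k) = P (m + j) - P m" for j
        proof (induction j)
          case (Suc j)
          have "{m<..m + Suc j} = insert (m + Suc j) {m<..m + j}" by auto
          then show ?case using Suc by (simp add: d_def)
        qed simp
        from this[of "n - m"] show ?thesis using m by simp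
      qed
      have mu_q: "\<mu> k = q k * d k" if "k \<ge> 1" for k using d0[OF that] by (simp add: q_def)
      have "S \<le> (\<Sum>k\<in>{m<..n}. q n * (1 + \<delta>) * d k)" unfolding S_def
        using m ratio(1)[of _ n] d0 mu_q by (intro sum_mono) (auto intro!: mult_right_mono less_imp_le)
      then have S1: "S \<le> q n * (1 + \<delta>) * (P n - P m)" by (simp add: sum_distrib_left[symmetric] tele)
      have "S \<ge> (\<Sum>k\<in>{m<..n}. q n * (1 - \<delta>) * d k)" unfolding S_def
        using m ratio(2)[of _ n] d0 mu_q by (intro sum_mono) (auto intro!: mult_right_mono less_imp_le)
      then have S2: "S \<ge> q n * (1 - \<delta>) * (P n - P m)" by (simp add: sum_distrib_left[symmetric] tele)
      define x where "x = q m / q n"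
      define y where "y = P m / P n"
      define z where "z = S / (q n * P n)"
      have x: "x \<le> 1 + \<delta>" "1 - \<delta> \<le> x" "x > 0"
        using ratio[of m n] m pp by (auto simp: x_def field_simps)
      have y: "0 \<le> y" "y \<le> \<theta>"
      proof -
        have "y = (real m / real n) powr (\<gamma> + 1)" using g by (simp add: y_def P_def powr_divide)
        also have "\<dots> \<le> \<theta>" unfolding \<theta>_def using m g by (intro powr_mono2) (auto simp: field_simps)
        finally show "y \<le> \<theta>" .
      qed (use pp in \<open>simp add: y_def\<close>)
      have z: "\<bar>z - (1 - y)\<bar> \<le> \<delta>"
      proof -
        have c: "c * (1 - y) = q n * c * (P n - P m) / (q n * P n)" for c
          using pp by (simp add: y_def field_simps)
        have "z \<le> (1 + \<delta>) * (1 - y)"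
          unfolding c z_def using S1 pp by (intro divide_right_mono) auto
        moreover have "z \<ge> (1 - \<delta>) * (1 - y)"
          unfolding c z_def using S2 pp by (intro divide_right_mono) auto
        moreover have "\<delta> * y \<ge> 0" using \<delta> y by simp
        ultimately show ?thesis by (auto simp: algebra_simps abs_le_iff)
      qed
      \<comment> \<open>Lower half plus upper half, both divided by \<open>q n * P n\<close>. With
        \<open>x\<close> near 1 and \<open>z\<close> near \<open>1 - y\<close>, the value 1 is
        nearly a fixed point, and deviations from it are multiplied by about
        \<open>y \<le> \<theta>\<close>.\<close>
      have Rn: "R n = R m * x * y + z"
        using pp unfolding R_def nuS x_def y_def z_def by (simp add: field_simps)
      have "R n - 1 = y * ((R m - 1) * x + (x - 1)) + (z - (1 - y))"
        unfolding Rn by (simp add: algebra_simps)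
      also have "\<bar>\<dots>\<bar> \<le> y * (\<bar>R m - 1\<bar> * x + \<bar>x - 1\<bar>) + \<bar>z - (1 - y)\<bar>"
      proof -
        have "\<bar>(R m - 1) * x + (x - 1)\<bar> \<le> \<bar>R m - 1\<bar> * x + \<bar>x - 1\<bar>"
          using abs_triangle_ineq[of "(R m - 1) * x" "x - 1"] x(3) by (simp add: abs_mult)
        then have "\<bar>y * ((R m - 1) * x + (x - 1))\<bar> \<le> y * (\<bar>R m - 1\<bar> * x + \<bar>x - 1\<bar>)"
          using y(1) by (simp add: abs_mult mult_left_mono)
        then show ?thesis by linarith
      qed
      also have "\<dots> \<le> \<theta> * (\<bar>R m - 1\<bar> * (1 + \<delta>) + \<delta>) + \<delta>"
        using x y z \<theta> by (intro add_mono mult_mono) auto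
      also have "\<dots> = \<theta> * (1 + \<delta>) * \<bar>R m - 1\<bar> + (\<theta> * \<delta> + \<delta>)" by (simp add: algebra_simps)
      also have "\<dots> \<le> (1 + \<theta>) / 2 * \<bar>R m - 1\<bar> + 2 * \<delta>"
      proof (intro add_mono mult_right_mono)
        have td: "\<theta> * \<delta> \<le> 1 * \<delta>" using \<delta> \<theta> by (intro mult_right_mono) auto
        then show "\<theta> * \<delta> + \<delta> \<le> 2 * \<delta>" by simp
        have "\<theta> * (1 + \<delta>) = \<theta> + \<theta> * \<delta>" by (simp add: algebra_simps)
        also have "\<dots> \<le> \<theta> + (1 - \<theta>) / 2" using td \<delta>(3) by linarith
        also have "\<dots> = (1 + \<theta>) / 2" by (simp add: field_simps)
        finally show "\<theta> * (1 + \<delta>) \<le> (1 + \<theta>) / 2" .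
      qed auto
      finally show "\<bar>R n - 1\<bar> \<le> (1 + \<theta>) / 2 * \<bar>R (n div 2) - 1\<bar> + \<eta>"
        using \<delta> by (simp add: m_def)
    qed
  qed (use \<theta> in auto)
  then have R1: "R \<longlonglongrightarrow> 1" by (simp add: LIM_zero_iff tendsto_rabs_zero_iff)
  \<comment> \<open>In \<open>s n * R n\<close> the increment \<open>d n\<close> cancels; what
    remains is \<open>nu \<mu> n * (\<gamma> + 1) / (real n * \<mu> n)\<close>.\<close>
  have "(\<lambda>n. (\<gamma> + 1) / (s n * R n)) \<longlonglongrightarrow> (\<gamma> + 1) / (1 * 1)"
    by (intro tendsto_intros R1 s1) auto
  then have "(\<lambda>n. (\<gamma> + 1) / (s n * R n)) \<longlonglongrightarrow> \<gamma> + 1" by simp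
  moreover have "eventually (\<lambda>n. (\<gamma> + 1) / (s n * R n) = real n * \<mu> n / nu \<mu> n) sequentially"
    using eventually_ge_at_top[of 1]
  proof eventually_elim
    case (elim n)
    have "nu \<mu> n \<ge> \<mu> n" unfolding nu_def
      using elim pos by (intro member_le_sum) (auto intro: less_imp_le)
    then have v: "nu \<mu> n > 0" using pos[OF elim] by simp
    have cancel: "c / (A / D * (v / (m / D * (A * k / c)))) = k * m / v"
      if "c > 0" "A > 0" "D > 0" "m > 0" "k > 0" "v > 0" for c A D m k v :: real
      using that by (simp add: field_simps)
    have "real n powr \<gamma> > 0" using elim by simp
    then show ?case
      using cancel[of "\<gamma> + 1" "real n powr \<gamma>" "d n" "\<mu> n" "real n" "nu \<mu> n"]
        elim pos[OF elim] d0[OF elim] v g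
      by (simp add: R_def s_def q_def P_def powr_add)
  qed
  ultimately show ?thesis by (rule Lim_transform_eventually)
qed

section \<open>Weighted averages and asymptotics of sequences\<close>

text \<open>Toeplitz's lemma: the head of the sum is a constant against a diverging total weight. It
  serves Kronecker's lemma, the index of the total weight, and the averaged martingale both almost
  surely and in mean square.\<close>

lemma weighted_average_tendsto:
  fixes z x :: "nat \<Rightarrow> real"
  assumes z: "\<And>k. z k \<ge> 0" and Z: "filterlim (\<lambda>n. \<Sum>k<n. z k) at_top sequentially"
    and x: "x \<longlonglongrightarrow> l"
  shows "(\<lambda>n. (\<Sum>k<n. z k * x k) / (\<Sum>k<n. z k)) \<longlonglongrightarrow> l"
proof (rule LIMSEQ_I)
  fix r :: real assume r: "r > 0"
  define S where "S = (\<lambda>n. \<Sum>k<n. z k)"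
  obtain N where N: "\<And>n. n \<ge> N \<Longrightarrow> \<bar>x n - l\<bar> < r / 2"
    using LIMSEQ_D[OF x, of "r/2"] r by auto
  define K where "K = (\<Sum>k<N. z k * \<bar>x k - l\<bar>)"
  have "eventually (\<lambda>n. S n > 0 \<and> S n > 2 * K / r \<and> n \<ge> N) sequentially"
    using filterlim_at_top_dense[THEN iffD1, OF Z, rule_format, of 0]
      filterlim_at_top_dense[THEN iffD1, OF Z, rule_format, of "2 * K / r"]
      eventually_ge_at_top[of N] unfolding S_def by eventually_elim auto
  then obtain n0 where n0: "\<And>n. n \<ge> n0 \<Longrightarrow> S n > 0 \<and> S n > 2 * K / r \<and> n \<ge> N"
    by (auto simp: eventually_sequentially)
  show "\<exists>n0. \<forall>n\<ge>n0. norm ((\<Sum>k<n. z k * x k) / (\<Sum>k<n. z k) - l) < r"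
  proof (intro exI[of _ n0] allI impI)
    fix n assume "n0 \<le> n"
    then have n: "S n > 0" "S n > 2 * K / r" "n \<ge> N" using n0 by auto
    have "(\<Sum>k<n. z k * x k) - l * S n = (\<Sum>k<n. z k * (x k - l))"
      by (simp add: S_def sum_distrib_left sum_subtractf algebra_simps)
    also have "\<bar>\<dots>\<bar> \<le> (\<Sum>k<n. z k * \<bar>x k - l\<bar>)"
      by (rule sum_abs[THEN order_trans]) (simp add: abs_mult z)
    also have "\<dots> = K + (\<Sum>k\<in>{N..<n}. z k * \<bar>x k - l\<bar>)"
      using n unfolding K_def lessThan_atLeast0 by (simp add: sum.atLeastLessThan_concat)
    also have "(\<Sum>k\<in>{N..<n}. z k * \<bar>x k - l\<bar>) \<le> (\<Sum>k\<in>{N..<n}. z k * (r / 2))"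
      using N z by (intro sum_mono mult_left_mono) (auto intro: less_imp_le)
    also have "\<dots> \<le> (\<Sum>k<n. z k * (r / 2))"
      using z r by (intro sum_mono2) auto
    also have "\<dots> = S n * (r / 2)" by (simp add: S_def sum_distrib_right)
    also have "K + S n * (r / 2) < S n * r" using n r by (simp add: field_simps)
    finally have "\<bar>(\<Sum>k<n. z k * x k) - l * S n\<bar> < S n * r" by simp
    moreover have "(\<Sum>k<n. z k * x k) / S n - l = ((\<Sum>k<n. z k * x k) - l * S n) / S n"
      using n by (simp add: field_simps)
    ultimately have "\<bar>(\<Sum>k<n. z k * x k) / S n - l\<bar> < r"
      using n by (simp add: field_simps)
    then show "norm ((\<Sum>k<n. z k * x k) / (\<Sum>k<n. z k) - l) < r" by (simp add: S_def)
  qed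
qed

lemma summation_by_parts:
  fixes g Q :: "nat \<Rightarrow> real"
  shows "(\<Sum>k<n. g k * (Q (Suc k) - Q k)) = g n * Q n - g 0 * Q 0 - (\<Sum>k<n. Q (Suc k) * (g (Suc k) - g k))"
  by (induction n) (auto simp: algebra_simps)

text \<open>With \<open>Q\<close> the partial sums of \<open>x k / g k\<close>, summation by parts
  writes the quotient as \<open>Q n\<close> minus an average of the later values of \<open>Q\<close>
  weighted by the increments of \<open>g\<close>, up to a factor tending to 1. Both have the limit
  of \<open>Q\<close>. The boundary term at 0 drops out because \<open>Q 0 = 0\<close>.\<close>

lemma kronecker:
  fixes g x :: "nat \<Rightarrow> real"
  assumes g: "incseq g" "\<And>k. g k > 0" and top: "filterlim g at_top sequentially"
    and conv: "summable (\<lambda>k. x k / g k)"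
  shows "(\<lambda>n. (\<Sum>k<n. x k) / g n) \<longlonglongrightarrow> 0"
proof -
  define Q where "Q = (\<lambda>n. \<Sum>k<n. x k / g k)"
  obtain l where l: "Q \<longlonglongrightarrow> l"
    using conv by (auto simp: summable_def sums_def Q_def)
  define z where "z = (\<lambda>k. g (Suc k) - g k)"
  have zs: "(\<Sum>k<n. z k) = g n - g 0" for n unfolding z_def by (rule sum_lessThan_telescope)
  have sz: "filterlim (\<lambda>n. \<Sum>k<n. z k) at_top sequentially" unfolding zs
    using filterlim_tendsto_add_at_top[OF tendsto_const[of "- g 0"] top] by simp
  have avg: "(\<lambda>n. (\<Sum>k<n. z k * Q (Suc k)) / (\<Sum>k<n. z k)) \<longlonglongrightarrow> l"
    using g by (intro weighted_average_tendsto sz LIMSEQ_Suc l) (auto simp: z_def incseq_SucD)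
  have inv: "(\<lambda>n. 1 / g n) \<longlonglongrightarrow> 0"
    using tendsto_inverse_0_at_top[OF top] by (simp add: inverse_eq_divide)
  have "(\<lambda>n. 1 - g 0 * (1 / g n)) \<longlonglongrightarrow> 1 - g 0 * 0" by (intro tendsto_intros inv)
  moreover have "(\<Sum>k<n. z k) / g n = 1 - g 0 * (1 / g n)" for n
    using g(2)[of n] by (simp add: zs diff_divide_distrib)
  ultimately have r1: "(\<lambda>n. (\<Sum>k<n. z k) / g n) \<longlonglongrightarrow> 1" by simp
  have ev: "eventually (\<lambda>n. (\<Sum>k<n. z k) > 0) sequentially"
    using sz by (auto simp: filterlim_at_top_dense)
  have "(\<lambda>n. Q n - (\<Sum>k<n. z k * Q (Suc k)) / (\<Sum>k<n. z k) * ((\<Sum>k<n. z k) / g n)) \<longlonglongrightarrow> l - l * 1"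
    by (intro tendsto_intros l avg r1)
  moreover have "eventually (\<lambda>n. Q n - (\<Sum>k<n. z k * Q (Suc k)) / (\<Sum>k<n. z k) * ((\<Sum>k<n. z k) / g n)
      = (\<Sum>k<n. x k) / g n) sequentially"
    using ev
  proof eventually_elim
    case (elim n)
    have "(\<Sum>k<n. x k) = (\<Sum>k<n. g k * (Q (Suc k) - Q k))"
      using g(2) by (intro sum.cong) (auto simp: Q_def less_imp_neq[symmetric])
    also have "\<dots> = g n * Q n - (\<Sum>k<n. z k * Q (Suc k))"
      by (subst summation_by_parts) (simp add: Q_def z_def mult.commute)
    finally show ?case using elim g(2)[of n] by (simp add: field_simps)
  qed
  ultimately show ?thesis using Lim_transform_eventually by fastforce
qed

text \<open>The function \<open>l\<close> removes the power \<open>n powr \<kappa>\<close> on the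
  logarithmic scale, and its increments are \<open>o(1 / n)\<close>. Between \<open>n\<close> and
  about \<open>n * t\<close> there are only \<open>O(n)\<close> of them, so \<open>l\<close> changes
  by \<open>o(1)\<close>.\<close>

lemma ratio_regularly_varying:
  fixes x :: "nat \<Rightarrow> real"
  assumes pos: "eventually (\<lambda>n. x n > 0) sequentially"
    and ratio: "(\<lambda>n. real n * (x (Suc n) / x n - 1)) \<longlonglongrightarrow> \<kappa>" and t: "t > 0"
  shows "(\<lambda>n. x (nat \<lfloor>real n * t\<rfloor>) / x n) \<longlonglongrightarrow> t powr \<kappa>"
proof -
  define l where "l = (\<lambda>n. ln (x n) - \<kappa> * ln (real n))"
  have small: "(\<lambda>n. x (Suc n) / x n - 1) \<longlonglongrightarrow> 0"
  proof -
    have "(\<lambda>n. real n * (x (Suc n) / x n - 1) * (1 / real n)) \<longlonglongrightarrow> \<kappa> * 0"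
      by (intro tendsto_mult ratio lim_1_over_n)
    moreover have "eventually (\<lambda>n. real n * (x (Suc n) / x n - 1) * (1 / real n) = x (Suc n) / x n - 1) sequentially"
      using eventually_gt_at_top[of 0] by eventually_elim auto
    ultimately show ?thesis using Lim_transform_eventually by fastforce
  qed
  have inc: "(\<lambda>n. real n * (l (Suc n) - l n)) \<longlonglongrightarrow> 0"
  proof -
    \<comment> \<open>Continuous extension of \<open>ln (1 + h) / h\<close>, so that the limit also
      passes through indices where the ratio equals 1 and \<open>h = 0\<close>.\<close>
    define \<phi> where "\<phi> = (\<lambda>h::real. if h = 0 then 1 else ln (1 + h) / h)"
    have "isCont \<phi> 0"
    proof -
      have "((\<lambda>h. ln (1 + h)) has_real_derivative 1) (at (0::real))"
        by (auto intro!: derivative_eq_intros)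
      then have "((\<lambda>h::real. ln (1 + h) / h) \<longlongrightarrow> 1) (at 0)" by (simp add: DERIV_def)
      moreover have "(\<phi> \<longlongrightarrow> 1) (at 0) = ((\<lambda>h::real. ln (1 + h) / h) \<longlongrightarrow> 1) (at 0)"
        by (rule filterlim_cong) (auto simp: \<phi>_def eventually_at_filter)
      ultimately show ?thesis by (simp add: isCont_def \<phi>_def)
    qed
    then have "(\<lambda>n. \<phi> (x (Suc n) / x n - 1)) \<longlonglongrightarrow> \<phi> 0"
      using small by (rule isCont_tendsto_compose)
    then have "(\<lambda>n. (real n * (x (Suc n) / x n - 1)) * \<phi> (x (Suc n) / x n - 1)
        - \<kappa> * (real n * ln (real (Suc n) / real n))) \<longlonglongrightarrow> \<kappa> * 1 - \<kappa> * 1"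
    proof (intro tendsto_diff tendsto_mult ratio tendsto_const)
      show "(\<lambda>n. real n * ln (real (Suc n) / real n)) \<longlonglongrightarrow> 1" by real_asymp
    qed (simp add: \<phi>_def)
    moreover have "eventually (\<lambda>n. x n > 0 \<and> x (Suc n) > 0) sequentially"
      using pos eventually_sequentially_Suc[THEN iffD2, OF pos] by (rule eventually_conj)
    then have "eventually (\<lambda>n. (real n * (x (Suc n) / x n - 1)) * \<phi> (x (Suc n) / x n - 1)
        - \<kappa> * (real n * ln (real (Suc n) / real n)) = real n * (l (Suc n) - l n)) sequentially"
      using eventually_gt_at_top[of 0]
    proof eventually_elim
      case (elim n)
      have h: "h * \<phi> h = ln (1 + h)" for h by (simp add: \<phi>_def)
      have "(real n * (x (Suc n) / x n - 1)) * \<phi> (x (Suc n) / x n - 1) = real n * ln (x (Suc n) / x n)"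
        using h[of "x (Suc n) / x n - 1"] by (simp add: mult.assoc)
      then show ?case using elim by (simp add: l_def ln_div algebra_simps)
    qed
    ultimately show ?thesis using Lim_transform_eventually by fastforce
  qed
  define m where "m = (\<lambda>n. nat \<lfloor>real n * t\<rfloor>)"
  have m_lim: "(\<lambda>n. real (m n) / real n) \<longlonglongrightarrow> t"
    unfolding m_def using t by real_asymp
  have m_top: "filterlim m at_top sequentially"
    unfolding m_def using t by real_asymp
  have "(\<lambda>n. l (m n) - l n) \<longlonglongrightarrow> 0"
  proof (rule LIMSEQ_I)
    fix r :: real assume r: "r > 0"
    \<comment> \<open>The denominator bounds the larger of \<open>n\<close>, \<open>m n\<close>
      divided by the smaller, whichever way round they are ordered.\<close>
    define \<epsilon> where "\<epsilon> = r / (2 * (t + 1 / t + 1))"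
    have \<epsilon>: "\<epsilon> > 0" using r t by (simp add: \<epsilon>_def add_pos_pos)
    obtain N where N: "N \<ge> 1" "\<And>n. n \<ge> N \<Longrightarrow> real n * \<bar>l (Suc n) - l n\<bar> \<le> \<epsilon>"
    proof -
      obtain N where "\<And>n. n \<ge> N \<Longrightarrow> \<bar>real n * (l (Suc n) - l n)\<bar> < \<epsilon>"
        using LIMSEQ_D[OF inc \<epsilon>] by auto
      then show thesis using that[of "max N 1"] by (auto simp: abs_mult intro: less_imp_le)
    qed
    have diff: "\<bar>l b - l a\<bar> \<le> \<epsilon> * (real b / real a)" if "N \<le> a" "a \<le> b" for a b
    proof -
      have a: "real a > 0" using that N by auto
      have "\<bar>l (a + j) - l a\<bar> \<le> \<epsilon> * (real j / real a)" for j
      proof (induction j)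
        case (Suc j)
        have "real a * \<bar>l (Suc (a + j)) - l (a + j)\<bar> \<le> real (a + j) * \<bar>l (Suc (a + j)) - l (a + j)\<bar>"
          by (intro mult_right_mono) auto
        also have "\<dots> \<le> \<epsilon>" using N(2)[of "a + j"] that by simp
        finally have "\<bar>l (Suc (a + j)) - l (a + j)\<bar> \<le> \<epsilon> * (1 / real a)"
          using a by (simp add: field_simps)
        then show ?case using Suc by (simp add: algebra_simps add_divide_distrib)
      qed simp
      from this[of "b - a"] have "\<bar>l b - l a\<bar> \<le> \<epsilon> * (real (b - a) / real a)" using that by simp
      also have "\<dots> \<le> \<epsilon> * (real b / real a)" using \<epsilon> by (intro mult_left_mono divide_right_mono) auto
      finally show ?thesis .
    qed
    have "(\<lambda>n. real n / real (m n)) \<longlonglongrightarrow> 1 / t"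
      using tendsto_inverse[OF m_lim] t by (simp add: inverse_eq_divide)
    then have "eventually (\<lambda>n. real n / real (m n) < 1 / t + 1) sequentially"
      by (rule order_tendstoD) simp
    moreover have "eventually (\<lambda>n. real (m n) / real n < t + 1) sequentially"
      using m_lim by (rule order_tendstoD) simp
    moreover have "eventually (\<lambda>n. m n \<ge> N) sequentially"
      using m_top by (auto simp: filterlim_at_top)
    moreover note eventually_ge_at_top[of N]
    ultimately have "eventually (\<lambda>n. norm (l (m n) - l n - 0) < r) sequentially"
    proof eventually_elim
      case (elim n)
      have "\<bar>l (m n) - l n\<bar> \<le> \<epsilon> * (t + 1 / t + 1)"
      proof (cases "n \<le> m n")
        case True
        then have "\<bar>l (m n) - l n\<bar> \<le> \<epsilon> * (real (m n) / real n)" using diff elim by auto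
        also have "\<dots> \<le> \<epsilon> * (t + 1 / t + 1)" using elim \<epsilon> t by (intro mult_left_mono) (auto intro: order_trans less_imp_le)
        finally show ?thesis .
      next
        case False
        then have "\<bar>l (m n) - l n\<bar> \<le> \<epsilon> * (real n / real (m n))" using diff[of "m n" n] elim by auto
        also have "\<dots> \<le> \<epsilon> * (t + 1 / t + 1)" using elim \<epsilon> t by (intro mult_left_mono) auto
        finally show ?thesis .
      qed
      also have "\<dots> = r / 2"
      proof -
        have "t + 1 / t + 1 > 0" using t by (simp add: add_pos_pos)
        then show ?thesis unfolding \<epsilon>_def by (metis less_irrefl mult.commute nonzero_eq_divide_eq divide_divide_eq_left')
      qed
      also have "\<dots> < r" using r by simp
      finally show ?case by simp
    qed
    then show "\<exists>no. \<forall>n\<ge>no. norm (l (m n) - l n - 0) < r" by (simp add: eventually_sequentially)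
  qed
  then have "(\<lambda>n. exp (l (m n) - l n) * (real (m n) / real n) powr \<kappa>) \<longlonglongrightarrow> exp 0 * t powr \<kappa>"
    using t by (intro tendsto_intros m_lim) auto
  moreover have "eventually (\<lambda>n. x (m n) > 0) sequentially"
    using pos m_top by (rule eventually_compose_filterlim)
  then have "eventually (\<lambda>n. exp (l (m n) - l n) * (real (m n) / real n) powr \<kappa> = x (m n) / x n) sequentially"
    using pos eventually_gt_at_top[of 0] filterlim_at_top[THEN iffD1, OF m_top, rule_format, of 1]
  proof eventually_elim
    case (elim n)
    have "x (m n) / x n = exp (ln (x (m n)) - ln (x n))" using elim by (simp add: exp_diff)
    moreover have "(real (m n) / real n) powr \<kappa> = exp (\<kappa> * (ln (real (m n)) - ln (real n)))"
      using elim by (simp add: powr_def ln_div)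
    ultimately show ?case by (simp add: l_def exp_add[symmetric] algebra_simps)
  qed
  ultimately show ?thesis unfolding m_def using Lim_transform_eventually by fastforce
qed

text \<open>Polya's argument: on a grid fine enough for the uniform continuity of \<open>F\<close>,
  monotonicity squeezes \<open>f n t\<close> between its values at the two neighbouring grid points,
  and there are only finitely many of those.\<close>

lemma monotone_pointwise_imp_uniform:
  fixes f :: "nat \<Rightarrow> real \<Rightarrow> real"
  assumes T: "T > 0" and mono: "\<And>n. mono_on {0..T} (f n)" and cont: "continuous_on {0..T} F"
    and lim: "\<And>t. t \<in> {0..T} \<Longrightarrow> (\<lambda>n. f n t) \<longlonglongrightarrow> F t"
  shows "uniform_limit {0..T} f F sequentially"
proof (rule uniform_limitI)
  fix e :: real assume e: "e > 0"
  have "uniformly_continuous_on {0..T} F" using cont by (intro compact_uniformly_continuous) auto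
  then obtain d where d: "d > 0"
    "\<And>s t. s \<in> {0..T} \<Longrightarrow> t \<in> {0..T} \<Longrightarrow> dist t s < d \<Longrightarrow> dist (F t) (F s) < e / 2"
    unfolding uniformly_continuous_on_def using e by (metis half_gt_zero)
  obtain K :: nat where K: "K > 0" "T / real K < d"
  proof -
    obtain K :: nat where "real K > T / d" using reals_Archimedean2 by blast
    moreover have "T / d > 0" using T d by simp
    ultimately have "real K > 0" by linarith
    moreover have "T / real K < d" using \<open>real K > T / d\<close> d(1) calculation by (simp add: field_simps)
    ultimately show thesis using that by simp
  qed
  define s where "s = (\<lambda>i::nat. T * real i / real K)"
  have s: "s i \<in> {0..T}" if "i \<le> K" for i
  proof -
    have "T * real i \<le> T * real K" using that T by (intro mult_left_mono) auto
    then show ?thesis using T K by (auto simp: s_def field_simps)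
  qed
  have "eventually (\<lambda>n. \<forall>i\<in>{..K}. dist (f n (s i)) (F (s i)) < e / 2) sequentially"
    using lim[OF s] e by (intro eventually_ball_finite ballI tendstoD) auto
  then show "eventually (\<lambda>n. \<forall>t\<in>{0..T}. dist (f n t) (F t) < e) sequentially"
  proof eventually_elim
    case (elim n)
    show ?case
    proof
      fix t assume t: "t \<in> {0..T}"
      define i where "i = nat \<lfloor>t * real K / T\<rfloor>"
      show "dist (f n t) (F t) < e"
      \<comment> \<open>At \<open>t = T\<close> the cell index would be \<open>K\<close>, and its
        right end point would lie outside the interval.\<close>
      proof (cases "t = T")
        case True
        have "s K = T" using K by (simp add: s_def)
        then show ?thesis using elim[rule_format, of K] e True by simp
      next
        case False
        have q: "0 \<le> t * real K / T" "t * real K / T < real K" using t False T K by (auto simp: field_simps)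
        have i: "real i \<le> t * real K / T" "t * real K / T < real i + 1"
          using q by (auto simp: i_def of_nat_nat)
        have iK: "i < K" using i q by linarith
        have st: "s i \<le> t" "t \<le> s (Suc i)" using i T K by (auto simp: s_def field_simps)
        have sd: "s (Suc i) - s i = T / real K" by (simp add: s_def distrib_left add_divide_distrib)
        note si = s[of i] s[of "Suc i"]
        have "f n (s i) \<le> f n t" "f n t \<le> f n (s (Suc i))"
          using mono_onD[OF mono] si st t iK by auto
        moreover have "dist (F (s i)) (F t) < e / 2" "dist (F (s (Suc i))) (F t) < e / 2"
          using si t st sd iK K by (intro d(2); auto simp: dist_real_def)+
        moreover have "dist (f n (s i)) (F (s i)) < e / 2" "dist (f n (s (Suc i))) (F (s (Suc i))) < e / 2"
          using elim iK by auto
        ultimately show ?thesis by (auto simp: dist_real_def abs_if split: if_splits)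
      qed
    qed
  qed
qed

section \<open>Square-integrable martingale differences\<close>

text \<open>Measurability is a separate conjunct because integrability of the square does not imply
  it.\<close>

definition square_integrable :: "'a measure \<Rightarrow> ('a \<Rightarrow> real) \<Rightarrow> bool" where
  "square_integrable M X \<longleftrightarrow> X \<in> borel_measurable M \<and> integrable M (\<lambda>\<omega>. (X \<omega>)\<^sup>2)"

lemma square_integrable_mult:
  assumes "square_integrable M X" "square_integrable M Y"
  shows "integrable M (\<lambda>\<omega>. X \<omega> * Y \<omega>)"
proof (rule Bochner_Integration.integrable_bound)
  show "integrable M (\<lambda>\<omega>. (X \<omega>)\<^sup>2 + (Y \<omega>)\<^sup>2)"
    using assms by (auto simp: square_integrable_def)
  show "AE \<omega> in M. norm (X \<omega> * Y \<omega>) \<le> norm ((X \<omega>)\<^sup>2 + (Y \<omega>)\<^sup>2)"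
  proof (rule AE_I2)
    fix \<omega>
    have "\<bar>X \<omega>\<bar> * \<bar>Y \<omega>\<bar> \<le> (X \<omega>)\<^sup>2 + (Y \<omega>)\<^sup>2"
      using sum_squares_bound[of "\<bar>X \<omega>\<bar>" "\<bar>Y \<omega>\<bar>"]
        mult_nonneg_nonneg[OF abs_ge_zero[of "X \<omega>"] abs_ge_zero[of "Y \<omega>"]]
      unfolding power2_abs by linarith
    then show "norm (X \<omega> * Y \<omega>) \<le> norm ((X \<omega>)\<^sup>2 + (Y \<omega>)\<^sup>2)" by (simp add: abs_mult)
  qed
qed (use assms in \<open>auto simp: square_integrable_def\<close>)

lemma square_integrable_bound:
  assumes "square_integrable M X" "Y \<in> borel_measurable M" "\<And>\<omega>. \<bar>Y \<omega>\<bar> \<le> \<bar>X \<omega>\<bar>"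
  shows "square_integrable M Y"
  unfolding square_integrable_def
proof
  show "integrable M (\<lambda>\<omega>. (Y \<omega>)\<^sup>2)"
  proof (rule Bochner_Integration.integrable_bound)
    show "integrable M (\<lambda>\<omega>. (X \<omega>)\<^sup>2)" using assms by (simp add: square_integrable_def)
    show "AE \<omega> in M. norm ((Y \<omega>)\<^sup>2) \<le> norm ((X \<omega>)\<^sup>2)"
      using assms(3) by (auto intro!: AE_I2 simp: abs_le_square_iff[symmetric])
  qed (use assms(2) in auto)
qed fact

lemma square_integrable_add:
  assumes "square_integrable M X" "square_integrable M Y"
  shows "square_integrable M (\<lambda>\<omega>. X \<omega> + Y \<omega>)"
proof -
  have "(\<lambda>\<omega>. (X \<omega> + Y \<omega>)\<^sup>2) = (\<lambda>\<omega>. (X \<omega>)\<^sup>2 + (Y \<omega>)\<^sup>2 + 2 * (X \<omega> * Y \<omega>))"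
    by (auto simp: power2_eq_square algebra_simps)
  then show ?thesis using assms square_integrable_mult[OF assms] by (auto simp: square_integrable_def)
qed

lemma square_integrable_cmult:
  "square_integrable M X \<Longrightarrow> square_integrable M (\<lambda>\<omega>. c * X \<omega>)"
  by (auto simp: square_integrable_def power_mult_distrib)

lemma square_integrable_zero: "square_integrable M (\<lambda>\<omega>. 0)"
  by (auto simp: square_integrable_def)

lemma square_integrable_diff:
  assumes "square_integrable M X" "square_integrable M Y"
  shows "square_integrable M (\<lambda>\<omega>. X \<omega> - Y \<omega>)"
  using square_integrable_add[OF assms(1) square_integrable_cmult[OF assms(2), of "-1"]] by simp

lemma square_integrable_sum:
  assumes "\<And>i. i \<in> I \<Longrightarrow> square_integrable M (X i)"
  shows "square_integrable M (\<lambda>\<omega>. \<Sum>i\<in>I. X i \<omega>)"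
  using assms
  by (induction I rule: infinite_finite_induct)
     (auto simp: square_integrable_zero intro!: square_integrable_add)

lemma square_integrable_abs: "square_integrable M X \<Longrightarrow> square_integrable M (\<lambda>\<omega>. \<bar>X \<omega>\<bar>)"
  by (auto simp: square_integrable_def)

section \<open>Running maxima and Doob's inequality along single paths\<close>

primrec running_max :: "(nat \<Rightarrow> real) \<Rightarrow> nat \<Rightarrow> real" where
  "running_max q 0 = \<bar>q 0\<bar>"
| "running_max q (Suc n) = max (running_max q n) \<bar>q (Suc n)\<bar>"

lemma running_max_ge: "k \<le> n \<Longrightarrow> \<bar>q k\<bar> \<le> running_max q n"
  by (induction n) (auto simp: le_Suc_eq)

lemma running_max_nonneg: "running_max q n \<ge> 0"
  by (induction n) auto

lemma running_max_le_sum: "running_max q n \<le> (\<Sum>k\<le>n. \<bar>q k\<bar>)"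
proof (induction n)
  case (Suc n)
  have "(\<Sum>k\<le>n. \<bar>q k\<bar>) \<ge> 0" by (intro sum_nonneg) auto
  then show ?case using Suc by auto
qed auto

lemma running_max_le: "(\<And>k. k \<le> n \<Longrightarrow> \<bar>q k\<bar> \<le> B) \<Longrightarrow> running_max q n \<le> B"
  by (induction n) auto

lemma square_integrable_running_max:
  assumes "\<And>k. square_integrable M (Y k)"
  shows "square_integrable M (\<lambda>\<omega>. running_max (\<lambda>k. Y k \<omega>) n)"
proof (rule square_integrable_bound)
  show "square_integrable M (\<lambda>\<omega>. \<Sum>k\<le>n. \<bar>Y k \<omega>\<bar>)"
    by (intro square_integrable_sum square_integrable_abs assms)
  show "(\<lambda>\<omega>. running_max (\<lambda>k. Y k \<omega>) n) \<in> borel_measurable M"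
  proof (induction n)
    case (Suc n)
    then show ?case using assms[of "Suc n"] by (auto simp: square_integrable_def)
  qed (use assms[of 0] in \<open>auto simp: square_integrable_def\<close>)
  show "\<bar>running_max (\<lambda>k. Y k \<omega>) n\<bar> \<le> \<bar>\<Sum>k\<le>n. \<bar>Y k \<omega>\<bar>\<bar>" for \<omega>
    using running_max_nonneg[of "\<lambda>k. Y k \<omega>" n] running_max_le_sum[of "\<lambda>k. Y k \<omega>" n]
    by simp
qed

text \<open>Doob's \<open>L2\<close> inequality before taking expectations. The maximum grows only
  when it equals the current absolute value, which bounds the increments of its square; summing by
  parts and using convexity of the absolute value leaves twice the product of final value and
  maximum. Splitting that product as \<open>r\<^sup>2 / 2 + 2 * q\<^sup>2\<close> yields the
  constant 4. The remaining sum has integrands known one step ahead, so it has mean zero for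
  martingales.\<close>

lemma running_max_pathwise:
  assumes "q 0 = 0"
  shows "(running_max q n)\<^sup>2 \<le>
    4 * (q n)\<^sup>2 - 4 * (\<Sum>k<n. running_max q k * sgn (q k) * (q (Suc k) - q k))"
proof -
  let ?r = "running_max q"
  have "(?r n)\<^sup>2 + 2 * (\<Sum>k<n. ?r k * sgn (q k) * (q (Suc k) - q k)) \<le> 2 * \<bar>q n\<bar> * ?r n"
  proof (induction n)
    case (Suc n)
    have "sgn (q n) * (q (Suc n) - q n) \<le> \<bar>q (Suc n)\<bar> - \<bar>q n\<bar>"
      by (auto simp: sgn_if)
    then have "?r n * sgn (q n) * (q (Suc n) - q n) \<le> ?r n * (\<bar>q (Suc n)\<bar> - \<bar>q n\<bar>)"
      using running_max_nonneg[of q n] by (simp add: mult.assoc mult_left_mono)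
    moreover have "(?r (Suc n))\<^sup>2 - (?r n)\<^sup>2 \<le> 2 * \<bar>q (Suc n)\<bar> * (?r (Suc n) - ?r n)"
    proof (cases "\<bar>q (Suc n)\<bar> \<le> ?r n")
      case False
      have "0 \<le> (\<bar>q (Suc n)\<bar> - ?r n)\<^sup>2" by simp
      then show ?thesis using False by (simp add: power2_eq_square algebra_simps)
    qed auto
    ultimately show ?case using Suc by (simp only: sum.lessThan_Suc) (simp add: algebra_simps)
  qed (use assms in simp)
  moreover have "2 * \<bar>q n\<bar> * ?r n \<le> (?r n)\<^sup>2 / 2 + 2 * (q n)\<^sup>2"
  proof -
    have "0 \<le> (?r n - 2 * \<bar>q n\<bar>)\<^sup>2" by simp
    then have "4 * (?r n * \<bar>q n\<bar>) \<le> (?r n)\<^sup>2 + 4 * (q n)\<^sup>2"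
      by (simp add: power2_diff power_mult_distrib)
    then show ?thesis by (simp add: mult_ac)
  qed
  ultimately show ?thesis by linarith
qed

lemma ennreal_SUP_sq_lessD:
  fixes a :: "nat \<Rightarrow> real"
  assumes "(SUP n. ennreal ((a n)\<^sup>2)) < ennreal (e\<^sup>2)" "e > 0"
  shows "\<bar>a n\<bar> < e"
proof -
  have "ennreal ((a n)\<^sup>2) < ennreal (e\<^sup>2)"
    using assms by (meson SUP_upper UNIV_I le_less_trans)
  then have "(a n)\<^sup>2 < e\<^sup>2" by (simp add: ennreal_less_iff)
  then show ?thesis using assms(2) by (metis abs_le_square_iff abs_of_pos not_le)
qed

text \<open>Orthogonality to the square-integrable functions of the past stands in for vanishing
  conditional expectation. The bound is on second moments, not on the variables themselves.\<close>

locale bounded_martingale_differences = prob_space M for M :: "'a measure" +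
  fixes F :: "nat \<Rightarrow> 'a measure" and D :: "nat \<Rightarrow> 'a \<Rightarrow> real"
  assumes subalg: "\<And>n. subalgebra M (F n)"
    and mono_F: "\<And>m n. m \<le> n \<Longrightarrow> sets (F m) \<subseteq> sets (F n)"
    and adapted: "\<And>n. D n \<in> borel_measurable (F n)"
    and sq_int: "\<And>n. square_integrable M (D n)"
    and sq_le: "\<And>n. expectation (\<lambda>\<omega>. (D n \<omega>)\<^sup>2) \<le> 1"
    and orthogonal: "\<And>n H. H \<in> borel_measurable (F n) \<Longrightarrow> square_integrable M H \<Longrightarrow>
      expectation (\<lambda>\<omega>. H \<omega> * D (Suc n) \<omega>) = 0"
begin

text \<open>Deterministic coefficients give three martingales from one noise: the martingale of the
  model, the plain noise sum, and the series to which Kronecker's lemma is applied. The shift pairs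
  \<open>c k\<close> with the difference following time \<open>k\<close>.\<close>

definition transform :: "(nat \<Rightarrow> real) \<Rightarrow> nat \<Rightarrow> 'a \<Rightarrow> real" where
  "transform c n \<omega> = (\<Sum>k<n. c k * D (Suc k) \<omega>)"

lemma transform_Suc: "transform c (Suc n) \<omega> = transform c n \<omega> + c n * D (Suc n) \<omega>"
  by (simp add: transform_def)

lemma measurable_mono: "m \<le> n \<Longrightarrow> X \<in> borel_measurable (F m) \<Longrightarrow> X \<in> borel_measurable (F n)"
  using subalg mono_F by (intro measurable_from_subalg[of "F n" "F m"]) (auto simp: subalgebra_def)

lemma measurable_F: "X \<in> borel_measurable (F m) \<Longrightarrow> X \<in> borel_measurable M"
  using subalg by (rule measurable_from_subalg)

lemma transform_measurable_F: "transform c n \<in> borel_measurable (F n)"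
  unfolding transform_def
  by (intro borel_measurable_sum borel_measurable_times borel_measurable_const measurable_mono[OF _ adapted]) auto

lemma transform_measurable [measurable]: "transform c n \<in> borel_measurable M"
  using transform_measurable_F by (rule measurable_F)

lemma transform_sq_int: "square_integrable M (transform c n)"
  unfolding transform_def by (intro square_integrable_sum square_integrable_cmult sq_int)

lemma transform_second_moment: "expectation (\<lambda>\<omega>. (transform c n \<omega>)\<^sup>2) \<le> (\<Sum>k<n. (c k)\<^sup>2)"
proof (induction n)
  case (Suc n)
  have i: "integrable M (\<lambda>\<omega>. (transform c n \<omega>)\<^sup>2)" "integrable M (\<lambda>\<omega>. (D (Suc n) \<omega>)\<^sup>2)"
    "integrable M (\<lambda>\<omega>. transform c n \<omega> * D (Suc n) \<omega>)"
    using transform_sq_int sq_int square_integrable_mult[OF transform_sq_int sq_int]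
    by (auto simp: square_integrable_def)
  have "(\<lambda>\<omega>. (transform c (Suc n) \<omega>)\<^sup>2) = (\<lambda>\<omega>. (transform c n \<omega>)\<^sup>2 +
      2 * c n * (transform c n \<omega> * D (Suc n) \<omega>) + (c n)\<^sup>2 * (D (Suc n) \<omega>)\<^sup>2)"
    by (auto simp: transform_Suc power2_eq_square algebra_simps)
  then have "expectation (\<lambda>\<omega>. (transform c (Suc n) \<omega>)\<^sup>2) = expectation (\<lambda>\<omega>. (transform c n \<omega>)\<^sup>2) +
      (c n)\<^sup>2 * expectation (\<lambda>\<omega>. (D (Suc n) \<omega>)\<^sup>2)"
    using i orthogonal[OF transform_measurable_F transform_sq_int, of c n] by simp
  also have "\<dots> \<le> (\<Sum>k<n. (c k)\<^sup>2) + (c n)\<^sup>2 * 1"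
    using Suc sq_le by (intro add_mono mult_left_mono) auto
  finally show ?case by simp
qed (simp add: transform_def)

lemma running_max_measurable_F: "(\<lambda>\<omega>. running_max (\<lambda>k. transform c k \<omega>) n) \<in> borel_measurable (F n)"
proof (induction n)
  case 0
  show ?case using transform_measurable_F[of c 0] by simp
next
  case (Suc n)
  then have "(\<lambda>\<omega>. running_max (\<lambda>k. transform c k \<omega>) n) \<in> borel_measurable (F (Suc n))"
    by (rule measurable_mono[rotated]) simp
  then show ?case using transform_measurable_F[of c "Suc n"]
    by (simp add: borel_measurable_max)
qed

lemma running_max_sq_int: "square_integrable M (\<lambda>\<omega>. running_max (\<lambda>k. transform c k \<omega>) n)"
  by (intro square_integrable_running_max transform_sq_int)

lemma doob_L2: "expectation (\<lambda>\<omega>. (running_max (\<lambda>k. transform c k \<omega>) n)\<^sup>2) \<le> 4 * (\<Sum>k<n. (c k)\<^sup>2)"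
proof -
  \<comment> \<open>The integrand of the pathwise inequality with the coefficient \<open>c k\<close>
    absorbed; it depends on the past up to \<open>k\<close> only, so each product with
    \<open>D (Suc k)\<close> has mean zero.\<close>
  define H where "H = (\<lambda>k \<omega>. c k * (running_max (\<lambda>k. transform c k \<omega>) k * sgn (transform c k \<omega>)))"
  have HF: "H k \<in> borel_measurable (F k)" for k
    unfolding H_def using running_max_measurable_F transform_measurable_F by measurable
  have Hs: "square_integrable M (H k)" for k unfolding H_def
  proof (intro square_integrable_cmult, rule square_integrable_bound)
    show "square_integrable M (\<lambda>\<omega>. running_max (\<lambda>k. transform c k \<omega>) k)" by (rule running_max_sq_int)
    show "(\<lambda>\<omega>. running_max (\<lambda>k. transform c k \<omega>) k * sgn (transform c k \<omega>)) \<in> borel_measurable M"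
      using running_max_sq_int[of c k] transform_measurable[of c k]
      by (auto simp: square_integrable_def sgn_real_def)
    show "\<bar>running_max (\<lambda>k. transform c k \<omega>) k * sgn (transform c k \<omega>)\<bar> \<le> \<bar>running_max (\<lambda>k. transform c k \<omega>) k\<bar>" for \<omega>
      by (auto simp: abs_mult sgn_if)
  qed
  have "expectation (\<lambda>\<omega>. (running_max (\<lambda>k. transform c k \<omega>) n)\<^sup>2)
     \<le> expectation (\<lambda>\<omega>. 4 * (transform c n \<omega>)\<^sup>2 - 4 * (\<Sum>k<n. H k \<omega> * D (Suc k) \<omega>))"
  proof (rule integral_mono)
    show "integrable M (\<lambda>\<omega>. (running_max (\<lambda>k. transform c k \<omega>) n)\<^sup>2)"
      using running_max_sq_int by (simp add: square_integrable_def)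
    show "integrable M (\<lambda>\<omega>. 4 * (transform c n \<omega>)\<^sup>2 - 4 * (\<Sum>k<n. H k \<omega> * D (Suc k) \<omega>))"
      using transform_sq_int square_integrable_mult[OF Hs sq_int]
      by (auto simp: square_integrable_def)
    show "(running_max (\<lambda>k. transform c k \<omega>) n)\<^sup>2
        \<le> 4 * (transform c n \<omega>)\<^sup>2 - 4 * (\<Sum>k<n. H k \<omega> * D (Suc k) \<omega>)" for \<omega>
      using running_max_pathwise[of "\<lambda>k. transform c k \<omega>" n]
      by (simp add: transform_Suc H_def mult_ac) (simp add: transform_def)
  qed
  also have "\<dots> = 4 * expectation (\<lambda>\<omega>. (transform c n \<omega>)\<^sup>2)"
    using transform_sq_int[of c n] square_integrable_mult[OF Hs sq_int] orthogonal[OF HF Hs]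
    by (simp add: square_integrable_def)
  finally show ?thesis using transform_second_moment[of c n] by simp
qed

lemma maximal_inequality:
  assumes "summable (\<lambda>k. (c k)\<^sup>2)"
  shows "(\<integral>\<^sup>+\<omega>. (SUP n. ennreal ((transform c n \<omega>)\<^sup>2)) \<partial>M) \<le> ennreal (4 * (\<Sum>k. (c k)\<^sup>2))"
proof -
  let ?r = "\<lambda>n \<omega>. running_max (\<lambda>k. transform c k \<omega>) n"
  have "(\<integral>\<^sup>+\<omega>. (SUP n. ennreal ((transform c n \<omega>)\<^sup>2)) \<partial>M) \<le> (\<integral>\<^sup>+\<omega>. (SUP n. ennreal ((?r n \<omega>)\<^sup>2)) \<partial>M)"
    using running_max_ge[of _ _ "\<lambda>k. transform c k _"]
    by (intro nn_integral_mono SUP_mono) (auto intro!: ennreal_leI simp: abs_le_square_iff[symmetric] running_max_nonneg)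
  also have "\<dots> = (SUP n. \<integral>\<^sup>+\<omega>. ennreal ((?r n \<omega>)\<^sup>2) \<partial>M)"
  proof (rule nn_integral_monotone_convergence_SUP)
    show "incseq (\<lambda>n \<omega>. ennreal ((?r n \<omega>)\<^sup>2))"
      by (auto intro!: incseq_SucI le_funI ennreal_leI power_mono simp: running_max_nonneg)
    show "(\<lambda>\<omega>. ennreal ((?r n \<omega>)\<^sup>2)) \<in> borel_measurable M" for n
      using running_max_sq_int[of c n] by (auto simp: square_integrable_def)
  qed
  also have "\<dots> \<le> ennreal (4 * (\<Sum>k. (c k)\<^sup>2))"
  proof (rule SUP_least)
    fix n
    have "(\<integral>\<^sup>+\<omega>. ennreal ((?r n \<omega>)\<^sup>2) \<partial>M) = ennreal (expectation (\<lambda>\<omega>. (?r n \<omega>)\<^sup>2))"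
      using running_max_sq_int[of c n] by (intro nn_integral_eq_integral) (auto simp: square_integrable_def)
    also have "\<dots> \<le> ennreal (4 * (\<Sum>k. (c k)\<^sup>2))"
      using doob_L2[of c n] sum_le_suminf[OF assms, of "{..<n}"] by (intro ennreal_leI) auto
    finally show "(\<integral>\<^sup>+\<omega>. ennreal ((?r n \<omega>)\<^sup>2) \<partial>M) \<le> ennreal (4 * (\<Sum>k. (c k)\<^sup>2))" .
  qed
  finally show ?thesis .
qed

text \<open>Largest squared deviation after time \<open>m\<close>. One bound on its mean serves both
  modes of convergence: it controls the Cauchy property along a path and the mean square distance to
  the limit.\<close>

definition osc :: "(nat \<Rightarrow> real) \<Rightarrow> nat \<Rightarrow> 'a \<Rightarrow> ennreal" where
  "osc c m \<omega> = (SUP j. ennreal ((transform c (m + j) \<omega> - transform c m \<omega>)\<^sup>2))"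

lemma osc_measurable [measurable]: "osc c m \<in> borel_measurable M"
  unfolding osc_def by measurable

lemma osc_bound:
  assumes "summable (\<lambda>k. (c k)\<^sup>2)"
  shows "(\<integral>\<^sup>+\<omega>. osc c m \<omega> \<partial>M) \<le> ennreal (4 * (\<Sum>k. (c (k + m))\<^sup>2))"
proof -
  \<comment> \<open>Deleting the first \<open>m\<close> coefficients turns increments after time
    \<open>m\<close> into a transform started at 0, to which the maximal inequality applies.\<close>
  define c' where "c' = (\<lambda>k. if k < m then 0 else c k)"
  have tr: "transform c (m + j) \<omega> - transform c m \<omega> = transform c' (m + j) \<omega>" for j \<omega>
  proof (induction j)
    case 0
    show ?case by (simp add: transform_def c'_def)
  next
    case (Suc j)
    then show ?case by (simp add: transform_Suc c'_def)
  qed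
  have s': "(\<lambda>k. (c' (k + m))\<^sup>2) = (\<lambda>k. (c (k + m))\<^sup>2)" by (auto simp: c'_def)
  have sm: "summable (\<lambda>k. (c (k + m))\<^sup>2)" using assms by (rule summable_ignore_initial_segment)
  then have sm': "summable (\<lambda>k. (c' k)\<^sup>2)"
    using summable_iff_shift[of "\<lambda>k. (c' k)\<^sup>2" m] by (simp add: s')
  have eq: "(\<Sum>k. (c' k)\<^sup>2) = (\<Sum>k. (c (k + m))\<^sup>2)"
    using suminf_split_initial_segment[OF sm', of m] by (simp add: s') (simp add: c'_def)
  have "(\<integral>\<^sup>+\<omega>. osc c m \<omega> \<partial>M) \<le> (\<integral>\<^sup>+\<omega>. (SUP n. ennreal ((transform c' n \<omega>)\<^sup>2)) \<partial>M)"
    unfolding osc_def tr by (intro nn_integral_mono SUP_least SUP_upper) auto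
  also have "\<dots> \<le> ennreal (4 * (\<Sum>k. (c (k + m))\<^sup>2))"
    using maximal_inequality[OF sm'] by (simp add: eq)
  finally show ?thesis .
qed

lemma osc_tendsto_0:
  assumes "summable (\<lambda>k. (c k)\<^sup>2)"
  shows "(\<lambda>m. \<integral>\<^sup>+\<omega>. osc c m \<omega> \<partial>M) \<longlonglongrightarrow> 0"
proof (rule tendsto_sandwich[OF _ _ tendsto_const])
  have "(\<lambda>m. (\<Sum>k. (c k)\<^sup>2) - (\<Sum>k<m. (c k)\<^sup>2)) \<longlonglongrightarrow> (\<Sum>k. (c k)\<^sup>2) - (\<Sum>k. (c k)\<^sup>2)"
    using assms by (intro tendsto_intros summable_LIMSEQ)
  then have "(\<lambda>m. \<Sum>k. (c (k + m))\<^sup>2) \<longlonglongrightarrow> 0"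
    by (simp add: suminf_minus_initial_segment[OF assms])
  then have "(\<lambda>m. ennreal (4 * (\<Sum>k. (c (k + m))\<^sup>2))) \<longlonglongrightarrow> ennreal (4 * 0)"
    by (intro tendsto_ennrealI tendsto_intros)
  then show "(\<lambda>m. ennreal (4 * (\<Sum>k. (c (k + m))\<^sup>2))) \<longlonglongrightarrow> 0" by simp
qed (use osc_bound[OF assms] in auto)

text \<open>The infimum of the oscillations over all starting times lies below each of them, so its
  integral is 0. A vanishing infimum at a path is the Cauchy property there.\<close>

lemma transform_AE_convergent:
  assumes "summable (\<lambda>k. (c k)\<^sup>2)"
  shows "AE \<omega> in M. convergent (\<lambda>n. transform c n \<omega>)"
proof -
  have "(\<integral>\<^sup>+\<omega>. (INF m. osc c m \<omega>) \<partial>M) \<le> (\<integral>\<^sup>+\<omega>. osc c m \<omega> \<partial>M)" for m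
    by (intro nn_integral_mono INF_lower) auto
  then have "(\<integral>\<^sup>+\<omega>. (INF m. osc c m \<omega>) \<partial>M) \<le> 0"
    by (intro LIMSEQ_le_const[OF osc_tendsto_0[OF assms]]) auto
  then have "AE \<omega> in M. (INF m. osc c m \<omega>) = 0"
    by (subst nn_integral_0_iff_AE[symmetric]) auto
  then show ?thesis
  proof eventually_elim
    case (elim \<omega>)
    have "Cauchy (\<lambda>n. transform c n \<omega>)"
    proof (rule CauchyI')
      fix e :: real assume e: "e > 0"
      have "(INF m. osc c m \<omega>) < ennreal ((e / 2)\<^sup>2)" using elim e by simp
      then obtain m where "osc c m \<omega> < ennreal ((e / 2)\<^sup>2)" by (auto simp: INF_less_iff)
      then have m: "\<bar>transform c (m + j) \<omega> - transform c m \<omega>\<bar> < e / 2" for j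
        unfolding osc_def using e by (intro ennreal_SUP_sq_lessD) auto
      show "\<exists>N. \<forall>i\<ge>N. \<forall>n>i. dist (transform c i \<omega>) (transform c n \<omega>) < e"
      proof (intro exI[of _ m] allI impI)
        fix i n assume "m \<le> i" "i < n"
        then show "dist (transform c i \<omega>) (transform c n \<omega>) < e"
          using m[of "i - m"] m[of "n - m"] by (auto simp: dist_real_def abs_if split: if_splits)
      qed
    qed
    then show ?case by (rule Cauchy_convergent)
  qed
qed

lemma transform_lim_L2:
  assumes "summable (\<lambda>k. (c k)\<^sup>2)"
  shows "converges_L2 M (transform c) (\<lambda>\<omega>. lim (\<lambda>n. transform c n \<omega>))"
proof -
  let ?Z = "\<lambda>\<omega>. lim (\<lambda>n. transform c n \<omega>)"
  have Z: "?Z \<in> borel_measurable M" by measurable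
  have le: "(\<integral>\<^sup>+\<omega>. ennreal ((transform c m \<omega> - ?Z \<omega>)\<^sup>2) \<partial>M) \<le> (\<integral>\<^sup>+\<omega>. osc c m \<omega> \<partial>M)" for m
  proof (rule nn_integral_mono_AE)
    show "AE \<omega> in M. ennreal ((transform c m \<omega> - ?Z \<omega>)\<^sup>2) \<le> osc c m \<omega>"
      using transform_AE_convergent[OF assms]
    proof eventually_elim
      case (elim \<omega>)
      then have "(\<lambda>n. transform c n \<omega>) \<longlonglongrightarrow> ?Z \<omega>" by (simp add: convergent_LIMSEQ_iff)
      then have "(\<lambda>j. transform c (m + j) \<omega>) \<longlonglongrightarrow> ?Z \<omega>"
        by (subst add.commute) (rule LIMSEQ_ignore_initial_segment)
      then have l: "(\<lambda>j. ennreal ((transform c (m + j) \<omega> - transform c m \<omega>)\<^sup>2)) \<longlonglongrightarrow>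
          ennreal ((?Z \<omega> - transform c m \<omega>)\<^sup>2)"
        by (intro tendsto_intros tendsto_ennrealI)
      have "ennreal ((transform c (m + j) \<omega> - transform c m \<omega>)\<^sup>2) \<le> osc c m \<omega>" for j
        unfolding osc_def by (rule SUP_upper) auto
      then have "ennreal ((?Z \<omega> - transform c m \<omega>)\<^sup>2) \<le> osc c m \<omega>"
        by (intro LIMSEQ_le_const2[OF l]) auto
      then show ?case by (simp add: power2_commute)
    qed
  qed
  have "(\<integral>\<^sup>+\<omega>. ennreal ((?Z \<omega>)\<^sup>2) \<partial>M) \<le> ennreal (4 * (\<Sum>k. (c (k + 0))\<^sup>2))"
    using order_trans[OF le osc_bound[OF assms], of 0] by (simp add: transform_def)
  then have "(\<integral>\<^sup>+\<omega>. ennreal ((?Z \<omega>)\<^sup>2) \<partial>M) < \<infinity>"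
    using ennreal_less_top le_less_trans by fastforce
  \<comment> \<open>The transform vanishes at time 0, so the oscillation bound at
    \<open>m = 0\<close> is a bound on the second moment of the limit itself.\<close>
  then have "integrable M (\<lambda>\<omega>. (?Z \<omega>)\<^sup>2)"
    using Z by (intro integrableI_nonneg) auto
  moreover have "(\<lambda>m. \<integral>\<^sup>+\<omega>. ennreal ((transform c m \<omega> - ?Z \<omega>)\<^sup>2) \<partial>M) \<longlonglongrightarrow> 0"
    by (rule tendsto_sandwich[OF _ _ tendsto_const osc_tendsto_0[OF assms]]) (use le in auto)
  ultimately show ?thesis using Z by (simp add: converges_L2_def)
qed

end

section \<open>The normalizing sequences\<close>

lemma sum_at_top_if_not_summable:
  fixes f :: "nat \<Rightarrow> real"
  assumes nonneg: "\<And>k. f k \<ge> 0" and "\<not> summable f"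
  shows "filterlim (\<lambda>n. \<Sum>k<n. f k) at_top sequentially"
  unfolding filterlim_at_top
proof
  fix Z
  have "\<exists>n. (\<Sum>k<n. f k) > Z"
    using summableI_nonneg_bounded[of f Z] assms by (meson not_le)
  then obtain n where n: "(\<Sum>k<n. f k) > Z" by blast
  show "eventually (\<lambda>n. Z \<le> (\<Sum>k<n. f k)) sequentially"
  proof (rule eventually_sequentiallyI[of n])
    fix m assume "n \<le> m"
    then have "(\<Sum>k<n. f k) \<le> (\<Sum>k<m. f k)" using nonneg by (intro sum_mono2) auto
    then show "Z \<le> (\<Sum>k<m. f k)" using n by linarith
  qed
qed

lemma unif_dist_tendsto_0I:
  assumes "uniform_limit {0..T} f g sequentially"
  shows "(\<lambda>n. unif_dist T (f n) g) \<longlonglongrightarrow> 0"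
proof (rule order_tendstoI)
  fix a :: ennreal assume a: "0 < a"
  obtain e where e: "e > 0" "ennreal e < a"
    using a by (metis dense ennreal_cases ennreal_less_zero_iff less_top_ennreal order_less_le_trans top_greatest not_less_iff_gr_or_eq)
  have "eventually (\<lambda>n. \<forall>t\<in>{0..T}. dist (f n t) (g t) < e) sequentially"
    using assms e by (intro uniform_limitD)
  then show "eventually (\<lambda>n. unif_dist T (f n) g < a) sequentially"
  proof eventually_elim
    case (elim n)
    have "unif_dist T (f n) g \<le> ennreal e"
      unfolding unif_dist_def using elim by (intro SUP_least ennreal_leI) (auto simp: dist_real_def intro: less_imp_le)
    then show ?case using e by simp
  qed
qed simp

locale memory_sequence =
  fixes p \<gamma> :: real and \<mu> :: "nat \<Rightarrow> real"
  assumes p_in: "p \<in> {0..1}" and gamma_in: "\<gamma> > -1" and mu_rv: "regularly_varying \<gamma> \<mu>"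
begin

lemma mu_pos: "n \<ge> 1 \<Longrightarrow> \<mu> n > 0"
  using mu_rv by (auto simp: regularly_varying_def)

lemma nu_pos: "n \<ge> 1 \<Longrightarrow> nu \<mu> n > 0"
  unfolding nu_def using mu_pos by (intro sum_pos) auto

lemma nu_Suc: "nu \<mu> (Suc n) = nu \<mu> n + \<mu> (Suc n)"
  by (simp add: nu_def)

lemma nu_nonneg: "nu \<mu> n \<ge> 0"
  unfolding nu_def using mu_pos by (intro sum_nonneg less_imp_le) auto

text \<open>The recursion by which \<open>a_seq\<close> cancels the mean growth of the weighted sum.
  It extends to \<open>n = 0\<close>: \<open>nu \<mu> 0 = 0\<close> makes the quotient 0, and both
  products are empty.\<close>

lemma a_Suc: "a_seq p \<mu> (Suc n) * (1 + p * (\<mu> (Suc n) / nu \<mu> n)) = a_seq p \<mu> n"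
proof (cases "n = 0")
  case False
  have "p * (\<mu> (Suc n) / nu \<mu> n) \<ge> 0"
    using p_in mu_pos[of "Suc n"] nu_nonneg[of n] by (intro mult_nonneg_nonneg divide_nonneg_nonneg) auto
  then have "1 + p * (\<mu> (Suc n) / nu \<mu> n) \<noteq> 0" by linarith
  then show ?thesis using False by (simp add: a_seq_def)
qed (simp add: a_seq_def nu_def)

lemma a_pos: "a_seq p \<mu> n > 0"
proof -
  have "1 + p * (\<mu> (i + 1) / nu \<mu> i) > 0" if "i \<ge> 1" for i
    using p_in mu_pos[of "i + 1"] nu_pos[OF that]
    by (intro add_pos_nonneg mult_nonneg_nonneg divide_nonneg_nonneg) auto
  then show ?thesis unfolding a_seq_def by (intro prod_pos) auto
qed

text \<open>\<open>mart_weight 0 = 1 / 0 = 0\<close>, because \<open>nu \<mu> 0 = 0\<close>.\<close>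

definition mart_weight :: "nat \<Rightarrow> real" where
  "mart_weight k = 1 / (a_seq p \<mu> k * nu \<mu> k)"

definition total_weight :: "nat \<Rightarrow> real" where
  "total_weight n = (\<Sum>k<n. mart_weight k)"

lemma mart_weight_nonneg: "mart_weight k \<ge> 0"
  using a_pos[of k] nu_nonneg[of k] by (simp add: mart_weight_def)

lemma mart_weight_pos: "k \<ge> 1 \<Longrightarrow> mart_weight k > 0"
  using a_pos[of k] nu_pos[of k] by (simp add: mart_weight_def)

lemma total_weight_0 [simp]: "total_weight 0 = 0"
  by (simp add: total_weight_def)

lemma total_weight_Suc: "total_weight (Suc n) = total_weight n + mart_weight n"
  by (simp add: total_weight_def)

lemma total_weight_mono: "m \<le> n \<Longrightarrow> total_weight m \<le> total_weight n"
  unfolding total_weight_def using mart_weight_nonneg by (intro sum_mono2) auto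

lemma total_weight_nonneg: "total_weight n \<ge> 0"
  using total_weight_mono[of 0 n] by simp

lemma memory_share_tendsto: "(\<lambda>n. real n * \<mu> n / nu \<mu> n) \<longlonglongrightarrow> \<gamma> + 1"
  using mu_rv gamma_in by (rule karamata_sum)

lemma nu_ratio_tendsto: "(\<lambda>n. nu \<mu> n / nu \<mu> (Suc n)) \<longlonglongrightarrow> 1"
proof -
  have "(\<lambda>n. 1 - (real (Suc n) * \<mu> (Suc n) / nu \<mu> (Suc n)) * (1 / real (Suc n))) \<longlonglongrightarrow> 1 - (\<gamma> + 1) * 0"
    by (intro tendsto_intros LIMSEQ_Suc[OF memory_share_tendsto] LIMSEQ_Suc[OF lim_1_over_n])
  moreover have "1 - (real (Suc n) * \<mu> (Suc n) / nu \<mu> (Suc n)) * (1 / real (Suc n)) = nu \<mu> n / nu \<mu> (Suc n)" for n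
  proof -
    have "real (Suc n) * \<mu> (Suc n) / nu \<mu> (Suc n) * (1 / real (Suc n)) = \<mu> (Suc n) / nu \<mu> (Suc n)"
      by (simp del: of_nat_Suc)
    then show ?thesis using nu_pos[of "Suc n"] by (simp add: nu_Suc field_simps)
  qed
  ultimately show ?thesis by simp
qed

lemma next_memory_share_tendsto: "(\<lambda>n. real n * (\<mu> (Suc n) / nu \<mu> n)) \<longlonglongrightarrow> \<gamma> + 1"
proof -
  have "(\<lambda>n. (real (Suc n) * \<mu> (Suc n) / nu \<mu> (Suc n)) * (1 - 1 / real (Suc n)) / (nu \<mu> n / nu \<mu> (Suc n)))
      \<longlonglongrightarrow> (\<gamma> + 1) * (1 - 0) / 1"
    by (intro tendsto_intros LIMSEQ_Suc[OF memory_share_tendsto] LIMSEQ_Suc[OF lim_1_over_n] nu_ratio_tendsto) auto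
  moreover have "eventually (\<lambda>n. (real (Suc n) * \<mu> (Suc n) / nu \<mu> (Suc n)) * (1 - 1 / real (Suc n)) / (nu \<mu> n / nu \<mu> (Suc n))
      = real n * (\<mu> (Suc n) / nu \<mu> n)) sequentially"
    using eventually_ge_at_top[of 1]
  proof eventually_elim
    case (elim n)
    show ?case using nu_pos[OF elim] nu_pos[of "Suc n"] by (simp add: divide_simps del: of_nat_Suc)
  qed
  ultimately show ?thesis using Lim_transform_eventually by fastforce
qed

text \<open>With \<open>r\<close> the share \<open>\<mu> (Suc n) / nu \<mu> n\<close>, of order
  \<open>(\<gamma> + 1) / n\<close>, consecutive weights have ratio
  \<open>(1 + p * r) / (1 + r)\<close>; this gives \<open>1 + (p - 1) * (\<gamma> + 1)\<close>. The
  increment of \<open>n * mart_weight n\<close> is taken because its sum telescopes, so averaging it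
  yields the growth index of the total weight.\<close>

lemma mart_weight_increment_tendsto:
  "(\<lambda>n. (real (Suc n) * mart_weight (Suc n) - real n * mart_weight n) / mart_weight n) \<longlonglongrightarrow> p * (\<gamma> + 1) - \<gamma>"
proof -
  define r where "r = (\<lambda>n. \<mu> (Suc n) / nu \<mu> n)"
  have nr: "(\<lambda>n. real n * r n) \<longlonglongrightarrow> \<gamma> + 1" unfolding r_def by (rule next_memory_share_tendsto)
  have "(\<lambda>n. (real n * r n) * (1 / real n)) \<longlonglongrightarrow> (\<gamma> + 1) * 0"
    by (intro tendsto_mult nr lim_1_over_n)
  moreover have "eventually (\<lambda>n. (real n * r n) * (1 / real n) = r n) sequentially"
    using eventually_ge_at_top[of 1] by eventually_elim auto
  ultimately have r: "r \<longlonglongrightarrow> 0" using Lim_transform_eventually by fastforce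
  have "(\<lambda>n. (1 + p * r n + (p - 1) * (real n * r n)) / (1 + r n)) \<longlonglongrightarrow> (1 + p * 0 + (p - 1) * (\<gamma> + 1)) / (1 + 0)"
    by (intro tendsto_intros r nr) auto
  moreover have "eventually (\<lambda>n. (1 + p * r n + (p - 1) * (real n * r n)) / (1 + r n) =
     (real (Suc n) * mart_weight (Suc n) - real n * mart_weight n) / mart_weight n) sequentially"
    using eventually_ge_at_top[of 1]
  proof eventually_elim
    case (elim n)
    have r0: "r n > 0" using mu_pos[of "Suc n"] nu_pos[OF elim] by (simp add: r_def)
    have "nu \<mu> (Suc n) = nu \<mu> n * (1 + r n)" using nu_pos[OF elim] by (simp add: nu_Suc r_def field_simps)
    moreover have "a_seq p \<mu> n = a_seq p \<mu> (Suc n) * (1 + p * r n)" using a_Suc[of n] by (simp add: r_def)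
    moreover have "1 + p * r n > 0" using p_in r0 by (intro add_pos_nonneg mult_nonneg_nonneg) auto
    ultimately have "mart_weight (Suc n) = mart_weight n * ((1 + p * r n) / (1 + r n))"
      using a_pos[of "Suc n"] nu_pos[OF elim] r0 a_pos[of n] by (simp add: mart_weight_def)
    then have "(real (Suc n) * mart_weight (Suc n) - real n * mart_weight n) / mart_weight n
        = real (Suc n) * ((1 + p * r n) / (1 + r n)) - real n"
      using mart_weight_pos[OF elim] by (simp only:) (simp add: diff_divide_distrib)
    also have "\<dots> = (1 + p * r n + (p - 1) * (real n * r n)) / (1 + r n)"
      using r0 by (simp add: field_simps)
    finally show ?case by simp
  qed
  ultimately have "(\<lambda>n. (real (Suc n) * mart_weight (Suc n) - real n * mart_weight n) / mart_weight n)
      \<longlonglongrightarrow> (1 + p * 0 + (p - 1) * (\<gamma> + 1)) / (1 + 0)"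
    by (rule Lim_transform_eventually)
  then show ?thesis by (simp add: algebra_simps)
qed

end

section \<open>Growth of the total weight when the variances are summable\<close>

locale square_summable_memory = memory_sequence +
  assumes v_bounded: "bounded (range (v_seq p \<mu>))" and p_ge: "p \<ge> p_crit \<gamma>"
begin

definition kappa :: real where
  "kappa = p * (\<gamma> + 1) - \<gamma>"

definition scale :: "nat \<Rightarrow> real" where
  "scale n = a_seq p \<mu> n * \<mu> n"

lemma kappa_pos: "kappa > 0"
proof -
  have "(\<gamma> + 1 / 2) / (\<gamma> + 1) * (\<gamma> + 1) \<le> p * (\<gamma> + 1)"
    using p_ge gamma_in unfolding p_crit_def by (intro mult_right_mono) auto
  then show ?thesis using gamma_in by (simp add: kappa_def)
qed

lemma scale_pos: "n \<ge> 1 \<Longrightarrow> scale n > 0"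
  using a_pos mu_pos by (simp add: scale_def)

lemma scale_square_summable: "summable (\<lambda>n. (scale (Suc n))\<^sup>2)"
proof -
  obtain B where B: "\<And>n. \<bar>v_seq p \<mu> n\<bar> \<le> B" using v_bounded by (auto simp: bounded_iff)
  show ?thesis
  proof (rule summableI_nonneg_bounded)
    fix n
    have "(\<Sum>k<n. (scale (Suc k))\<^sup>2) = (\<Sum>k=1..n. (scale k)\<^sup>2)"
      by (simp add: sum.atLeast1_atMost_eq)
    also have "\<dots> = (v_seq p \<mu> n)\<^sup>2"
      by (simp add: v_seq_def scale_def power_mult_distrib sum_nonneg)
    also have "\<dots> \<le> B\<^sup>2" using B[of n] by (simp add: abs_le_square_iff[symmetric])
    finally show "(\<Sum>k<n. (scale (Suc k))\<^sup>2) \<le> B\<^sup>2" .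
  qed auto
qed

lemma scale_tendsto: "scale \<longlonglongrightarrow> 0"
proof -
  have "(\<lambda>n. (scale (Suc n))\<^sup>2) \<longlonglongrightarrow> 0" using scale_square_summable by (rule summable_LIMSEQ_zero)
  then have "(\<lambda>n. sqrt ((scale (Suc n))\<^sup>2)) \<longlonglongrightarrow> sqrt 0" by (rule tendsto_real_sqrt)
  then have "(\<lambda>n. scale (Suc n)) \<longlonglongrightarrow> 0" by (simp add: tendsto_rabs_zero_iff)
  then show ?thesis by (rule LIMSEQ_imp_Suc)
qed

lemma scale_mart_weight: "n \<ge> 1 \<Longrightarrow> scale n * (real n * mart_weight n) = real n * \<mu> n / nu \<mu> n"
  using a_pos[of n] nu_pos[of n] by (simp add: scale_def mart_weight_def)

text \<open>As \<open>scale n\<close> tends to 0 while \<open>scale n * (n * mart_weight n)\<close>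
  tends to \<open>\<gamma> + 1 > 0\<close>, the weights eventually exceed those of the harmonic
  series.\<close>

lemma total_weight_at_top: "filterlim total_weight at_top sequentially"
proof -
  have "\<not> summable mart_weight"
  proof
    assume s: "summable mart_weight"
    have "eventually (\<lambda>n. real n * \<mu> n / nu \<mu> n > (\<gamma> + 1) / 2) sequentially"
      using memory_share_tendsto gamma_in by (intro order_tendstoD) auto
    moreover have "eventually (\<lambda>n. scale n < (\<gamma> + 1) / 2) sequentially"
      using scale_tendsto gamma_in by (intro order_tendstoD) auto
    ultimately have "eventually (\<lambda>n. norm (1 / real n) \<le> mart_weight n) sequentially"
      using eventually_ge_at_top[of 1]
    proof eventually_elim
      case (elim n)
      have "scale n * 1 \<le> scale n * (real n * mart_weight n)"
        unfolding scale_mart_weight[OF elim(3)] using elim by linarith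
      then have "1 \<le> real n * mart_weight n" using scale_pos[of n] elim by (simp only: mult_le_cancel_left_pos)
      then show ?case using elim by (simp add: field_simps)
    qed
    then have "summable (\<lambda>n. 1 / real n)" using s by (rule summable_comparison_test_ev)
    then show False using not_summable_harmonic[where 'a = real] by (simp add: inverse_eq_divide)
  qed
  then show ?thesis unfolding total_weight_def[abs_def]
    by (intro sum_at_top_if_not_summable mart_weight_nonneg)
qed

lemma total_weight_eventually_pos: "eventually (\<lambda>n. total_weight n > 0) sequentially"
  using total_weight_at_top by (auto simp: filterlim_at_top_dense)

text \<open>The relative increments of \<open>n * mart_weight n\<close> tend to
  \<open>kappa\<close>, hence so does their average with weights \<open>mart_weight\<close>. That
  average telescopes to the quotient sought, up to a constant divided by the total weight.\<close>

lemma mart_weight_over_total: "(\<lambda>n. real n * (mart_weight n / total_weight n)) \<longlonglongrightarrow> kappa"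
proof -
  let ?x = "\<lambda>n. (real (Suc n) * mart_weight (Suc n) - real n * mart_weight n) / mart_weight n"
  have "(\<lambda>n. (\<Sum>k<n. mart_weight k * ?x k) / (\<Sum>k<n. mart_weight k)) \<longlonglongrightarrow> kappa"
    unfolding kappa_def
    using mart_weight_nonneg total_weight_at_top mart_weight_increment_tendsto
    by (intro weighted_average_tendsto) (auto simp: total_weight_def[abs_def])
  moreover have "(\<lambda>n. mart_weight 1 * inverse (total_weight n)) \<longlonglongrightarrow> mart_weight 1 * 0"
    by (intro tendsto_intros tendsto_inverse_0_at_top total_weight_at_top)
  ultimately have "(\<lambda>n. mart_weight 1 * inverse (total_weight n) + (\<Sum>k<n. mart_weight k * ?x k) / total_weight n)
      \<longlonglongrightarrow> mart_weight 1 * 0 + kappa"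
    unfolding total_weight_def by (intro tendsto_add)
  moreover have "eventually (\<lambda>n. mart_weight 1 * inverse (total_weight n) + (\<Sum>k<n. mart_weight k * ?x k) / total_weight n
      = real n * (mart_weight n / total_weight n)) sequentially"
    using eventually_ge_at_top[of 1]
  proof eventually_elim
    case (elim n)
    \<comment> \<open>The term at 0 vanishes because \<open>mart_weight 0 = 0\<close>, so the
      telescoping sum starts at \<open>mart_weight 1\<close>.\<close>
    have "(\<Sum>k<Suc m. mart_weight k * ?x k) = real (Suc m) * mart_weight (Suc m) - mart_weight 1" for m
    proof (induction m)
      case 0
      show ?case by (simp add: mart_weight_def nu_def)
    next
      case (Suc m)
      then show ?case using mart_weight_pos[of "Suc m"]
        by (subst sum.lessThan_Suc) (simp del: sum.lessThan_Suc)
    qed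
    from this[of "n - 1"] have sum_eq: "(\<Sum>k<n. mart_weight k * ?x k) = real n * mart_weight n - mart_weight 1"
      using elim by simp
    show ?case unfolding sum_eq by (simp add: divide_inverse algebra_simps)
  qed
  ultimately show ?thesis using Lim_transform_eventually by fastforce
qed

lemma scale_total_weight: "(\<lambda>n. scale n * total_weight n) \<longlonglongrightarrow> (\<gamma> + 1) / kappa"
proof -
  have "(\<lambda>n. (real n * \<mu> n / nu \<mu> n) / (real n * (mart_weight n / total_weight n))) \<longlonglongrightarrow> (\<gamma> + 1) / kappa"
    using kappa_pos by (intro tendsto_divide memory_share_tendsto mart_weight_over_total) auto
  moreover have "eventually (\<lambda>n. (real n * \<mu> n / nu \<mu> n) / (real n * (mart_weight n / total_weight n))
      = scale n * total_weight n) sequentially"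
    using eventually_ge_at_top[of 1] total_weight_eventually_pos
  proof eventually_elim
    case (elim n)
    show ?case using scale_mart_weight[OF elim(1), symmetric] mart_weight_pos[OF elim(1)] elim by simp
  qed
  ultimately show ?thesis by (rule Lim_transform_eventually)
qed

text \<open>The total weight vanishes at 0 and at 1; adding 1 provides the positive normalization
  that Kronecker's lemma divides by, with the same asymptotics.\<close>

lemma scale_succ_total_weight: "(\<lambda>n. scale n * (1 + total_weight n)) \<longlonglongrightarrow> (\<gamma> + 1) / kappa"
  using tendsto_add[OF scale_tendsto scale_total_weight] by (simp add: distrib_left)

lemma floor_time_at_top:
  assumes "t > 0"
  shows "filterlim (\<lambda>n. nat \<lfloor>real n * t\<rfloor>) at_top sequentially"
  using assms by real_asymp

lemma scale_total_weight_pointwise: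
  assumes "t \<ge> 0"
  shows "(\<lambda>n. scale n * total_weight (nat \<lfloor>real n * t\<rfloor>)) \<longlonglongrightarrow> (\<gamma> + 1) / kappa * t powr kappa"
\<comment> \<open>At time 0 both sides are 0, since \<open>0 powr kappa = 0\<close>; regular
  variation covers positive times only.\<close>
proof (cases "t = 0")
  case False
  have "eventually (\<lambda>n. real n * (mart_weight n / total_weight n) = real n * (total_weight (Suc n) / total_weight n - 1)) sequentially"
    using total_weight_eventually_pos
    by eventually_elim (simp add: total_weight_Suc add_divide_distrib)
  then have "(\<lambda>n. real n * (total_weight (Suc n) / total_weight n - 1)) \<longlonglongrightarrow> kappa"
    by (rule Lim_transform_eventually[OF mart_weight_over_total])
  then have "(\<lambda>n. total_weight (nat \<lfloor>real n * t\<rfloor>) / total_weight n) \<longlonglongrightarrow> t powr kappa"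
    using False assms by (intro ratio_regularly_varying total_weight_eventually_pos) auto
  then have "(\<lambda>n. (scale n * total_weight n) * (total_weight (nat \<lfloor>real n * t\<rfloor>) / total_weight n))
      \<longlonglongrightarrow> (\<gamma> + 1) / kappa * t powr kappa"
    by (intro tendsto_mult scale_total_weight)
  moreover have "eventually (\<lambda>n. (scale n * total_weight n) * (total_weight (nat \<lfloor>real n * t\<rfloor>) / total_weight n)
      = scale n * total_weight (nat \<lfloor>real n * t\<rfloor>)) sequentially"
    using total_weight_eventually_pos by eventually_elim auto
  ultimately show ?thesis by (rule Lim_transform_eventually)
qed simp

lemma scale_total_weight_unif:
  assumes T: "T > 0"
  shows "(\<lambda>n. unif_dist T (\<lambda>t. scale n * total_weight (nat \<lfloor>real n * t\<rfloor>))
      (\<lambda>t. (\<gamma> + 1) / kappa * t powr kappa)) \<longlonglongrightarrow> 0"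
proof -
  \<comment> \<open>\<open>scale 0\<close> contains the arbitrary value \<open>\<mu> 0\<close> and
    may be negative; \<open>max 1 n\<close> makes the profile monotone in time for every
    \<open>n\<close>.\<close>
  have "uniform_limit {0..T} (\<lambda>n t. scale (max 1 n) * total_weight (nat \<lfloor>real n * t\<rfloor>))
      (\<lambda>t. (\<gamma> + 1) / kappa * t powr kappa) sequentially"
  proof (rule monotone_pointwise_imp_uniform[OF T])
    show "mono_on {0..T} (\<lambda>t. scale (max 1 n) * total_weight (nat \<lfloor>real n * t\<rfloor>))" for n
      using scale_pos[of "max 1 n"]
      by (intro mono_onI mult_left_mono total_weight_mono nat_mono floor_mono) (auto intro: less_imp_le)
    show "continuous_on {0..T} (\<lambda>t. (\<gamma> + 1) / kappa * t powr kappa)"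
      using kappa_pos
      by (intro continuous_on_mult continuous_on_const continuous_on_powr' continuous_on_id) auto
    fix t assume "t \<in> {0..T}"
    moreover have "eventually (\<lambda>n. scale n * total_weight (nat \<lfloor>real n * t\<rfloor>)
       = scale (max 1 n) * total_weight (nat \<lfloor>real n * t\<rfloor>)) sequentially"
      using eventually_ge_at_top[of 1] by eventually_elim (simp add: max_def)
    ultimately show "(\<lambda>n. scale (max 1 n) * total_weight (nat \<lfloor>real n * t\<rfloor>)) \<longlonglongrightarrow> (\<gamma> + 1) / kappa * t powr kappa"
      by (intro Lim_transform_eventually[OF scale_total_weight_pointwise]) auto
  qed
  from unif_dist_tendsto_0I[OF this] show ?thesis
    by (rule Lim_transform_eventually)
       (use eventually_ge_at_top[of 1] in \<open>eventually_elim, simp add: max_def\<close>)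
qed

lemma inverse_total_weight_square_summable: "summable (\<lambda>n. (1 / (1 + total_weight n))\<^sup>2)"
proof -
  \<comment> \<open>The product \<open>scale n * (1 + total_weight n)\<close> has limit
    \<open>2 / c\<close>, so it eventually exceeds \<open>1 / c\<close>.\<close>
  define c where "c = 2 * kappa / (\<gamma> + 1)"
  have c: "c > 0" using kappa_pos gamma_in by (simp add: c_def)
  have half_less: "x / 2 < x" if "x > 0" for x :: real using that by simp
  have "1 / c = (\<gamma> + 1) / kappa / 2" by (simp add: c_def)
  moreover have "(\<gamma> + 1) / kappa > 0" using kappa_pos gamma_in by simp
  ultimately have "1 / c < (\<gamma> + 1) / kappa" using half_less[of "(\<gamma> + 1) / kappa"] by (simp only:)
  with scale_succ_total_weight have "eventually (\<lambda>n. scale n * (1 + total_weight n) > 1 / c) sequentially"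
    by (rule order_tendstoD)
  then have "eventually (\<lambda>n. norm ((1 / (1 + total_weight n))\<^sup>2) \<le> c\<^sup>2 * (scale n)\<^sup>2) sequentially"
  proof eventually_elim
    case (elim n)
    have "1 / (1 + total_weight n) \<le> c * scale n"
      using elim c total_weight_nonneg[of n] by (simp add: field_simps)
    then have "(1 / (1 + total_weight n))\<^sup>2 \<le> (c * scale n)\<^sup>2"
      using total_weight_nonneg[of n] by (intro power_mono) auto
    then show ?case by (simp add: power_mult_distrib)
  qed
  moreover have "summable (\<lambda>n. c\<^sup>2 * (scale n)\<^sup>2)"
    using scale_square_summable by (intro summable_mult) (simp add: summable_Suc_iff[of "\<lambda>n. (scale n)\<^sup>2"])
  ultimately show ?thesis by (rule summable_comparison_test_ev)
qed

lemma succ_total_weight_incseq: "incseq (\<lambda>n. 1 + total_weight n)"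
  using total_weight_mono by (auto simp: incseq_def)

lemma succ_total_weight_at_top: "filterlim (\<lambda>n. 1 + total_weight n) at_top sequentially"
  by (intro filterlim_tendsto_add_at_top[OF tendsto_const] total_weight_at_top)

text \<open>Kronecker's lemma with all terms equal to 1 and normalization
  \<open>(1 + total_weight n)\<^sup>2\<close>. This is what makes the noise negligible in mean
  square, as its sum over \<open>n\<close> steps has second moment at most \<open>n\<close>.\<close>

lemma linear_scale_square_tendsto: "(\<lambda>n. real n * (scale n)\<^sup>2) \<longlonglongrightarrow> 0"
proof -
  have W: "1 + total_weight n > 0" for n using total_weight_nonneg[of n] by simp
  have "(\<lambda>n. (\<Sum>k<n. 1) / (1 + total_weight n)\<^sup>2) \<longlonglongrightarrow> 0"
  proof (rule kronecker)
    show "incseq (\<lambda>n. (1 + total_weight n)\<^sup>2)"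
      using total_weight_mono total_weight_nonneg by (auto simp: incseq_def intro!: power_mono)
    show "filterlim (\<lambda>n. (1 + total_weight n)\<^sup>2) at_top sequentially"
      by (intro filterlim_pow_at_top succ_total_weight_at_top) auto
    show "summable (\<lambda>k. 1 / (1 + total_weight k)\<^sup>2)"
      using inverse_total_weight_square_summable by (simp add: power_divide)
  qed (use W in \<open>auto simp: less_imp_neq[symmetric]\<close>)
  then have "(\<lambda>n. (scale n * (1 + total_weight n))\<^sup>2 * (real n / (1 + total_weight n)\<^sup>2)) \<longlonglongrightarrow> ((\<gamma> + 1) / kappa)\<^sup>2 * 0"
    by (intro tendsto_mult tendsto_power scale_succ_total_weight) simp
  moreover have "(scale n * (1 + total_weight n))\<^sup>2 * (real n / (1 + total_weight n)\<^sup>2) = real n * (scale n)\<^sup>2" for n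
    using W[of n] by (simp add: power_mult_distrib)
  ultimately show ?thesis by simp
qed

text \<open>Monotonicity of the total weight carries the pointwise bound over to the maximum: late
  terms are at most \<open>\<epsilon> * (1 + total_weight m)\<close>, while the early ones
  contribute a constant that \<open>scale n\<close> sends to 0.\<close>

lemma scaled_running_max_tendsto:
  assumes e: "(\<lambda>m. e m / (1 + total_weight m)) \<longlonglongrightarrow> 0" and T: "T > 0"
  shows "(\<lambda>n. scale n * running_max e (nat \<lfloor>real n * T\<rfloor>)) \<longlonglongrightarrow> 0"
proof (rule LIMSEQ_I)
  fix r :: real assume r: "r > 0"
  define L where "L = (\<gamma> + 1) / kappa * T powr kappa"
  have L: "L \<ge> 0" using kappa_pos gamma_in by (simp add: L_def)
  define \<epsilon> where "\<epsilon> = r / (L + 1)"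
  have \<epsilon>: "\<epsilon> > 0" "\<epsilon> * L < r" using r L by (auto simp: \<epsilon>_def field_simps)
  have W: "1 + total_weight n > 0" for n using total_weight_nonneg[of n] by simp
  obtain N where N: "\<And>m. m \<ge> N \<Longrightarrow> \<bar>e m / (1 + total_weight m)\<bar> < \<epsilon>"
    using LIMSEQ_D[OF e \<epsilon>(1)] by auto
  define K where "K = running_max e N"
  have bound: "running_max e m \<le> K + \<epsilon> * (1 + total_weight m)" for m
  proof (rule running_max_le)
    fix k assume k: "k \<le> m"
    show "\<bar>e k\<bar> \<le> K + \<epsilon> * (1 + total_weight m)"
    proof (cases "k \<le> N")
      case True
      then have "\<bar>e k\<bar> \<le> K" unfolding K_def by (rule running_max_ge)
      moreover have "\<epsilon> * (1 + total_weight m) \<ge> 0" using \<epsilon> W[of m] by simp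
      ultimately show ?thesis by linarith
    next
      case False
      then have "\<bar>e k\<bar> \<le> \<epsilon> * (1 + total_weight k)"
        using N[of k] W[of k] by (simp add: abs_divide field_simps)
      also have "\<dots> \<le> \<epsilon> * (1 + total_weight m)" using total_weight_mono[OF k] \<epsilon> by simp
      finally show ?thesis using running_max_nonneg[of e N] by (simp add: K_def)
    qed
  qed
  have "(\<lambda>n. scale n * (K + \<epsilon>) + \<epsilon> * (scale n * total_weight (nat \<lfloor>real n * T\<rfloor>))) \<longlonglongrightarrow> 0 * (K + \<epsilon>) + \<epsilon> * L"
    unfolding L_def using T by (intro tendsto_intros scale_tendsto scale_total_weight_pointwise) auto
  then have "eventually (\<lambda>n. scale n * (K + \<epsilon>) + \<epsilon> * (scale n * total_weight (nat \<lfloor>real n * T\<rfloor>)) < r) sequentially"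
    using \<epsilon> by (intro order_tendstoD) auto
  then have "eventually (\<lambda>n. norm (scale n * running_max e (nat \<lfloor>real n * T\<rfloor>) - 0) < r) sequentially"
    using eventually_ge_at_top[of 1]
  proof eventually_elim
    case (elim n)
    have "scale n * running_max e (nat \<lfloor>real n * T\<rfloor>) \<le> scale n * (K + \<epsilon> * (1 + total_weight (nat \<lfloor>real n * T\<rfloor>)))"
      using bound scale_pos[OF elim(2)] by (intro mult_left_mono) auto
    also have "\<dots> < r" using elim by (simp add: algebra_simps)
    finally show ?case using running_max_nonneg[of e] scale_pos[OF elim(2)] by simp
  qed
  then show "\<exists>no. \<forall>n\<ge>no. norm (scale n * running_max e (nat \<lfloor>real n * T\<rfloor>) - 0) < r"
    by (simp add: eventually_sequentially)
qed

end

section \<open>Independence of past and present sources\<close>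

lemma vimage_algebra_Int_stable: "Int_stable {Y -` A \<inter> S | A. A \<in> sets N}"
proof (rule Int_stableI)
  fix a b assume "a \<in> {Y -` A \<inter> S | A. A \<in> sets N}" "b \<in> {Y -` A \<inter> S | A. A \<in> sets N}"
  then obtain A B where "A \<in> sets N" "B \<in> sets N" "a = Y -` A \<inter> S" "b = Y -` B \<inter> S" by auto
  then show "a \<inter> b \<in> {Y -` A \<inter> S | A. A \<in> sets N}" by (intro CollectI exI[of _ "A \<inter> B"]) auto
qed

context srrw_rvm
begin

text \<open>One family indexed by source and time. Separating past from present cuts across all
  three sources, which a single independent family allows.\<close>

definition source_events :: "source \<times> nat \<Rightarrow> 'a set set" where
  "source_events i = (case fst i of
       Innovation \<Rightarrow> {\<xi> (snd i) -` A \<inter> space M | A. A \<in> sets borel}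
     | Recollection \<Rightarrow> {\<alpha> (snd i) -` A \<inter> space M | A. A \<in> sets (count_space UNIV)}
     | Recalled_Time \<Rightarrow> {\<beta> (snd i) -` A \<inter> space M | A. A \<in> sets (count_space UNIV)})"

definition source_index :: "(source \<times> nat) set" where
  "source_index = {Innovation} \<times> {1..} \<union> {Recollection, Recalled_Time} \<times> {2..}"

definition block :: "(source \<times> nat) set \<Rightarrow> 'a measure" where
  "block K = sigma (space M) (\<Union>i\<in>K. source_events i)"

lemma source_UNIV: "(UNIV :: source set) = {Innovation, Recollection, Recalled_Time}"
  using source.exhaust by auto

lemma source_events_Pow: "source_events i \<subseteq> Pow (space M)"
  by (auto simp: source_events_def split: source.splits)

lemma source_events_indep: "indep_sets source_events source_index"
proof (rule indep_setsI)
  have rvs: "random_variable borel (\<xi> k)" if "k \<ge> 1" for k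
    using xi_indep that by (auto simp: indep_vars_def)
  have rva: "random_variable (count_space UNIV) (\<alpha> k)" if "k \<ge> 2" for k
    using alpha_indep that by (auto simp: indep_vars_def)
  have rvb: "random_variable (count_space UNIV) (\<beta> k)" if "k \<ge> 2" for k
    using beta_indep that by (auto simp: indep_vars_def)
  show "source_events i \<subseteq> events" if "i \<in> source_index" for i
    using that rvs rva rvb by (auto simp: source_events_def source_index_def intro: measurable_sets)
  fix A J assume J: "J \<noteq> {}" "J \<subseteq> source_index" "finite J" and A: "\<forall>j\<in>J. A j \<in> source_events j"
  define T where "T = (\<lambda>s. {k. (s, k) \<in> J})"
  have finT: "finite (T s)" for s
    unfolding T_def using J(3) finite_vimageI[of J "\<lambda>k. (s, k)"] by (simp add: inj_on_def vimage_def)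
  define idx :: "source \<Rightarrow> nat set" where "idx = (\<lambda>s. if s = Innovation then {1..} else {2..})"
  have T_sub: "T s \<subseteq> idx s" for s
    using J(2) by (cases s) (auto simp: T_def idx_def source_index_def)
  have ind: "indep_sets (\<lambda>k. source_events (s, k)) (idx s)" for s
    using xi_indep alpha_indep beta_indep
    by (cases s) (simp_all add: source_events_def idx_def indep_vars_def2)
  \<comment> \<open>The intersection with \<open>space M\<close> gives the full event, of
    probability 1, for a source that contributes no index.\<close>
  define B where "B = (\<lambda>s. space M \<inter> (\<Inter>k\<in>T s. A (s, k)))"
  have sub: "A (s, k) \<subseteq> space M" if "k \<in> T s" for s k
    using A that source_events_Pow[of "(s, k)"] by (auto simp: T_def)
  have prob_B: "prob (B s) = (\<Prod>k\<in>T s. prob (A (s, k)))" for s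
  proof (cases "T s = {}")
    case False
    then have "B s = (\<Inter>k\<in>T s. A (s, k))" using sub by (fastforce simp: B_def)
    then show ?thesis
      using indep_setsD[OF ind[of s] T_sub False finT, of "\<lambda>k. A (s, k)"] A by (auto simp: T_def)
  qed (simp add: B_def prob_space)
  have genB: "B s \<in> generated_sets M N Y (idx s)"
    if "\<And>k. k \<in> idx s \<Longrightarrow> source_events (s, k) = {Y k -` A \<inter> space M | A. A \<in> sets N}" for s N and Y :: "nat \<Rightarrow> 'a \<Rightarrow> 'c"
  proof -
    let ?G = "\<Union>k\<in>idx s. {Y k -` A \<inter> space M | A. A \<in> sets N}"
    have G: "?G \<subseteq> Pow (space M)" by auto
    let ?N = "sigma (space M) ?G"
    have N: "sets ?N = sigma_sets (space M) ?G" "space ?N = space M"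
      using G by (simp_all add: sets_measure_of space_measure_of)
    have "A (s, k) \<in> sigma_sets (space M) ?G" if "k \<in> T s" for k
    proof -
      have "A (s, k) \<in> source_events (s, k)" "k \<in> idx s" using A that T_sub by (auto simp: T_def)
      then show ?thesis using \<open>\<And>k. k \<in> idx s \<Longrightarrow> source_events (s, k) = _\<close> by (intro sigma_sets.Basic) blast
    qed
    then have mem: "A (s, k) \<in> sets ?N" if "k \<in> T s" for k using that N(1) by blast
    have "B s \<in> sets ?N"
    proof (cases "T s = {}")
      case True
      then have "B s = space ?N" by (simp add: B_def N(2))
      then show ?thesis by (simp only: sets.top)
    next
      case False
      have "space ?N \<inter> (\<Inter>k\<in>T s. A (s, k)) \<in> sets ?N"
        by (intro sets.Int[OF sets.top] sets.finite_INT[OF finT False mem])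
      then show ?thesis by (simp only: B_def N(2))
    qed
    then have "B s \<in> sigma_sets (space M) ?G" using N(1) by blast
    then show ?thesis by (simp add: generated_sets_def)
  qed
  \<comment> \<open>The probability factors over the three sources here, and within each source by
    \<open>prob_B\<close>; the double product is then merged into one over \<open>J\<close>.\<close>
  have "prob (\<Inter>s\<in>UNIV. B s) = (\<Prod>s\<in>UNIV. prob (B s))"
  proof (rule indep_setsD[OF sources_indep])
    show "\<forall>s\<in>UNIV. B s \<in> (case s of
           Innovation \<Rightarrow> generated_sets M borel \<xi> {1..}
         | Recollection \<Rightarrow> generated_sets M (count_space UNIV) \<alpha> {2..}
         | Recalled_Time \<Rightarrow> generated_sets M (count_space UNIV) \<beta> {2..})"
    proof
      fix s :: source show "B s \<in> (case s of
           Innovation \<Rightarrow> generated_sets M borel \<xi> {1..}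
         | Recollection \<Rightarrow> generated_sets M (count_space UNIV) \<alpha> {2..}
         | Recalled_Time \<Rightarrow> generated_sets M (count_space UNIV) \<beta> {2..})"
      proof (cases s)
        case Innovation
        have "B Innovation \<in> generated_sets M borel \<xi> (idx Innovation)"
          by (rule genB) (simp add: source_events_def)
        then show ?thesis unfolding Innovation source.case by (simp add: idx_def)
      next
        case Recollection
        have "B Recollection \<in> generated_sets M (count_space UNIV) \<alpha> (idx Recollection)"
          by (rule genB) (simp add: source_events_def)
        then show ?thesis unfolding Recollection source.case by (simp add: idx_def)
      next
        case Recalled_Time
        have "B Recalled_Time \<in> generated_sets M (count_space UNIV) \<beta> (idx Recalled_Time)"
          by (rule genB) (simp add: source_events_def)
        then show ?thesis unfolding Recalled_Time source.case by (simp add: idx_def)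
      qed
    qed
  qed (auto simp: source_UNIV)
  also have "(\<Inter>s\<in>UNIV. B s) = (\<Inter>j\<in>J. A j)"
  proof -
    obtain s0 k0 where "(s0, k0) \<in> J" using J(1) by auto
    then have "(\<Inter>j\<in>J. A j) \<subseteq> space M" using sub[of k0 s0] by (auto simp: T_def)
    then show ?thesis by (fastforce simp: B_def T_def)
  qed
  also have "(\<Prod>s\<in>UNIV. prob (B s)) = (\<Prod>s\<in>UNIV. \<Prod>k\<in>T s. prob (A (s, k)))"
    by (simp add: prob_B)
  also have "\<dots> = (\<Prod>(s, k)\<in>(SIGMA s:UNIV. T s). prob (A (s, k)))"
    using finT by (intro prod.Sigma) (auto simp: source_UNIV)
  also have "(SIGMA s:UNIV. T s) = J" by (auto simp: T_def)
  finally show "prob (\<Inter>j\<in>J. A j) = (\<Prod>j\<in>J. prob (A j))" by (simp add: case_prod_unfold)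
qed

lemma source_events_subset: "i \<in> source_index \<Longrightarrow> source_events i \<subseteq> events"
  using source_events_indep by (auto simp: indep_sets_def)

lemma block_space [simp]: "space (block K) = space M"
  unfolding block_def using source_events_Pow by (intro space_measure_of) auto

lemma sets_block: "sets (block K) = sigma_sets (space M) (\<Union>i\<in>K. source_events i)"
  unfolding block_def using source_events_Pow by (intro sets_measure_of) auto

lemma block_subalgebra:
  assumes "K \<subseteq> source_index"
  shows "subalgebra M (block K)"
proof -
  have "(\<Union>i\<in>K. source_events i) \<subseteq> events" using source_events_subset assms by blast
  then have "sets (block K) \<subseteq> events" unfolding sets_block by (rule sets.sigma_sets_subset)
  then show ?thesis by (simp add: subalgebra_def)
qed

lemma block_mono: "K \<subseteq> L \<Longrightarrow> sets (block K) \<subseteq> sets (block L)"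
  unfolding sets_block by (intro sigma_sets_mono') auto

lemma source_events_Int_stable: "Int_stable (source_events i)"
  unfolding source_events_def
  by (cases "fst i") (simp_all only: source.case vimage_algebra_Int_stable)

text \<open>Disjoint index sets generate independent sigma-algebras, since the generators are closed
  under intersection. Later independence arguments reduce to disjointness of index sets.\<close>

lemma block_indep_var:
  fixes U V :: "'a \<Rightarrow> real"
  assumes K: "K \<subseteq> source_index" and L: "L \<subseteq> source_index" and disj: "K \<inter> L = {}"
    and U: "U \<in> borel_measurable (block K)" and V: "V \<in> borel_measurable (block L)"
  shows "indep_var borel U borel V"
  unfolding indep_var_eq
proof (intro conjI)
  show "random_variable borel U" "random_variable borel V"
    using measurable_from_subalg[OF block_subalgebra] K L U V by auto
  have "indep_sets (\<lambda>b. sigma_sets (space M) (\<Union>i\<in>case_bool K L b. source_events i)) UNIV"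
  proof (rule indep_sets_collect_sigma)
    have "(\<Union>b. case_bool K L b) = K \<union> L" by (auto simp: UNIV_bool)
    then show "indep_sets source_events (\<Union>b. case_bool K L b)"
      using indep_sets_mono_index[OF _ source_events_indep, of "K \<union> L"] K L by simp
    show "disjoint_family_on (case_bool K L) UNIV"
      using disj by (auto simp: disjoint_family_on_def split: bool.splits)
  qed (rule source_events_Int_stable)
  then have ind: "indep_sets (\<lambda>b. case_bool (sets (block K)) (sets (block L)) b) UNIV"
    by (rule indep_sets_mono_sets) (auto simp: sets_block split: bool.splits)
  have s: "sigma_sets (space M) {X -` A \<inter> space M | A. A \<in> sets borel} \<subseteq> sets (block K')"
    if "X \<in> borel_measurable (block K')" for X :: "'a \<Rightarrow> real" and K'
    using sets.sigma_sets_subset[of "{X -` A \<inter> space M | A. A \<in> sets borel}" "block K'"]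
      measurable_sets[OF that] by auto
  show "indep_set (sigma_sets (space M) {U -` A \<inter> space M | A. A \<in> sets borel})
     (sigma_sets (space M) {V -` A \<inter> space M | A. A \<in> sets borel})"
    unfolding indep_set_def
    by (rule indep_sets_mono_sets[OF ind]) (use s[OF U] s[OF V] in \<open>auto split: bool.splits\<close>)
qed

lemma block_expectation_mult:
  fixes U V :: "'a \<Rightarrow> real"
  assumes "K \<subseteq> source_index" "L \<subseteq> source_index" "K \<inter> L = {}"
    and "U \<in> borel_measurable (block K)" "V \<in> borel_measurable (block L)"
    and "integrable M U" "integrable M V"
  shows "integrable M (\<lambda>\<omega>. U \<omega> * V \<omega>)"
    and "expectation (\<lambda>\<omega>. U \<omega> * V \<omega>) = expectation U * expectation V"
  using indep_var_integrable[OF block_indep_var[OF assms(1-5)] assms(6,7)]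
    indep_var_lebesgue_integral[OF block_indep_var[OF assms(1-5)] assms(6,7)] by auto

lemma block_measurable_source:
  assumes "i \<in> K"
  shows "fst i = Innovation \<Longrightarrow> \<xi> (snd i) \<in> borel_measurable (block K)"
    and "fst i = Recollection \<Longrightarrow> \<alpha> (snd i) \<in> measurable (block K) (count_space UNIV)"
    and "fst i = Recalled_Time \<Longrightarrow> \<beta> (snd i) \<in> measurable (block K) (count_space UNIV)"
proof -
  have E: "E \<in> sets (block K)" if "E \<in> source_events i" for E
    using that assms by (auto simp: sets_block intro!: sigma_sets.Basic)
  show "\<xi> (snd i) \<in> borel_measurable (block K)" if "fst i = Innovation"
    by (rule measurableI) (auto intro!: E exI simp: source_events_def that)
  show "\<alpha> (snd i) \<in> measurable (block K) (count_space UNIV)" if "fst i = Recollection"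
    by (rule measurableI) (auto intro!: E exI simp: source_events_def that)
  show "\<beta> (snd i) \<in> measurable (block K) (count_space UNIV)" if "fst i = Recalled_Time"
    by (rule measurableI) (auto intro!: E exI simp: source_events_def that)
qed

text \<open>\<open>block (past n)\<close> is the filtration of the model at time
  \<open>n\<close>.\<close>

definition past :: "nat \<Rightarrow> (source \<times> nat) set" where
  "past n = {i \<in> source_index. snd i \<le> n}"

definition present :: "nat \<Rightarrow> (source \<times> nat) set" where
  "present n = {i \<in> source_index. snd i = n}"

lemma past_subset: "past n \<subseteq> source_index" and present_subset: "present n \<subseteq> source_index"
  by (auto simp: past_def present_def)

lemma past_present_disjoint: "past n \<inter> present (Suc n) = {}"
  by (auto simp: past_def present_def)

lemma in_past: "1 \<le> k \<Longrightarrow> k \<le> n \<Longrightarrow> (Innovation, k) \<in> past n"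
  "2 \<le> k \<Longrightarrow> k \<le> n \<Longrightarrow> (Recollection, k) \<in> past n"
  "2 \<le> k \<Longrightarrow> k \<le> n \<Longrightarrow> (Recalled_Time, k) \<in> past n"
  by (auto simp: past_def source_index_def)

lemma in_present: "1 \<le> k \<Longrightarrow> (Innovation, k) \<in> present k"
  "2 \<le> k \<Longrightarrow> (Recollection, k) \<in> present k"
  "2 \<le> k \<Longrightarrow> (Recalled_Time, k) \<in> present k"
  by (auto simp: present_def source_index_def)

abbreviation X where "X \<equiv> srrw_step \<xi> \<alpha> \<beta>"

text \<open>Indicator that step \<open>n\<close> repeats step \<open>j\<close>. It lets the randomly
  chosen step be written as a finite sum of products of a present indicator and a past step, which
  then factor by independence.\<close>

definition recall :: "nat \<Rightarrow> nat \<Rightarrow> 'a \<Rightarrow> real" where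
  "recall n j \<omega> = of_bool (\<alpha> n \<omega>) * of_bool (\<beta> n \<omega> = j)"

definition fresh :: "nat \<Rightarrow> 'a \<Rightarrow> real" where
  "fresh n \<omega> = (1 - of_bool (\<alpha> n \<omega>))"

lemma step_1: "X (Suc 0) \<omega> = \<xi> 1 \<omega>"
  by (simp add: srrw_step.simps(2))

lemma step_Suc:
  assumes "n \<ge> 1"
  shows "X (Suc n) \<omega> = (\<Sum>j=1..n. recall (Suc n) j \<omega> * X j \<omega>) + fresh (Suc n) \<omega> * \<xi> (Suc n) \<omega>"
proof -
  have "(\<Sum>j=1..n. of_bool (\<beta> (Suc n) \<omega> = j) * X j \<omega>)
      = (if \<beta> (Suc n) \<omega> \<in> {1..n} then X (\<beta> (Suc n) \<omega>) \<omega> else 0)"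
    by (simp add: of_bool_def if_distrib[of "\<lambda>x. x * _"] sum.delta' cong: if_cong)
  then show ?thesis using assms
    by (simp add: srrw_step.simps(2) recall_def fresh_def sum_distrib_left mult.assoc del: sum.cong)
qed

text \<open>At most one of the indicators is nonzero, so squaring commutes with the selection and
  there are no cross terms.\<close>

lemma step_Suc_square:
  assumes "n \<ge> 1"
  shows "(X (Suc n) \<omega>)\<^sup>2 = (\<Sum>j=1..n. recall (Suc n) j \<omega> * (X j \<omega>)\<^sup>2) + fresh (Suc n) \<omega> * (\<xi> (Suc n) \<omega>)\<^sup>2"
proof -
  have "(\<Sum>j=1..n. of_bool (\<beta> (Suc n) \<omega> = j) * (X j \<omega>)\<^sup>2)
      = (if \<beta> (Suc n) \<omega> \<in> {1..n} then (X (\<beta> (Suc n) \<omega>) \<omega>)\<^sup>2 else 0)"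
    by (simp add: of_bool_def if_distrib[of "\<lambda>x. x * _"] sum.delta' cong: if_cong)
  then show ?thesis using assms
    by (simp add: srrw_step.simps(2) recall_def fresh_def sum_distrib_left[symmetric] mult.assoc)
qed

lemma recall_measurable:
  assumes "n \<ge> 2" "(Recollection, n) \<in> K" "(Recalled_Time, n) \<in> K"
  shows "recall n j \<in> borel_measurable (block K)"
proof -
  have a: "\<alpha> n \<in> measurable (block K) (count_space UNIV)" "\<beta> n \<in> measurable (block K) (count_space UNIV)"
    using block_measurable_source(2)[OF assms(2)] block_measurable_source(3)[OF assms(3)] by auto
  show ?thesis unfolding recall_def
    using measurable_compose[OF a(1), of "\<lambda>b. of_bool b :: real" borel]
      measurable_compose[OF a(2), of "\<lambda>i. of_bool (i = j) :: real" borel] by auto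
qed

lemma fresh_measurable:
  assumes "n \<ge> 2" "(Recollection, n) \<in> K"
  shows "fresh n \<in> borel_measurable (block K)"
proof -
  have a: "\<alpha> n \<in> measurable (block K) (count_space UNIV)"
    using block_measurable_source(2)[OF assms(2)] by auto
  show ?thesis unfolding fresh_def
    using measurable_compose[OF a, of "\<lambda>b. of_bool b :: real" borel] by auto
qed

lemma step_measurable: "X k \<in> borel_measurable (block (past n))" if "k \<le> n"
  using that
proof (induction k rule: less_induct)
  case (less k)
  show ?case
  proof (cases k)
    case 0
    then show ?thesis by (simp add: fun_eq_iff[THEN iffD2, of "X 0" "\<lambda>_. 0"])
  next
    case (Suc m)
    have xi: "\<xi> k \<in> borel_measurable (block (past n))"
      using block_measurable_source(1)[OF in_past(1)] less.prems Suc by auto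
    show ?thesis
    proof (cases "m = 0")
      case True
      then have "X k = \<xi> k" using Suc by (auto simp: step_1 fun_eq_iff)
      then show ?thesis using xi by simp
    next
      case False
      have "X k = (\<lambda>\<omega>. (\<Sum>j=1..m. recall k j \<omega> * X j \<omega>) + fresh k \<omega> * \<xi> k \<omega>)"
        using step_Suc[of m] False Suc by (auto simp: fun_eq_iff)
      moreover have "\<dots> \<in> borel_measurable (block (past n))"
        using False Suc less.prems
        by (intro borel_measurable_add borel_measurable_sum borel_measurable_times xi less.IH
            recall_measurable fresh_measurable in_past) auto
      ultimately show ?thesis by simp
    qed
  qed
qed

section \<open>Expectations of the recall and innovation indicators\<close>

lemma expectation_alpha:
  assumes "n \<ge> 2"
  shows "expectation (\<lambda>\<omega>. of_bool (\<alpha> n \<omega>)) = p"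
proof -
  have rv: "\<alpha> n \<in> measurable M (count_space UNIV)"
    using alpha_indep assms by (auto simp: indep_vars_def)
  have "expectation (\<lambda>\<omega>. of_bool (\<alpha> n \<omega>) :: real) = (\<integral>b. of_bool b \<partial>distr M (count_space UNIV) (\<alpha> n))"
    using rv by (subst integral_distr) auto
  also have "\<dots> = measure_pmf.expectation (bernoulli_pmf p) (\<lambda>b. of_bool b)"
    by (simp add: alpha_distr[OF assms])
  also have "\<dots> = p" using p_range by (simp add: integral_bernoulli_pmf)
  finally show ?thesis .
qed

lemma expectation_recall:
  assumes "n \<ge> 1" "j \<in> {1..n}"
  shows "integrable M (recall (Suc n) j)" "expectation (recall (Suc n) j) = p * \<mu> j / nu \<mu> n"
proof -
  let ?K = "{(Recollection, Suc n)}" and ?L = "{(Recalled_Time, Suc n)}"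
  have K: "?K \<subseteq> source_index" "?L \<subseteq> source_index" "?K \<inter> ?L = {}"
    using assms by (auto simp: source_index_def)
  have a: "\<alpha> (Suc n) \<in> measurable (block ?K) (count_space UNIV)"
    and b: "\<beta> (Suc n) \<in> measurable (block ?L) (count_space UNIV)"
    using block_measurable_source(2)[of "(Recollection, Suc n)" ?K]
      block_measurable_source(3)[of "(Recalled_Time, Suc n)" ?L] by auto
  have U: "(\<lambda>\<omega>. of_bool (\<alpha> (Suc n) \<omega>) :: real) \<in> borel_measurable (block ?K)"
    using measurable_compose[OF a, of "\<lambda>b. of_bool b :: real" borel] by auto
  have V: "(\<lambda>\<omega>. of_bool (\<beta> (Suc n) \<omega> = j) :: real) \<in> borel_measurable (block ?L)"
    using measurable_compose[OF b, of "\<lambda>i. of_bool (i = j) :: real" borel] by auto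
  note UM = measurable_from_subalg[OF block_subalgebra[OF K(1)] U]
  note VM = measurable_from_subalg[OF block_subalgebra[OF K(2)] V]
  have iU: "integrable M (\<lambda>\<omega>. of_bool (\<alpha> (Suc n) \<omega>) :: real)"
    by (rule integrable_const_bound[of _ 1]) (use UM in auto)
  have iV: "integrable M (\<lambda>\<omega>. of_bool (\<beta> (Suc n) \<omega> = j) :: real)"
    by (rule integrable_const_bound[of _ 1]) (use VM in auto)
  have "expectation (\<lambda>\<omega>. of_bool (\<beta> (Suc n) \<omega> = j)) = expectation (indicator {\<omega> \<in> space M. \<beta> (Suc n) \<omega> = j})"
    by (intro Bochner_Integration.integral_cong) (auto simp: indicator_def)
  also have "\<dots> = prob {\<omega> \<in> space M. \<beta> (Suc n) \<omega> = j}"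
    by (simp, rule arg_cong[where f = prob]) auto
  also have "\<dots> = \<mu> j / nu \<mu> n" using beta_distr[of "Suc n" j] assms by auto
  finally have eV: "expectation (\<lambda>\<omega>. of_bool (\<beta> (Suc n) \<omega> = j)) = \<mu> j / nu \<mu> n" .
  show "integrable M (recall (Suc n) j)" "expectation (recall (Suc n) j) = p * \<mu> j / nu \<mu> n"
    using block_expectation_mult[OF K U V iU iV] assms
    by (simp_all add: recall_def[abs_def] eV expectation_alpha)
qed

text \<open>Stated for a general \<open>f\<close> to serve the identity, for centring, and the
  square, for the second moment.\<close>

lemma expectation_fresh_mult:
  assumes "n \<ge> 2" and f: "f \<in> borel_measurable borel" and i: "integrable M (\<lambda>\<omega>. f (\<xi> n \<omega>))"
  shows "integrable M (\<lambda>\<omega>. fresh n \<omega> * f (\<xi> n \<omega>))"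
    and "expectation (\<lambda>\<omega>. fresh n \<omega> * f (\<xi> n \<omega>)) = (1 - p) * expectation (\<lambda>\<omega>. f (\<xi> n \<omega>))"
proof -
  let ?K = "{(Recollection, n)}" and ?L = "{(Innovation, n)}"
  have K: "?K \<subseteq> source_index" "?L \<subseteq> source_index" "?K \<inter> ?L = {}"
    using assms by (auto simp: source_index_def)
  have U: "fresh n \<in> borel_measurable (block ?K)" using assms by (intro fresh_measurable) auto
  have V: "(\<lambda>\<omega>. f (\<xi> n \<omega>)) \<in> borel_measurable (block ?L)"
    using block_measurable_source(1)[of "(Innovation, n)" ?L] f by auto
  note UM = measurable_from_subalg[OF block_subalgebra[OF K(1)] U]
  have iU: "integrable M (fresh n)"
    by (rule integrable_const_bound[of _ 1]) (use UM in \<open>auto simp: fresh_def\<close>)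
  have "(\<lambda>\<omega>. of_bool (\<alpha> n \<omega>) :: real) \<in> borel_measurable M"
  proof -
    have "(\<lambda>\<omega>. of_bool (\<alpha> n \<omega>) :: real) = (\<lambda>\<omega>. 1 - fresh n \<omega>)" by (auto simp: fresh_def)
    then show ?thesis using UM by simp
  qed
  then have "integrable M (\<lambda>\<omega>. of_bool (\<alpha> n \<omega>) :: real)"
    by (intro integrable_const_bound[of _ 1]) auto
  then have "expectation (fresh n) = 1 - p"
    using expectation_alpha[OF assms(1)] by (simp add: fresh_def[abs_def] prob_space)
  then show "integrable M (\<lambda>\<omega>. fresh n \<omega> * f (\<xi> n \<omega>))"
    "expectation (\<lambda>\<omega>. fresh n \<omega> * f (\<xi> n \<omega>)) = (1 - p) * expectation (\<lambda>\<omega>. f (\<xi> n \<omega>))"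
    using block_expectation_mult[OF K U V iU i] by simp_all
qed

end

section \<open>The martingale decomposition of the walk\<close>

context srrw_rvm
begin

sublocale memory_sequence p \<gamma> \<mu>
  using p_range gamma_gt memory by unfold_locales

definition weighted_sum :: "nat \<Rightarrow> 'a \<Rightarrow> real" where
  "weighted_sum n \<omega> = (\<Sum>k=1..n. \<mu> k * X k \<omega>)"

text \<open>The compensated step; for \<open>n = 0\<close> the compensator is \<open>0 / 0 = 0\<close>.\<close>

definition noise :: "nat \<Rightarrow> 'a \<Rightarrow> real" where
  "noise n \<omega> = X n \<omega> - p * weighted_sum (n - 1) \<omega> / nu \<mu> (n - 1)"

end

locale srrw_rvm_unit_variance = srrw_rvm +
  assumes xi_sq_integrable: "integrable M (\<lambda>\<omega>. (\<xi> 1 \<omega>)\<^sup>2)"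
    and xi_variance: "expectation (\<lambda>\<omega>. (\<xi> 1 \<omega>)\<^sup>2) = 1"
begin

lemma xi_moments:
  assumes "n \<ge> 1"
  shows "\<xi> n \<in> borel_measurable M" "integrable M (\<xi> n)" "expectation (\<xi> n) = 0"
    and "integrable M (\<lambda>\<omega>. (\<xi> n \<omega>)\<^sup>2)" "expectation (\<lambda>\<omega>. (\<xi> n \<omega>)\<^sup>2) = 1"
proof -
  have rv: "random_variable borel (\<xi> k)" if "k \<ge> 1" for k
    using xi_indep that by (auto simp: indep_vars_def)
  show "\<xi> n \<in> borel_measurable M" using rv assms by simp
  have i: "integrable M (\<lambda>\<omega>. f (\<xi> n \<omega>)) \<longleftrightarrow> integrable M (\<lambda>\<omega>. f (\<xi> 1 \<omega>))"
    and e: "expectation (\<lambda>\<omega>. f (\<xi> n \<omega>)) = expectation (\<lambda>\<omega>. f (\<xi> 1 \<omega>))"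
    if "f \<in> borel_measurable borel" for f :: "real \<Rightarrow> real"
    using integrable_distr_eq[OF rv[OF assms] that] integrable_distr_eq[OF rv[of 1] that]
      integral_distr[OF rv[OF assms] that] integral_distr[OF rv[of 1] that]
    by (simp_all add: xi_ident[OF assms])
  show "integrable M (\<xi> n)" "expectation (\<xi> n) = 0"
    using i[of "\<lambda>x. x"] e[of "\<lambda>x. x"] xi_integrable xi_mean by simp_all
  show "integrable M (\<lambda>\<omega>. (\<xi> n \<omega>)\<^sup>2)" "expectation (\<lambda>\<omega>. (\<xi> n \<omega>)\<^sup>2) = 1"
    using i[of "\<lambda>x. x\<^sup>2"] e[of "\<lambda>x. x\<^sup>2"] xi_sq_integrable xi_variance by simp_all
qed

lemma expectation_past_recall:
  assumes "n \<ge> 1" "j \<in> {1..n}" and U: "U \<in> borel_measurable (block (past n))" "integrable M U"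
  shows "integrable M (\<lambda>\<omega>. U \<omega> * recall (Suc n) j \<omega>)"
    and "expectation (\<lambda>\<omega>. U \<omega> * recall (Suc n) j \<omega>) = p * \<mu> j / nu \<mu> n * expectation U"
proof -
  have "recall (Suc n) j \<in> borel_measurable (block (present (Suc n)))"
    using assms by (intro recall_measurable in_present) auto
  from block_expectation_mult[OF past_subset present_subset past_present_disjoint U(1) this U(2)]
  show "integrable M (\<lambda>\<omega>. U \<omega> * recall (Suc n) j \<omega>)"
    "expectation (\<lambda>\<omega>. U \<omega> * recall (Suc n) j \<omega>) = p * \<mu> j / nu \<mu> n * expectation U"
    using expectation_recall[OF assms(1,2)] by auto
qed

lemma step_measurable_M: "X n \<in> borel_measurable M"
  using step_measurable[of n n] by (intro measurable_from_subalg[OF block_subalgebra[OF past_subset]]) auto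

text \<open>A square is recalled from time \<open>j\<close> with weight
  \<open>p * \<mu> j / nu \<mu> n\<close>, and these weights sum to \<open>p\<close>; the innovation
  supplies the remaining \<open>1 - p\<close>. Unit second moments therefore reproduce
  themselves.\<close>

lemma step_second_moment:
  "integrable M (\<lambda>\<omega>. (X n \<omega>)\<^sup>2) \<and> (n \<ge> 1 \<longrightarrow> expectation (\<lambda>\<omega>. (X n \<omega>)\<^sup>2) = 1)"
proof (induction n rule: less_induct)
  case (less k)
  consider "k = 0" | "k = 1" | n where "k = Suc n" "n \<ge> 1"
    by (cases k) force+
  then show ?case
  proof cases
    case 2
    then show ?thesis using xi_moments(4,5)[of 1] by (simp add: step_1)
  next
    case 3
    have IH: "integrable M (\<lambda>\<omega>. (X j \<omega>)\<^sup>2)" "expectation (\<lambda>\<omega>. (X j \<omega>)\<^sup>2) = 1" if "j \<in> {1..n}" for j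
      using less.IH[of j] that 3 by auto
    have r: "integrable M (\<lambda>\<omega>. recall (Suc n) j \<omega> * (X j \<omega>)\<^sup>2)"
      "expectation (\<lambda>\<omega>. recall (Suc n) j \<omega> * (X j \<omega>)\<^sup>2) = p * \<mu> j / nu \<mu> n" if "j \<in> {1..n}" for j
    proof -
      have "(\<lambda>\<omega>. (X j \<omega>)\<^sup>2) \<in> borel_measurable (block (past n))"
        using step_measurable[of j n] that by auto
      from expectation_past_recall[OF 3(2) that this IH(1)[OF that]]
      show "integrable M (\<lambda>\<omega>. recall (Suc n) j \<omega> * (X j \<omega>)\<^sup>2)"
        "expectation (\<lambda>\<omega>. recall (Suc n) j \<omega> * (X j \<omega>)\<^sup>2) = p * \<mu> j / nu \<mu> n"
        by (simp_all add: mult.commute[of "recall _ _ _"] IH(2)[OF that])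
    qed
    have f: "integrable M (\<lambda>\<omega>. fresh (Suc n) \<omega> * (\<xi> (Suc n) \<omega>)\<^sup>2)"
      "expectation (\<lambda>\<omega>. fresh (Suc n) \<omega> * (\<xi> (Suc n) \<omega>)\<^sup>2) = 1 - p"
      using expectation_fresh_mult[of "Suc n" "\<lambda>x. x\<^sup>2"] xi_moments[of "Suc n"] 3 by simp_all
    have "expectation (\<lambda>\<omega>. (X k \<omega>)\<^sup>2) = (\<Sum>j=1..n. p * \<mu> j / nu \<mu> n) + (1 - p)"
      unfolding 3(1) step_Suc_square[OF 3(2)]
      using r f by (subst Bochner_Integration.integral_add) (auto simp: Bochner_Integration.integral_sum)
    also have "(\<Sum>j=1..n. p * \<mu> j / nu \<mu> n) = p * nu \<mu> n / nu \<mu> n"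
      unfolding nu_def by (simp only: sum_distrib_left sum_divide_distrib)
    also have "\<dots> = p" using nu_pos[OF 3(2)] by simp
    finally have "expectation (\<lambda>\<omega>. (X k \<omega>)\<^sup>2) = 1" by simp
    moreover have "integrable M (\<lambda>\<omega>. (X k \<omega>)\<^sup>2)"
      unfolding 3(1) step_Suc_square[OF 3(2)]
      by (intro Bochner_Integration.integrable_add Bochner_Integration.integrable_sum r f)
    ultimately show ?thesis by simp
  qed simp
qed

lemma step_sq_int: "square_integrable M (X n)"
  using step_second_moment step_measurable_M by (simp add: square_integrable_def)

lemma weighted_sum_sq_int: "square_integrable M (weighted_sum n)"
  unfolding weighted_sum_def by (intro square_integrable_sum square_integrable_cmult step_sq_int)

lemma weighted_sum_measurable: "m \<le> n \<Longrightarrow> weighted_sum m \<in> borel_measurable (block (past n))"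
  unfolding weighted_sum_def
  by (intro borel_measurable_sum borel_measurable_times borel_measurable_const step_measurable) auto

lemma noise_Suc: "noise (Suc n) \<omega> = X (Suc n) \<omega> - (p / nu \<mu> n) * weighted_sum n \<omega>"
  by (simp add: noise_def)

lemma noise_sq_int: "square_integrable M (noise n)"
  unfolding noise_def
  using square_integrable_diff[OF step_sq_int square_integrable_cmult[OF weighted_sum_sq_int, of "p / nu \<mu> (n - 1)" "n - 1"]]
  by simp

text \<open>Given the past, step \<open>Suc n\<close> has mean \<open>p / nu \<mu> n\<close> times
  the weighted sum, which is what \<open>noise\<close> subtracts. Tested against \<open>H\<close>,
  the recalled part matches this term by term and the innovation part has mean zero.\<close>

lemma noise_orthogonal:
  assumes H: "H \<in> borel_measurable (block (past n))" and sq: "square_integrable M H"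
  shows "expectation (\<lambda>\<omega>. H \<omega> * noise (Suc n) \<omega>) = 0"
proof -
  have intH: "integrable M H"
    using square_integrable_mult[OF sq, of "\<lambda>_. 1"] by (simp add: square_integrable_def)
  show ?thesis
  proof (cases "n = 0")
    \<comment> \<open>The step at time 1 is the innovation itself, with neither recollection nor
      recalled time.\<close>
    case True
    have "expectation (\<lambda>\<omega>. H \<omega> * \<xi> 1 \<omega>) = expectation H * expectation (\<xi> 1)"
      using block_measurable_source(1)[of "(Innovation, 1)" "present (Suc n)"] in_present(1)[of 1] True xi_moments(2)[of 1]
      by (intro block_expectation_mult[OF past_subset present_subset past_present_disjoint H _ intH]) auto
    then show ?thesis using True xi_moments(3)[of 1] by (simp add: noise_Suc step_1 weighted_sum_def)
  next
    case False
    then have n: "n \<ge> 1" by simp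
    have r: "integrable M (\<lambda>\<omega>. H \<omega> * (recall (Suc n) j \<omega> * X j \<omega>))"
      "expectation (\<lambda>\<omega>. H \<omega> * (recall (Suc n) j \<omega> * X j \<omega>)) = p / nu \<mu> n * (\<mu> j * expectation (\<lambda>\<omega>. H \<omega> * X j \<omega>))"
      if "j \<in> {1..n}" for j
    proof -
      have "(\<lambda>\<omega>. H \<omega> * X j \<omega>) \<in> borel_measurable (block (past n))"
        using step_measurable[of j n] that H by auto
      from expectation_past_recall[OF n that this square_integrable_mult[OF sq step_sq_int]]
      show "integrable M (\<lambda>\<omega>. H \<omega> * (recall (Suc n) j \<omega> * X j \<omega>))"
        "expectation (\<lambda>\<omega>. H \<omega> * (recall (Suc n) j \<omega> * X j \<omega>)) = p / nu \<mu> n * (\<mu> j * expectation (\<lambda>\<omega>. H \<omega> * X j \<omega>))"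
        by (simp_all add: mult_ac)
    qed
    have fm: "(\<lambda>\<omega>. fresh (Suc n) \<omega> * \<xi> (Suc n) \<omega>) \<in> borel_measurable (block (present (Suc n)))"
      using fresh_measurable[of "Suc n" "present (Suc n)"] block_measurable_source(1)[OF in_present(1)[of "Suc n"]]
        in_present(2)[of "Suc n"] n by auto
    have fi: "integrable M (\<lambda>\<omega>. fresh (Suc n) \<omega> * \<xi> (Suc n) \<omega>)"
      "expectation (\<lambda>\<omega>. fresh (Suc n) \<omega> * \<xi> (Suc n) \<omega>) = 0"
      using expectation_fresh_mult[of "Suc n" "\<lambda>x. x"] xi_moments[of "Suc n"] n by simp_all
    have f: "integrable M (\<lambda>\<omega>. H \<omega> * (fresh (Suc n) \<omega> * \<xi> (Suc n) \<omega>))"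
      "expectation (\<lambda>\<omega>. H \<omega> * (fresh (Suc n) \<omega> * \<xi> (Suc n) \<omega>)) = 0"
      using block_expectation_mult[OF past_subset present_subset past_present_disjoint H fm intH fi(1)] fi(2)
      by simp_all
    have HX: "integrable M (\<lambda>\<omega>. H \<omega> * X j \<omega>)" for j by (rule square_integrable_mult[OF sq step_sq_int])
    have "H \<omega> * noise (Suc n) \<omega> = (\<Sum>j=1..n. H \<omega> * (recall (Suc n) j \<omega> * X j \<omega>)) +
        H \<omega> * (fresh (Suc n) \<omega> * \<xi> (Suc n) \<omega>) - p / nu \<mu> n * (\<Sum>j=1..n. \<mu> j * (H \<omega> * X j \<omega>))" for \<omega>
      unfolding noise_Suc step_Suc[OF n] weighted_sum_def
      by (simp add: sum_distrib_left algebra_simps)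
    moreover have "integrable M (\<lambda>\<omega>. \<Sum>j=1..n. H \<omega> * (recall (Suc n) j \<omega> * X j \<omega>))"
      by (intro Bochner_Integration.integrable_sum r)
    moreover have "integrable M (\<lambda>\<omega>. p / nu \<mu> n * (\<Sum>j=1..n. \<mu> j * (H \<omega> * X j \<omega>)))"
      by (intro integrable_mult_right Bochner_Integration.integrable_sum HX)
    ultimately have "expectation (\<lambda>\<omega>. H \<omega> * noise (Suc n) \<omega>) =
        expectation (\<lambda>\<omega>. \<Sum>j=1..n. H \<omega> * (recall (Suc n) j \<omega> * X j \<omega>)) + 0
        - expectation (\<lambda>\<omega>. p / nu \<mu> n * (\<Sum>j=1..n. \<mu> j * (H \<omega> * X j \<omega>)))"
      using f by (simp only: Bochner_Integration.integral_add Bochner_Integration.integral_diff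
          Bochner_Integration.integrable_add)
    also have "expectation (\<lambda>\<omega>. \<Sum>j=1..n. H \<omega> * (recall (Suc n) j \<omega> * X j \<omega>)) =
        (\<Sum>j=1..n. p / nu \<mu> n * (\<mu> j * expectation (\<lambda>\<omega>. H \<omega> * X j \<omega>)))"
      using r by (subst Bochner_Integration.integral_sum) auto
    also have "expectation (\<lambda>\<omega>. p / nu \<mu> n * (\<Sum>j=1..n. \<mu> j * (H \<omega> * X j \<omega>))) =
        p / nu \<mu> n * (\<Sum>j=1..n. \<mu> j * expectation (\<lambda>\<omega>. H \<omega> * X j \<omega>))"
      using HX by simp
    finally have "expectation (\<lambda>\<omega>. H \<omega> * noise (Suc n) \<omega>) =
        (\<Sum>j=1..n. p / nu \<mu> n * (\<mu> j * expectation (\<lambda>\<omega>. H \<omega> * X j \<omega>))) + 0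
        - p / nu \<mu> n * (\<Sum>j=1..n. \<mu> j * expectation (\<lambda>\<omega>. H \<omega> * X j \<omega>))" .
    then show ?thesis by (simp add: sum_distrib_left)
  qed
qed

text \<open>Pythagoras: the compensator is a function of the past, so it is orthogonal to the noise
  and their second moments add up to that of the step.\<close>

lemma noise_second_moment: "expectation (\<lambda>\<omega>. (noise n \<omega>)\<^sup>2) \<le> 1"
proof (cases n)
  case 0
  then show ?thesis by (simp add: noise_def weighted_sum_def)
next
  case (Suc m)
  define W where "W = (\<lambda>\<omega>. (p / nu \<mu> m) * weighted_sum m \<omega>)"
  have Ws: "square_integrable M W" unfolding W_def by (intro square_integrable_cmult weighted_sum_sq_int)
  have Wm: "W \<in> borel_measurable (block (past m))"
    unfolding W_def using weighted_sum_measurable[of m m] by simp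
  have "(X n \<omega>)\<^sup>2 = (noise n \<omega>)\<^sup>2 + 2 * (W \<omega> * noise n \<omega>) + (W \<omega>)\<^sup>2" for \<omega>
    unfolding Suc noise_Suc W_def by (simp add: power2_eq_square algebra_simps)
  then have "expectation (\<lambda>\<omega>. (X n \<omega>)\<^sup>2) = expectation (\<lambda>\<omega>. (noise n \<omega>)\<^sup>2) + expectation (\<lambda>\<omega>. (W \<omega>)\<^sup>2)"
    using noise_sq_int[of n] Ws square_integrable_mult[OF Ws noise_sq_int[of n]] noise_orthogonal[OF Wm Ws] Suc
    by (simp add: square_integrable_def)
  moreover have "expectation (\<lambda>\<omega>. (W \<omega>)\<^sup>2) \<ge> 0" by simp
  moreover have "expectation (\<lambda>\<omega>. (X n \<omega>)\<^sup>2) = 1" using step_second_moment[of n] Suc by simp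
  ultimately show ?thesis by linarith
qed

sublocale noise: bounded_martingale_differences M "\<lambda>n. block (past n)" noise
proof
  show "subalgebra M (block (past n))" for n by (intro block_subalgebra past_subset)
  show "sets (block (past m)) \<subseteq> sets (block (past n))" if "m \<le> n" for m n
    using that by (intro block_mono) (auto simp: past_def)
  show "noise n \<in> borel_measurable (block (past n))" for n
    unfolding noise_def[abs_def] using step_measurable[of n n] weighted_sum_measurable[of "n - 1" n] by simp
qed (use noise_sq_int noise_second_moment noise_orthogonal in auto)

lemma mart_eq_transform:
  "srrw_mart p \<mu> \<xi> \<alpha> \<beta> n \<omega> = noise.transform (\<lambda>k. a_seq p \<mu> (Suc k) * \<mu> (Suc k)) n \<omega>"
proof (induction n)
  case (Suc n)
  have "srrw_mart p \<mu> \<xi> \<alpha> \<beta> (Suc n) \<omega> = a_seq p \<mu> (Suc n) * weighted_sum n \<omega> + a_seq p \<mu> (Suc n) * \<mu> (Suc n) * X (Suc n) \<omega>"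
    by (simp add: srrw_mart_def weighted_sum_def algebra_simps)
  also have "\<dots> = a_seq p \<mu> (Suc n) * (1 + p * (\<mu> (Suc n) / nu \<mu> n)) * weighted_sum n \<omega>
      + a_seq p \<mu> (Suc n) * \<mu> (Suc n) * noise (Suc n) \<omega>"
    by (simp add: noise_Suc algebra_simps)
  also have "\<dots> = srrw_mart p \<mu> \<xi> \<alpha> \<beta> n \<omega> + a_seq p \<mu> (Suc n) * \<mu> (Suc n) * noise (Suc n) \<omega>"
    unfolding a_Suc by (simp add: srrw_mart_def weighted_sum_def)
  finally show ?case by (simp add: noise.transform_Suc Suc)
qed (simp add: srrw_mart_def noise.transform_def)

text \<open>The compensator of step \<open>Suc k\<close> is \<open>p\<close> times the weighted sum
  divided by \<open>nu \<mu> k\<close>; expressing that sum through the martingale brings in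
  \<open>mart_weight k\<close>.\<close>

lemma walk_decomposition:
  "srrw_walk \<xi> \<alpha> \<beta> n \<omega> = noise.transform (\<lambda>_. 1) n \<omega> +
     p * (\<Sum>k<n. mart_weight k * srrw_mart p \<mu> \<xi> \<alpha> \<beta> k \<omega>)"
proof (induction n)
  case (Suc n)
  have "X (Suc n) \<omega> = noise (Suc n) \<omega> + p * (mart_weight n * srrw_mart p \<mu> \<xi> \<alpha> \<beta> n \<omega>)"
    using a_pos[of n] by (simp add: noise_Suc srrw_mart_def weighted_sum_def mart_weight_def)
  then show ?case using Suc by (simp add: srrw_walk_def noise.transform_Suc algebra_simps)
qed (simp add: srrw_walk_def noise.transform_def)

end

section \<open>Convergence of the rescaled walk\<close>

lemma unif_dist_le:
  assumes "\<And>t. t \<in> {0..T} \<Longrightarrow> \<bar>y t - z t\<bar> \<le> A + c * \<bar>u t - v t\<bar>" and "A \<ge> 0" "c \<ge> 0"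
  shows "unif_dist T y z \<le> ennreal A + ennreal c * unif_dist T u v"
  unfolding unif_dist_def
proof (rule SUP_least)
  fix t assume t: "t \<in> {0..T}"
  have "ennreal \<bar>y t - z t\<bar> \<le> ennreal (A + c * \<bar>u t - v t\<bar>)" using assms(1)[OF t] by (rule ennreal_leI)
  also have "\<dots> = ennreal A + ennreal c * ennreal \<bar>u t - v t\<bar>"
    using assms(2,3) by (simp add: ennreal_mult ennreal_plus)
  also have "\<dots> \<le> ennreal A + ennreal c * (SUP t\<in>{0..T}. ennreal \<bar>u t - v t\<bar>)"
    using t by (intro add_left_mono mult_left_mono SUP_upper) auto
  finally show "ennreal \<bar>y t - z t\<bar> \<le> ennreal A + ennreal c * (SUP t\<in>{0..T}. ennreal \<bar>u t - v t\<bar>)" .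
qed

text \<open>Bounding the sum by twice the larger term stays within \<open>ennreal\<close>, where the
  square of a difference is not at hand; hence 4 in place of the usual 2.\<close>

lemma ennreal_square_add_le: "(x + y)\<^sup>2 \<le> 4 * x\<^sup>2 + 4 * (y\<^sup>2 :: ennreal)"
proof -
  have *: "(x + y)\<^sup>2 \<le> 4 * x\<^sup>2" if "y \<le> x" for x y :: ennreal
  proof -
    have "(x + y)\<^sup>2 \<le> (2 * x)\<^sup>2" using that by (intro power_mono) (auto simp: mult_2)
    then show ?thesis by (simp add: power_mult_distrib)
  qed
  show ?thesis
  proof (cases "y \<le> x")
    case True
    then show ?thesis using * by (meson le_iff_add order_trans)
  next
    case False
    then have "(y + x)\<^sup>2 \<le> 4 * y\<^sup>2" using * by simp
    then show ?thesis by (metis add.commute le_iff_add order_trans)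
  qed
qed

lemma ennreal_square_tendsto_0:
  fixes f :: "'b \<Rightarrow> ennreal"
  assumes "(f \<longlongrightarrow> 0) F"
  shows "((\<lambda>x. (f x)\<^sup>2) \<longlongrightarrow> 0) F"
proof (rule tendsto_sandwich[OF _ _ tendsto_const assms])
  have "eventually (\<lambda>x. f x < 1) F" using assms by (rule order_tendstoD) simp
  then show "eventually (\<lambda>x. (f x)\<^sup>2 \<le> f x) F"
  proof eventually_elim
    case (elim x)
    then show ?case using mult_right_mono[of "f x" 1 "f x"] by (simp add: power2_eq_square)
  qed
qed auto

lemma weighted_sum_square_le:
  fixes w x :: "'b \<Rightarrow> real"
  assumes "\<And>k. k \<in> A \<Longrightarrow> w k \<ge> 0"
  shows "(\<Sum>k\<in>A. w k * x k)\<^sup>2 \<le> (\<Sum>k\<in>A. w k) * (\<Sum>k\<in>A. w k * (x k)\<^sup>2)"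
proof -
  have "(\<Sum>k\<in>A. w k * x k)\<^sup>2 = (\<Sum>k\<in>A. sqrt (w k) * (sqrt (w k) * x k))\<^sup>2"
    using assms by (intro arg_cong[where f = "\<lambda>s. s\<^sup>2"] sum.cong) (auto simp flip: mult.assoc)
  also have "\<dots> \<le> (\<Sum>k\<in>A. (sqrt (w k))\<^sup>2) * (\<Sum>k\<in>A. (sqrt (w k) * x k)\<^sup>2)"
    by (rule Cauchy_Schwarz_ineq_sum)
  also have "\<dots> = (\<Sum>k\<in>A. w k) * (\<Sum>k\<in>A. w k * (x k)\<^sup>2)"
    using assms by (intro arg_cong2[where f = times] sum.cong) (auto simp: power_mult_distrib)
  finally show ?thesis .
qed

locale srrw_rvm_square_summable = srrw_rvm_unit_variance +
  assumes v_seq_bounded: "bounded (range (v_seq p \<mu>))" and p_ge_crit: "p \<ge> p_crit \<gamma>"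
begin

sublocale square_summable_memory p \<gamma> \<mu>
  using v_seq_bounded p_ge_crit by unfold_locales

abbreviation mart where "mart \<equiv> srrw_mart p \<mu> \<xi> \<alpha> \<beta>"
abbreviation mart_limit where "mart_limit \<equiv> srrw_mart_lim p \<mu> \<xi> \<alpha> \<beta>"
abbreviation walk where "walk \<equiv> srrw_walk \<xi> \<alpha> \<beta>"

lemma mart_transform: "mart = noise.transform (\<lambda>k. scale (Suc k))"
  by (simp add: fun_eq_iff mart_eq_transform scale_def)

lemma mart_AE: "AE \<omega> in M. (\<lambda>n. mart n \<omega>) \<longlonglongrightarrow> mart_limit \<omega>"
  using noise.transform_AE_convergent[OF scale_square_summable]
  unfolding mart_transform[symmetric] srrw_mart_lim_def by (simp add: convergent_LIMSEQ_iff)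

lemma mart_L2: "converges_L2 M mart mart_limit"
  using noise.transform_lim_L2[OF scale_square_summable]
  unfolding mart_transform[symmetric] srrw_mart_lim_def[abs_def] by simp

lemma mart_sq_int: "square_integrable M (mart n)"
  unfolding mart_transform by (rule noise.transform_sq_int)

lemma mart_limit_sq_int: "square_integrable M mart_limit"
  using mart_L2 by (simp add: converges_L2_def square_integrable_def)

text \<open>Error of replacing the whole past of the martingale by its limit and dropping the noise.
  What is split off is a deterministic profile in time multiplied by a single random
  variable.\<close>

definition remainder :: "nat \<Rightarrow> 'a \<Rightarrow> real" where
  "remainder n \<omega> = walk n \<omega> - p * total_weight n * mart_limit \<omega>"

lemma remainder_eq:
  "remainder n \<omega> = noise.transform (\<lambda>_. 1) n \<omega> + p * (\<Sum>k<n. mart_weight k * (mart k \<omega> - mart_limit \<omega>))"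
  unfolding remainder_def walk_decomposition total_weight_def
  by (simp add: sum_subtractf right_diff_distrib sum_distrib_right)

lemma remainder_sq_int: "square_integrable M (remainder n)"
  unfolding remainder_eq[abs_def]
  by (intro square_integrable_add square_integrable_cmult square_integrable_sum square_integrable_diff
      mart_sq_int mart_limit_sq_int noise.transform_sq_int)

text \<open>Kronecker's lemma handles the noise, through the convergent series with square-summable
  coefficients \<open>1 / (1 + total_weight k)\<close>; the other part is a weighted average of a
  null sequence.\<close>

lemma remainder_AE: "AE \<omega> in M. (\<lambda>n. remainder n \<omega> / (1 + total_weight n)) \<longlonglongrightarrow> 0"
  using mart_AE noise.transform_AE_convergent[OF inverse_total_weight_square_summable]
proof eventually_elim
  case (elim \<omega>)
  have W: "1 + total_weight n > 0" for n using total_weight_nonneg[of n] by simp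
  have "(\<lambda>n. (\<Sum>k<n. noise (Suc k) \<omega>) / (1 + total_weight n)) \<longlonglongrightarrow> 0"
  proof (rule kronecker[OF succ_total_weight_incseq W succ_total_weight_at_top])
    show "summable (\<lambda>k. noise (Suc k) \<omega> / (1 + total_weight k))"
      using elim(2) by (simp add: summable_iff_convergent noise.transform_def)
  qed
  then have 1: "(\<lambda>n. noise.transform (\<lambda>_. 1) n \<omega> / (1 + total_weight n)) \<longlonglongrightarrow> 0"
    by (simp add: noise.transform_def)
  have 2: "(\<lambda>n. (\<Sum>k<n. mart_weight k * (mart k \<omega> - mart_limit \<omega>)) / (\<Sum>k<n. mart_weight k)) \<longlonglongrightarrow> 0"
    using elim(1) total_weight_at_top mart_weight_nonneg
    by (intro weighted_average_tendsto) (auto simp: total_weight_def[abs_def] LIM_zero)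
  have 3: "(\<lambda>n. (\<Sum>k<n. mart_weight k * (mart k \<omega> - mart_limit \<omega>)) / (1 + total_weight n)) \<longlonglongrightarrow> 0"
  proof (rule Lim_null_comparison[OF _ tendsto_rabs_zero[OF 2]])
    show "eventually (\<lambda>n. norm ((\<Sum>k<n. mart_weight k * (mart k \<omega> - mart_limit \<omega>)) / (1 + total_weight n))
      \<le> \<bar>(\<Sum>k<n. mart_weight k * (mart k \<omega> - mart_limit \<omega>)) / (\<Sum>k<n. mart_weight k)\<bar>) sequentially"
      using total_weight_eventually_pos
      by eventually_elim (auto simp: total_weight_def abs_divide intro!: divide_left_mono mult_pos_pos add_pos_pos)
  qed
  have "(\<lambda>n. noise.transform (\<lambda>_. 1) n \<omega> / (1 + total_weight n) +
      p * ((\<Sum>k<n. mart_weight k * (mart k \<omega> - mart_limit \<omega>)) / (1 + total_weight n))) \<longlonglongrightarrow> 0 + p * 0"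
    by (intro tendsto_intros 1 3)
  then show ?case by (simp add: remainder_eq add_divide_distrib)
qed

section \<open>Mean square control of the remainder, uniformly in time\<close>

definition mart_error :: "nat \<Rightarrow> real" where
  "mart_error k = expectation (\<lambda>\<omega>. (mart k \<omega> - mart_limit \<omega>)\<^sup>2)"

lemma mart_diff_sq_int: "square_integrable M (\<lambda>\<omega>. mart k \<omega> - mart_limit \<omega>)"
  by (intro square_integrable_diff mart_sq_int mart_limit_sq_int)

lemma mart_error_tendsto: "mart_error \<longlonglongrightarrow> 0"
proof -
  have "(\<lambda>n. ennreal (mart_error n)) \<longlonglongrightarrow> ennreal 0"
    using mart_L2 mart_diff_sq_int
    by (simp add: converges_L2_def mart_error_def square_integrable_def nn_integral_eq_integral)
  then show ?thesis
    by (rule tendsto_ennrealD) (auto simp: mart_error_def)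
qed

text \<open>The noise is bounded by Doob's inequality, with \<open>8 = 2 * 4\<close>. The weighted
  part is dominated by the sum of absolute values up to \<open>n\<close>, which does not depend on
  the earlier time; Cauchy-Schwarz then extracts one factor of the total weight.\<close>

lemma remainder_maximal:
  "expectation (\<lambda>\<omega>. (running_max (\<lambda>k. remainder k \<omega>) n)\<^sup>2)
    \<le> 8 * real n + 2 * (total_weight n * (\<Sum>k<n. mart_weight k * mart_error k))"
proof -
  let ?L = "\<lambda>\<omega>. running_max (\<lambda>k. noise.transform (\<lambda>_. 1) k \<omega>) n"
  let ?d = "\<lambda>k \<omega>. mart k \<omega> - mart_limit \<omega>"
  have pw: "(running_max (\<lambda>k. remainder k \<omega>) n)\<^sup>2
      \<le> 2 * (?L \<omega>)\<^sup>2 + 2 * (total_weight n * (\<Sum>k<n. mart_weight k * (?d k \<omega>)\<^sup>2))" for \<omega>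
  proof -
    let ?S = "\<Sum>k<n. mart_weight k * \<bar>?d k \<omega>\<bar>"
    have "running_max (\<lambda>k. remainder k \<omega>) n \<le> ?L \<omega> + ?S"
    proof (rule running_max_le)
      fix m assume m: "m \<le> n"
      have "\<bar>p * (\<Sum>k<m. mart_weight k * ?d k \<omega>)\<bar> \<le> 1 * \<bar>\<Sum>k<m. mart_weight k * ?d k \<omega>\<bar>"
        unfolding abs_mult using p_range by (intro mult_right_mono) auto
      also have "\<dots> \<le> (\<Sum>k<m. mart_weight k * \<bar>?d k \<omega>\<bar>)"
        using sum_abs[of "\<lambda>k. mart_weight k * ?d k \<omega>" "{..<m}"] mart_weight_nonneg by (simp add: abs_mult)
      also have "\<dots> \<le> ?S" using m mart_weight_nonneg by (intro sum_mono2) auto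
      finally show "\<bar>remainder m \<omega>\<bar> \<le> ?L \<omega> + ?S"
        using running_max_ge[OF m, of "\<lambda>k. noise.transform (\<lambda>_. 1) k \<omega>"]
        unfolding remainder_eq by linarith
    qed
    then have "(running_max (\<lambda>k. remainder k \<omega>) n)\<^sup>2 \<le> (?L \<omega> + ?S)\<^sup>2"
      using running_max_nonneg by (intro power_mono)
    also have "\<dots> \<le> 2 * (?L \<omega>)\<^sup>2 + 2 * ?S\<^sup>2"
      using sum_squares_bound[of "?L \<omega>" ?S] by (simp add: power2_sum)
    also have "?S\<^sup>2 \<le> total_weight n * (\<Sum>k<n. mart_weight k * (?d k \<omega>)\<^sup>2)"
      using weighted_sum_square_le[of "{..<n}" mart_weight "\<lambda>k. \<bar>?d k \<omega>\<bar>"] mart_weight_nonneg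
      by (simp add: total_weight_def)
    finally show ?thesis by simp
  qed
  have iL: "integrable M (\<lambda>\<omega>. (?L \<omega>)\<^sup>2)"
    using noise.running_max_sq_int by (simp add: square_integrable_def)
  have id: "integrable M (\<lambda>\<omega>. (?d k \<omega>)\<^sup>2)" for k
    using mart_diff_sq_int by (simp add: square_integrable_def)
  have "expectation (\<lambda>\<omega>. (running_max (\<lambda>k. remainder k \<omega>) n)\<^sup>2) \<le>
    expectation (\<lambda>\<omega>. 2 * (?L \<omega>)\<^sup>2 + 2 * (total_weight n * (\<Sum>k<n. mart_weight k * (?d k \<omega>)\<^sup>2)))"
  proof (rule integral_mono[OF _ _ pw])
    show "integrable M (\<lambda>\<omega>. (running_max (\<lambda>k. remainder k \<omega>) n)\<^sup>2)"
      using square_integrable_running_max[of M remainder, OF remainder_sq_int] by (simp add: square_integrable_def)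
    show "integrable M (\<lambda>\<omega>. 2 * (?L \<omega>)\<^sup>2 + 2 * (total_weight n * (\<Sum>k<n. mart_weight k * (?d k \<omega>)\<^sup>2)))"
      using iL id by (intro Bochner_Integration.integrable_add integrable_mult_right Bochner_Integration.integrable_sum)
  qed
  also have "\<dots> = 2 * expectation (\<lambda>\<omega>. (?L \<omega>)\<^sup>2) + 2 * (total_weight n * (\<Sum>k<n. mart_weight k * mart_error k))"
    using iL id by (simp add: mart_error_def)
  also have "expectation (\<lambda>\<omega>. (?L \<omega>)\<^sup>2) \<le> 4 * real n"
    using noise.doob_L2[of "\<lambda>_. 1" n] by simp
  finally show ?thesis by simp
qed

lemma scaled_remainder_L2:
  assumes T: "T > 0"
  shows "(\<lambda>n. \<integral>\<^sup>+\<omega>. ennreal ((scale n * running_max (\<lambda>k. remainder k \<omega>) (nat \<lfloor>real n * T\<rfloor>))\<^sup>2) \<partial>M) \<longlonglongrightarrow> 0"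
proof -
  define N where "N = (\<lambda>n. nat \<lfloor>real n * T\<rfloor>)"
  have N_top: "filterlim N at_top sequentially" unfolding N_def using T by (rule floor_time_at_top)
  define A where "A = (\<lambda>n. (\<Sum>k<n. mart_weight k * mart_error k) / (\<Sum>k<n. mart_weight k))"
  have "A \<longlonglongrightarrow> 0" unfolding A_def
    using mart_weight_nonneg total_weight_at_top mart_error_tendsto
    by (intro weighted_average_tendsto) (auto simp: total_weight_def[abs_def])
  then have A: "(\<lambda>n. A (N n)) \<longlonglongrightarrow> 0" using N_top by (rule filterlim_compose)
  \<comment> \<open>The first term vanishes because \<open>n * (scale n)\<^sup>2\<close> does; in
    the second a convergent square multiplies the averaged error, which tends to 0.\<close>
  define R where "R = (\<lambda>n. 8 * T * (real n * (scale n)\<^sup>2) + 2 * ((scale n * total_weight (N n))\<^sup>2 * A (N n)))"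
  have "R \<longlonglongrightarrow> 8 * T * 0 + 2 * (((\<gamma> + 1) / kappa * T powr kappa)\<^sup>2 * 0)"
    unfolding R_def N_def
    by (intro tendsto_add tendsto_mult tendsto_power tendsto_const linear_scale_square_tendsto
        scale_total_weight_pointwise A[unfolded N_def] less_imp_le[OF T])
  then have "(\<lambda>n. ennreal (R n)) \<longlonglongrightarrow> ennreal 0" by (intro tendsto_ennrealI) simp
  then have R: "(\<lambda>n. ennreal (R n)) \<longlonglongrightarrow> 0" by simp
  show ?thesis
  proof (rule tendsto_sandwich[OF _ _ tendsto_const R])
    have "eventually (\<lambda>n. total_weight (N n) > 0) sequentially"
      using total_weight_eventually_pos N_top by (rule eventually_compose_filterlim)
    then show "eventually (\<lambda>n. (\<integral>\<^sup>+\<omega>. ennreal ((scale n * running_max (\<lambda>k. remainder k \<omega>) (nat \<lfloor>real n * T\<rfloor>))\<^sup>2) \<partial>M)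
        \<le> ennreal (R n)) sequentially"
    proof eventually_elim
      case (elim n)
      have i: "integrable M (\<lambda>\<omega>. (scale n * running_max (\<lambda>k. remainder k \<omega>) (N n))\<^sup>2)"
        using square_integrable_cmult[OF square_integrable_running_max[of M remainder, OF remainder_sq_int]]
        by (simp add: square_integrable_def)
      have "expectation (\<lambda>\<omega>. (scale n * running_max (\<lambda>k. remainder k \<omega>) (N n))\<^sup>2)
          = (scale n)\<^sup>2 * expectation (\<lambda>\<omega>. (running_max (\<lambda>k. remainder k \<omega>) (N n))\<^sup>2)"
        by (simp add: power_mult_distrib)
      also have "\<dots> \<le> (scale n)\<^sup>2 * (8 * real (N n) +
          2 * (total_weight (N n) * (\<Sum>k<N n. mart_weight k * mart_error k)))"
        by (intro mult_left_mono remainder_maximal) auto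
      also have "(\<Sum>k<N n. mart_weight k * mart_error k) = total_weight (N n) * A (N n)"
        using elim by (simp add: A_def total_weight_def)
      also have "(scale n)\<^sup>2 * (8 * real (N n) + 2 * (total_weight (N n) * (total_weight (N n) * A (N n))))
         = 8 * real (N n) * (scale n)\<^sup>2 + 2 * ((scale n * total_weight (N n))\<^sup>2 * A (N n))"
        by (simp add: power2_eq_square algebra_simps)
      also have "\<dots> \<le> 8 * (real n * T) * (scale n)\<^sup>2 + 2 * ((scale n * total_weight (N n))\<^sup>2 * A (N n))"
        using T by (intro add_right_mono mult_right_mono mult_left_mono) (auto simp: N_def of_nat_floor)
      also have "\<dots> = R n" by (simp add: R_def mult_ac)
      finally have "expectation (\<lambda>\<omega>. (scale n * running_max (\<lambda>k. remainder k \<omega>) (N n))\<^sup>2) \<le> R n" .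
      then have "(\<integral>\<^sup>+\<omega>. ennreal ((scale n * running_max (\<lambda>k. remainder k \<omega>) (N n))\<^sup>2) \<partial>M) \<le> ennreal (R n)"
        using i by (subst nn_integral_eq_integral) (auto intro: ennreal_leI)
      then show ?case by (simp add: N_def)
    qed
  qed auto
qed

abbreviation rescaled_walk where
  "rescaled_walk n t \<omega> \<equiv> a_seq p \<mu> n * \<mu> n * walk (nat \<lfloor>real n * t\<rfloor>) \<omega>"

abbreviation limit_process where
  "limit_process t \<omega> \<equiv> p * (\<gamma> + 1) / (p * (\<gamma> + 1) - \<gamma>) * t powr (p * (\<gamma> + 1) - \<gamma>) * mart_limit \<omega>"

definition profile_dist :: "real \<Rightarrow> nat \<Rightarrow> ennreal" where
  "profile_dist T n = unif_dist T (\<lambda>t. scale n * total_weight (nat \<lfloor>real n * t\<rfloor>))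
     (\<lambda>t. (\<gamma> + 1) / kappa * t powr kappa)"

lemma profile_dist_tendsto: "T > 0 \<Longrightarrow> profile_dist T \<longlonglongrightarrow> 0"
  unfolding profile_dist_def[abs_def] by (rule scale_total_weight_unif)

text \<open>Randomness and time are separated: the profile distance is deterministic and multiplied
  by the limit variable, while the remainder enters through its maximum only. Either mode of
  convergence then follows from this one bound.\<close>

lemma process_dist_le:
  assumes "n \<ge> 1"
  shows "unif_dist T (\<lambda>t. rescaled_walk n t \<omega>) (\<lambda>t. limit_process t \<omega>)
    \<le> ennreal (scale n * running_max (\<lambda>k. remainder k \<omega>) (nat \<lfloor>real n * T\<rfloor>))
      + ennreal (p * \<bar>mart_limit \<omega>\<bar>) * profile_dist T n"
  unfolding profile_dist_def
proof (rule unif_dist_le)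
  show "0 \<le> scale n * running_max (\<lambda>k. remainder k \<omega>) (nat \<lfloor>real n * T\<rfloor>)"
    by (intro mult_nonneg_nonneg less_imp_le[OF scale_pos[OF assms]] running_max_nonneg)
  show "0 \<le> p * \<bar>mart_limit \<omega>\<bar>" using p_range by simp
  fix t assume t: "t \<in> {0..T}"
  define m where "m = nat \<lfloor>real n * t\<rfloor>"
  define F where "F = (\<gamma> + 1) / kappa * t powr kappa"
  have "m \<le> nat \<lfloor>real n * T\<rfloor>" unfolding m_def using t by (intro nat_mono floor_mono mult_left_mono) auto
  then have "\<bar>remainder m \<omega>\<bar> \<le> running_max (\<lambda>k. remainder k \<omega>) (nat \<lfloor>real n * T\<rfloor>)"
    by (rule running_max_ge)
  then have r: "scale n * \<bar>remainder m \<omega>\<bar> \<le> scale n * running_max (\<lambda>k. remainder k \<omega>) (nat \<lfloor>real n * T\<rfloor>)"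
    using scale_pos[OF assms] by (intro mult_left_mono) auto
  have "rescaled_walk n t \<omega> - limit_process t \<omega> = scale n * walk m \<omega> - p * F * mart_limit \<omega>"
    by (simp add: scale_def m_def F_def kappa_def)
  then have eq: "rescaled_walk n t \<omega> - limit_process t \<omega>
      = scale n * remainder m \<omega> + p * mart_limit \<omega> * (scale n * total_weight m - F)"
    unfolding remainder_def by (simp add: algebra_simps)
  have "\<bar>rescaled_walk n t \<omega> - limit_process t \<omega>\<bar>
      \<le> scale n * \<bar>remainder m \<omega>\<bar> + p * \<bar>mart_limit \<omega>\<bar> * \<bar>scale n * total_weight m - F\<bar>"
    unfolding eq
    using abs_triangle_ineq[of "scale n * remainder m \<omega>" "p * mart_limit \<omega> * (scale n * total_weight m - F)"]
      scale_pos[OF assms] p_range by (simp add: abs_mult)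
  from order_trans[OF this add_right_mono[OF r]]
  show "\<bar>rescaled_walk n t \<omega> - limit_process t \<omega>\<bar>
      \<le> scale n * running_max (\<lambda>k. remainder k \<omega>) (nat \<lfloor>real n * T\<rfloor>) + p * \<bar>mart_limit \<omega>\<bar> *
        \<bar>scale n * total_weight (nat \<lfloor>real n * t\<rfloor>) - (\<gamma> + 1) / kappa * t powr kappa\<bar>"
    unfolding m_def F_def .
qed

lemma rescaled_walk_AE: "converges_AE_D M rescaled_walk limit_process"
  unfolding converges_AE_D_def
proof (intro allI impI)
  fix T :: real assume T: "T > 0"
  show "AE \<omega> in M. (\<lambda>n. unif_dist T (\<lambda>t. rescaled_walk n t \<omega>) (\<lambda>t. limit_process t \<omega>)) \<longlonglongrightarrow> 0"
    using remainder_AE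
  proof eventually_elim
    case (elim \<omega>)
    have "(\<lambda>n. ennreal (scale n * running_max (\<lambda>k. remainder k \<omega>) (nat \<lfloor>real n * T\<rfloor>))) \<longlonglongrightarrow> ennreal 0"
      by (intro tendsto_ennrealI scaled_running_max_tendsto elim T)
    moreover have "(\<lambda>n. ennreal (p * \<bar>mart_limit \<omega>\<bar>) * profile_dist T n) \<longlonglongrightarrow> ennreal (p * \<bar>mart_limit \<omega>\<bar>) * 0"
      by (intro ennreal_tendsto_cmult profile_dist_tendsto T) simp
    ultimately have lim: "(\<lambda>n. ennreal (scale n * running_max (\<lambda>k. remainder k \<omega>) (nat \<lfloor>real n * T\<rfloor>))
        + ennreal (p * \<bar>mart_limit \<omega>\<bar>) * profile_dist T n) \<longlonglongrightarrow> ennreal 0 + ennreal (p * \<bar>mart_limit \<omega>\<bar>) * 0"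
      by (rule tendsto_add)
    then have lim: "(\<lambda>n. ennreal (scale n * running_max (\<lambda>k. remainder k \<omega>) (nat \<lfloor>real n * T\<rfloor>))
        + ennreal (p * \<bar>mart_limit \<omega>\<bar>) * profile_dist T n) \<longlonglongrightarrow> 0" by simp
    show ?case
      by (rule tendsto_sandwich[OF _ eventually_sequentiallyI[of 1, OF process_dist_le] tendsto_const lim]) simp_all
  qed
qed

lemma rescaled_walk_L2: "converges_L2_D M rescaled_walk limit_process"
  unfolding converges_L2_D_def
proof (intro allI impI)
  fix T :: real assume T: "T > 0"
  let ?r = "\<lambda>n \<omega>. scale n * running_max (\<lambda>k. remainder k \<omega>) (nat \<lfloor>real n * T\<rfloor>)"
  let ?I = "\<integral>\<^sup>+\<omega>. ennreal ((p * mart_limit \<omega>)\<^sup>2) \<partial>M"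
  have sq: "square_integrable M (\<lambda>\<omega>. p * mart_limit \<omega>)"
    by (intro square_integrable_cmult mart_limit_sq_int)
  have "?I = ennreal (expectation (\<lambda>\<omega>. (p * mart_limit \<omega>)\<^sup>2))"
    by (rule nn_integral_eq_integral) (use sq in \<open>simp_all add: square_integrable_def\<close>)
  then have fin: "?I < top" by simp
  have rm: "(\<lambda>\<omega>. running_max (\<lambda>k. remainder k \<omega>) N) \<in> borel_measurable M" for N
    using square_integrable_running_max[of M remainder, OF remainder_sq_int] by (simp add: square_integrable_def)
  have le: "(\<integral>\<^sup>+\<omega>. (unif_dist T (\<lambda>t. rescaled_walk n t \<omega>) (\<lambda>t. limit_process t \<omega>))\<^sup>2 \<partial>M)
      \<le> 4 * (\<integral>\<^sup>+\<omega>. ennreal ((?r n \<omega>)\<^sup>2) \<partial>M) + 4 * (?I * (profile_dist T n)\<^sup>2)" if n: "n \<ge> 1" for n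
  proof -
    have "(\<integral>\<^sup>+\<omega>. (unif_dist T (\<lambda>t. rescaled_walk n t \<omega>) (\<lambda>t. limit_process t \<omega>))\<^sup>2 \<partial>M)
      \<le> (\<integral>\<^sup>+\<omega>. 4 * ennreal ((?r n \<omega>)\<^sup>2) + 4 * (ennreal ((p * mart_limit \<omega>)\<^sup>2) * (profile_dist T n)\<^sup>2) \<partial>M)"
    \<comment> \<open>The comparison is pointwise, so a supremum over uncountably many times may
      stand on the left; measurability is established for the dominating functions.\<close>
    proof (rule nn_integral_mono)
      fix \<omega>
      have "(unif_dist T (\<lambda>t. rescaled_walk n t \<omega>) (\<lambda>t. limit_process t \<omega>))\<^sup>2
        \<le> (ennreal (?r n \<omega>) + ennreal (p * \<bar>mart_limit \<omega>\<bar>) * profile_dist T n)\<^sup>2"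
        by (intro power_mono process_dist_le n) auto
      also have "\<dots> \<le> 4 * (ennreal (?r n \<omega>))\<^sup>2 + 4 * (ennreal (p * \<bar>mart_limit \<omega>\<bar>) * profile_dist T n)\<^sup>2"
        by (rule ennreal_square_add_le)
      also have "(ennreal (?r n \<omega>))\<^sup>2 = ennreal ((?r n \<omega>)\<^sup>2)"
        by (intro ennreal_power mult_nonneg_nonneg less_imp_le[OF scale_pos[OF n]] running_max_nonneg)
      also have "(ennreal (p * \<bar>mart_limit \<omega>\<bar>) * profile_dist T n)\<^sup>2
          = ennreal ((p * mart_limit \<omega>)\<^sup>2) * (profile_dist T n)\<^sup>2"
        using p_range by (simp add: power_mult_distrib ennreal_power)
      finally show "(unif_dist T (\<lambda>t. rescaled_walk n t \<omega>) (\<lambda>t. limit_process t \<omega>))\<^sup>2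
        \<le> 4 * ennreal ((?r n \<omega>)\<^sup>2) + 4 * (ennreal ((p * mart_limit \<omega>)\<^sup>2) * (profile_dist T n)\<^sup>2)" .
    qed
    also have "\<dots> = 4 * (\<integral>\<^sup>+\<omega>. ennreal ((?r n \<omega>)\<^sup>2) \<partial>M) + 4 * (?I * (profile_dist T n)\<^sup>2)"
    proof -
      have "(\<lambda>\<omega>. ennreal ((?r n \<omega>)\<^sup>2)) \<in> borel_measurable M"
        using rm[of "nat \<lfloor>real n * T\<rfloor>"] by measurable
      moreover have "(\<lambda>\<omega>. ennreal ((p * mart_limit \<omega>)\<^sup>2)) \<in> borel_measurable M"
        using sq by (auto simp: square_integrable_def)
      ultimately show ?thesis by (simp add: nn_integral_add nn_integral_cmult nn_integral_multc)
    qed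
    finally show ?thesis .
  qed
  have I: "(\<lambda>n. ?I * (profile_dist T n)\<^sup>2) \<longlonglongrightarrow> ?I * 0"
    by (intro ennreal_tendsto_cmult ennreal_square_tendsto_0 profile_dist_tendsto T fin)
  have "(\<lambda>n. 4 * (\<integral>\<^sup>+\<omega>. ennreal ((?r n \<omega>)\<^sup>2) \<partial>M) + 4 * (?I * (profile_dist T n)\<^sup>2)) \<longlonglongrightarrow> 4 * 0 + 4 * (?I * 0)"
    by (intro tendsto_add ennreal_tendsto_cmult[OF _ scaled_remainder_L2[OF T]] ennreal_tendsto_cmult[OF _ I]) simp_all
  then have lim: "(\<lambda>n. 4 * (\<integral>\<^sup>+\<omega>. ennreal ((?r n \<omega>)\<^sup>2) \<partial>M) + 4 * (?I * (profile_dist T n)\<^sup>2)) \<longlonglongrightarrow> 0"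
    by simp
  show "(\<lambda>n. \<integral>\<^sup>+\<omega>. (unif_dist T (\<lambda>t. rescaled_walk n t \<omega>) (\<lambda>t. limit_process t \<omega>))\<^sup>2 \<partial>M) \<longlonglongrightarrow> 0"
    by (rule tendsto_sandwich[OF _ eventually_sequentiallyI[of 1, OF le] tendsto_const lim]) simp_all
qed

end

theorem theorem2p8:
  fixes M :: "'a measure" and p \<gamma> :: real and \<mu> :: "nat \<Rightarrow> real"
    and \<xi> :: "nat \<Rightarrow> 'a \<Rightarrow> real" and \<alpha> :: "nat \<Rightarrow> 'a \<Rightarrow> bool" and \<beta> :: "nat \<Rightarrow> 'a \<Rightarrow> nat"
  assumes "srrw_rvm M p \<gamma> \<mu> \<xi> \<alpha> \<beta>"
    and "integrable M (\<lambda>\<omega>. (\<xi> 1 \<omega>)\<^sup>2)"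
    and "(\<integral>\<omega>. (\<xi> 1 \<omega>)\<^sup>2 \<partial>M) = 1"
    and "bounded (range (v_seq p \<mu>))"
    and "p \<in> {p_crit \<gamma>..1}"
  shows "converges_AE M (srrw_mart p \<mu> \<xi> \<alpha> \<beta>) (srrw_mart_lim p \<mu> \<xi> \<alpha> \<beta>) \<and>
    converges_L2 M (srrw_mart p \<mu> \<xi> \<alpha> \<beta>) (srrw_mart_lim p \<mu> \<xi> \<alpha> \<beta>) \<and>
    (let Y = (\<lambda>n t \<omega>. a_seq p \<mu> n * \<mu> n * srrw_walk \<xi> \<alpha> \<beta> (nat \<lfloor>real n * t\<rfloor>) \<omega>);
         Z = (\<lambda>t \<omega>. p * (\<gamma> + 1) / (p * (\<gamma> + 1) - \<gamma>) * t powr (p * (\<gamma> + 1) - \<gamma>)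
                      * srrw_mart_lim p \<mu> \<xi> \<alpha> \<beta> \<omega>)
     in converges_L2_D M Y Z \<and> converges_AE_D M Y Z)"
proof -
  interpret srrw_rvm M p \<gamma> \<mu> \<xi> \<alpha> \<beta> by fact
  interpret srrw_rvm_square_summable M p \<gamma> \<mu> \<xi> \<alpha> \<beta>
    using assms(2-5) by unfold_locales auto
  show ?thesis
    unfolding Let_def converges_AE_def
    by (intro conjI mart_AE mart_L2 rescaled_walk_L2 rescaled_walk_AE)
qed

end
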